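(* Let $f,g,h,R$ satisfy the standing assumptions on the data listed in the context, let $v^*$ be the optimal value function, let $\Omega\subset\mathbb{R}^{N}$ be a domain containing the origin, and let $(X_n)_{n\in\mathbb{N}}$ be a nested (increasing) sequence of finite subsets of $\Omega\setminus\{0\}$ whose union is dense in $\Omega$. Let $k:\Omega\times\Omega\to\mathbb{R}$ be a positive definite kernel whose reproducing kernel Hilbert space $\mathcal{H}_k(\Omega)$ consists of real-analytic functions on $\Omega$, and suppose $v^*\in\mathcal{H}_k(\Omega)$. For each $n$, let $\mathcal{M}_{X_n}\subset\mathcal{H}_k(\Omega)$ be the set of minimizers of $$\min_{v\in\mathcal{H}_k(\Omega)}\|v\|_{\mathcal{H}_k(\Omega)}\quad\text{s.t.}\quad\begin{cases}\langle f(x),\nabla v(x)\rangle-\frac14\|g(x)^\top\nabla v(x)\|_{R^{-1}}^2+h(x)=0,& x\in X_n,\\ v(x)\ge0,& x\in X_n,\\ v(0)=0.\end{cases}$$ Then any sequence $(v_n)_{n\in\mathbb{N}}$ with $v_n\in\mathcal{M}_{X_n}$ for all $n$ satisfies $$\lim_{n\to\infty}\|v_n-v^*\|_{\mathcal{H}_k(\Omega)}=0.$$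
   Context: Let $N,M\in\mathbb{N}$. $\langle\cdot,\cdot\rangle$ is the Euclidean inner product, $\|\cdot\|$ the Euclidean norm, and $\|y\|_A:=\sqrt{\langle y,Ay\rangle}$ for symmetric positive definite $A$. A domain is a nonempty, open, connected subset of $\mathbb{R}^N$. Standing assumptions on the data: $f\in C^1(\mathbb{R}^N,\mathbb{R}^N)$, $g\in C^1(\mathbb{R}^N,\mathbb{R}^{N\times M})$, $h\in C^1(\mathbb{R}^N,\mathbb{R})$, $R\in\mathbb{R}^{M\times M}$ is symmetric positive definite, $f(0)=0$, $h(0)=0$ and $h(x)>0$ for all $x\ne0$. Optimal control problem: let $\mathcal{U}_\infty:=L^\infty([0,\infty);\mathbb{R}^M)$. For $x\in\mathbb{R}^N$ and $\mathbf{u}\in\mathcal{U}_\infty$ let $\mathbf{x}_{\mathbf{u}}(\cdot;x)$ be the unique maximal Carathéodory solution of $\dot{\mathbf{x}}_{\mathbf{u}}(t;x)=f(\mathbf{x}_{\mathbf{u}}(t;x))+g(\mathbf{x}_{\mathbf{u}}(t;x))\mathbf{u}(t)$, $\mathbf{x}_{\mathbf{u}}(0;x)=x$. Put $$J_\infty(x,\mathbf{u}):=\int_0^\infty h(\mathbf{x}_{\mathbf{u}}(t;x))+\langle\mathbf{u}(t),R\mathbf{u}(t)\rangle\,dt,$$ with $J_\infty(x,\mathbf{u}):=+\infty$ if the trajectory blows up in finite time. The optimal value function is $v^*(x):=\inf_{\mathbf{u}\in\mathcal{U}_\infty}J_\infty(x,\mathbf{u})$. "$v^*\in\mathcal{H}_k(\Omega)$"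 means that $v^*$ is finite on $\Omega$ and its restriction to $\Omega$ belongs to $\mathcal{H}_k(\Omega)$. A kernel is a symmetric function $k:\Omega\times\Omega\to\mathbb{R}$; it is positive definite if for every finite set of pairwise distinct points $x_1,\dots,x_n\in\Omega$ the matrix $(k(x_i,x_j))_{i,j}$ is positive semidefinite. $\mathcal{H}_k(\Omega)$ is the unique Hilbert space of real-valued functions on $\Omega$ with reproducing kernel $k$. *)

theory Defs
  imports "HOL-Analysis.Analysis"
begin

section \<open>Smoothness\<close>

definition C1_map :: "('a::real_normed_vector \<Rightarrow> 'b::real_normed_vector) \<Rightarrow> bool" where
  "C1_map F \<longleftrightarrow>
    (\<exists>F' :: 'a \<Rightarrow> 'a \<Rightarrow>\<^sub>L 'b.
      (\<forall>x. (F has_derivative blinfun_apply (F' x)) (at x)) \<and> continuous_on UNIV F')"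

definition grad :: "('a::real_inner \<Rightarrow> real) \<Rightarrow> 'a \<Rightarrow> 'a" where
  "grad \<phi> x = (THE D. GDERIV \<phi> x :> D)"

text \<open>
  Real analyticity: near each point of the set, the function is the sum of a convergent power
  series.  A multi-index is a function \<open>\<alpha> :: 'n \<Rightarrow> nat\<close>, and convergence is
  unconditional, hence absolute.
\<close>

definition real_analytic_on :: "(real^'n \<Rightarrow> real) \<Rightarrow> (real^'n) set \<Rightarrow> bool" where
  "real_analytic_on \<phi> S \<longleftrightarrow>
    (\<forall>a\<in>S. \<exists>r>0. \<exists>c :: ('n \<Rightarrow> nat) \<Rightarrow> real. \<forall>x\<in>ball a r.
      ((\<lambda>\<alpha>. c \<alpha> * (\<Prod>i\<in>UNIV. (x $ i - a $ i) ^ \<alpha> i)) has_sum \<phi> x) UNIV)"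

section \<open>Weighted norms\<close>

definition sym_pos_def :: "real^'n^'n \<Rightarrow> bool" where
  "sym_pos_def A \<longleftrightarrow> transpose A = A \<and> (\<forall>y. y \<noteq> 0 \<longrightarrow> y \<bullet> (A *v y) > 0)"

definition weighted_norm :: "real^'n^'n \<Rightarrow> real^'n \<Rightarrow> real" where
  "weighted_norm A y = sqrt (y \<bullet> (A *v y))"

section \<open>The optimal control problem\<close>

text \<open>
  Essentially bounded controls on \<open>[0,\<infinity>)\<close>, as representatives: neither modifications on null sets
  nor the values at negative times affect the trajectories or the cost.
\<close>

definition admissible_controls :: "(real \<Rightarrow> real^'m) set" where
  "admissible_controls =
    {u \<in> borel_measurable (lebesgue_on {0..}). \<exists>C. AE t in lebesgue_on {0..}. norm (u t) \<le> C}"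

text \<open>
  Caratheodory solution on \<open>[0,T)\<close>, where \<open>T\<close> may be infinite, in the integral form with the
  Lebesgue integral.  The values of \<open>y\<close> outside \<open>[0,T)\<close> are irrelevant.
\<close>

definition caratheodory_solution ::
  "(real^'n \<Rightarrow> real^'n) \<Rightarrow> (real^'n \<Rightarrow> real^'m^'n) \<Rightarrow> (real \<Rightarrow> real^'m) \<Rightarrow> real^'n
    \<Rightarrow> ereal \<Rightarrow> (real \<Rightarrow> real^'n) \<Rightarrow> bool" where
  "caratheodory_solution f g u x T y \<longleftrightarrow>
    0 < T \<and> continuous_on {t. 0 \<le> t \<and> ereal t < T} y \<and>
    (\<forall>t. 0 \<le> t \<and> ereal t < T \<longrightarrow>
      set_integrable lebesgue {0..t} (\<lambda>s. f (y s) + g (y s) *v u s) \<and>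
      y t = x + (LINT s:{0..t}|lebesgue. f (y s) + g (y s) *v u s))"

definition maximal_solution ::
  "(real^'n \<Rightarrow> real^'n) \<Rightarrow> (real^'n \<Rightarrow> real^'m^'n) \<Rightarrow> (real \<Rightarrow> real^'m) \<Rightarrow> real^'n
    \<Rightarrow> ereal \<Rightarrow> (real \<Rightarrow> real^'n) \<Rightarrow> bool" where
  "maximal_solution f g u x T y \<longleftrightarrow>
    caratheodory_solution f g u x T y \<and>
    \<not> (\<exists>T' z. T < T' \<and> caratheodory_solution f g u x T' z \<and>
        (\<forall>t. 0 \<le> t \<and> ereal t < T \<longrightarrow> z t = y t))"

text \<open>
  For continuously differentiable \<open>f\<close>, \<open>g\<close> and an admissible control, the maximal time and the
  trajectory on \<open>[0,T)\<close> are unique; the choice only concerns values outside \<open>[0,T)\<close>.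
\<close>

definition maximal_trajectory ::
  "(real^'n \<Rightarrow> real^'n) \<Rightarrow> (real^'n \<Rightarrow> real^'m^'n) \<Rightarrow> (real \<Rightarrow> real^'m) \<Rightarrow> real^'n
    \<Rightarrow> ereal \<times> (real \<Rightarrow> real^'n)" where
  "maximal_trajectory f g u x = (SOME (T, y). maximal_solution f g u x T y)"

definition cost ::
  "(real^'n \<Rightarrow> real^'n) \<Rightarrow> (real^'n \<Rightarrow> real^'m^'n) \<Rightarrow> (real^'n \<Rightarrow> real) \<Rightarrow> real^'m^'m
    \<Rightarrow> real^'n \<Rightarrow> (real \<Rightarrow> real^'m) \<Rightarrow> ennreal" where
  "cost f g h R x u =
    (case maximal_trajectory f g u x of (T, y) \<Rightarrow>
      if T = \<infinity> then \<integral>\<^sup>+ t\<in>{0..}. ennreal (h (y t) + u t \<bullet> (R *v u t)) \<partial>lebesgue else \<infinity>)"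

definition optimal_value ::
  "(real^'n \<Rightarrow> real^'n) \<Rightarrow> (real^'n \<Rightarrow> real^'m^'n) \<Rightarrow> (real^'n \<Rightarrow> real) \<Rightarrow> real^'m^'m
    \<Rightarrow> real^'n \<Rightarrow> ennreal" where
  "optimal_value f g h R x = (INF u\<in>admissible_controls. cost f g h R x u)"

section \<open>Reproducing kernel Hilbert spaces\<close>

definition pos_def_kernel :: "'a set \<Rightarrow> ('a \<Rightarrow> 'a \<Rightarrow> real) \<Rightarrow> bool" where
  "pos_def_kernel \<Omega> k \<longleftrightarrow>
    (\<forall>x\<in>\<Omega>. \<forall>y\<in>\<Omega>. k x y = k y x) \<and>
    (\<forall>P c. finite P \<and> P \<subseteq> \<Omega> \<longrightarrow> 0 \<le> (\<Sum>x\<in>P. \<Sum>y\<in>P. c x * c y * k x y))"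

definition hnorm :: "(('a \<Rightarrow> real) \<Rightarrow> ('a \<Rightarrow> real) \<Rightarrow> real) \<Rightarrow> ('a \<Rightarrow> real) \<Rightarrow> real" where
  "hnorm ip \<phi> = sqrt (ip \<phi> \<phi>)"

text \<open>
  A real-valued function on \<open>\<Omega>\<close> is an element of \<open>extensional \<Omega>\<close>.  The locale says that the set
  \<open>H\<close> with inner product \<open>ip\<close> is a Hilbert space of functions on \<open>\<Omega>\<close> with reproducing kernel \<open>k\<close>;
  these properties determine \<open>H\<close>, and \<open>ip\<close> on \<open>H\<close>, uniquely.
\<close>

locale rkhs =
  fixes \<Omega> :: "'a set"
    and k :: "'a \<Rightarrow> 'a \<Rightarrow> real"
    and H :: "('a \<Rightarrow> real) set"
    and ip :: "('a \<Rightarrow> real) \<Rightarrow> ('a \<Rightarrow> real) \<Rightarrow> real"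
  assumes extensional: "H \<subseteq> extensional \<Omega>"
    and zero_mem: "(\<lambda>x\<in>\<Omega>. 0) \<in> H"
    and add_mem: "\<lbrakk>\<phi> \<in> H; \<psi> \<in> H\<rbrakk> \<Longrightarrow> (\<lambda>x\<in>\<Omega>. \<phi> x + \<psi> x) \<in> H"
    and scale_mem: "\<phi> \<in> H \<Longrightarrow> (\<lambda>x\<in>\<Omega>. c * \<phi> x) \<in> H"
    and ip_commute: "\<lbrakk>\<phi> \<in> H; \<psi> \<in> H\<rbrakk> \<Longrightarrow> ip \<phi> \<psi> = ip \<psi> \<phi>"
    and ip_add: "\<lbrakk>\<phi> \<in> H; \<psi> \<in> H; \<eta> \<in> H\<rbrakk>
      \<Longrightarrow> ip (\<lambda>x\<in>\<Omega>. \<phi> x + \<psi> x) \<eta> = ip \<phi> \<eta> + ip \<psi> \<eta>"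
    and ip_scale: "\<lbrakk>\<phi> \<in> H; \<psi> \<in> H\<rbrakk> \<Longrightarrow> ip (\<lambda>x\<in>\<Omega>. c * \<phi> x) \<psi> = c * ip \<phi> \<psi>"
    and ip_nonneg: "\<phi> \<in> H \<Longrightarrow> 0 \<le> ip \<phi> \<phi>"
    and ip_eq_zero: "\<lbrakk>\<phi> \<in> H; ip \<phi> \<phi> = 0\<rbrakk> \<Longrightarrow> \<phi> = (\<lambda>x\<in>\<Omega>. 0)"
    and norm_complete: "\<lbrakk>\<And>n :: nat. s n \<in> H;
        \<forall>e>0. \<exists>N. \<forall>m\<ge>N. \<forall>n\<ge>N. hnorm ip (\<lambda>x\<in>\<Omega>. s m x - s n x) < e\<rbrakk>
      \<Longrightarrow> \<exists>l\<in>H. (\<lambda>n. hnorm ip (\<lambda>x\<in>\<Omega>. s n x - l x)) \<longlonglongrightarrow> 0"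
    and kernel_mem: "x \<in> \<Omega> \<Longrightarrow> (\<lambda>y\<in>\<Omega>. k y x) \<in> H"
    and reproducing: "\<lbrakk>\<phi> \<in> H; x \<in> \<Omega>\<rbrakk> \<Longrightarrow> ip \<phi> (\<lambda>y\<in>\<Omega>. k y x) = \<phi> x"

section \<open>The collocation problem\<close>

definition hjb_residual ::
  "(real^'n \<Rightarrow> real^'n) \<Rightarrow> (real^'n \<Rightarrow> real^'m^'n) \<Rightarrow> (real^'n \<Rightarrow> real) \<Rightarrow> real^'m^'m
    \<Rightarrow> (real^'n \<Rightarrow> real) \<Rightarrow> real^'n \<Rightarrow> real" where
  "hjb_residual f g h R \<phi> x =
    f x \<bullet> grad \<phi> x
    - 1/4 * (weighted_norm (matrix_inv R) (transpose (g x) *v grad \<phi> x))\<^sup>2 + h x"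

definition feasible ::
  "(real^'n \<Rightarrow> real^'n) \<Rightarrow> (real^'n \<Rightarrow> real^'m^'n) \<Rightarrow> (real^'n \<Rightarrow> real) \<Rightarrow> real^'m^'m
    \<Rightarrow> (real^'n \<Rightarrow> real) set \<Rightarrow> (real^'n) set \<Rightarrow> (real^'n \<Rightarrow> real) set" where
  "feasible f g h R H X =
    {\<phi> \<in> H. (\<forall>x\<in>X. hjb_residual f g h R \<phi> x = 0) \<and> (\<forall>x\<in>X. \<phi> x \<ge> 0) \<and> \<phi> 0 = 0}"

definition minimizers ::
  "(real^'n \<Rightarrow> real^'n) \<Rightarrow> (real^'n \<Rightarrow> real^'m^'n) \<Rightarrow> (real^'n \<Rightarrow> real) \<Rightarrow> real^'m^'m
    \<Rightarrow> (real^'n \<Rightarrow> real) set \<Rightarrow> ((real^'n \<Rightarrow> real) \<Rightarrow> (real^'n \<Rightarrow> real) \<Rightarrow> real) \<Rightarrow> (real^'n) set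
    \<Rightarrow> (real^'n \<Rightarrow> real) set" where
  "minimizers f g h R H ip X =
    {\<phi> \<in> feasible f g h R H X. \<forall>\<psi>\<in>feasible f g h R H X. hnorm ip \<phi> \<le> hnorm ip \<psi>}"

end

theory Submission
  imports Defs "HOL-Complex_Analysis.Conformal_Mappings" "HOL-Library.Diagonal_Subsequence"
begin

text \<open>
  The value function satisfies the Hamilton--Jacobi--Bellman (HJB) equation on \<open>\<Omega>\<close>, by dynamic
  programming and a chain rule along trajectories. Hence it is feasible and bounds the norms of the
  minimizers \<open>v\<^sub>n\<close>. By uniform boundedness, gradients at a point are bounded functionals of the
  Hilbert space, so some subsequence of \<open>v\<^sub>n\<close> converges, weakly as far as gradients and values on
  the collocation points are concerned, to a nonnegative function that vanishes at \<open>0\<close> and, by density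
  and continuity, solves the HJB equation on \<open>\<Omega>\<close>. Near \<open>0\<close> such a solution is unique, by a maximum
  principle on sublevel sets; by analyticity the weak limit is the value function. Its norm dominates
  those of the minimizers, so the convergence is strong.
\<close>

section \<open>Real-analytic functions\<close>

lemma has_derivative_monomial:
  fixes a :: "real^'n" and \<alpha> :: "'n \<Rightarrow> nat"
  shows "((\<lambda>x. \<Prod>i\<in>UNIV. (x $ i - a $ i) ^ \<alpha> i) has_derivative
    (\<lambda>e. e \<bullet> (\<chi> i. \<alpha> i * (x $ i - a $ i) ^ (\<alpha> i - 1) * (\<Prod>j\<in>UNIV - {i}. (x $ j - a $ j) ^ \<alpha> j)))) (at x)"
proof -
  have "((\<lambda>x. (x $ i - a $ i) ^ \<alpha> i) has_derivative (\<lambda>e. e $ i * (\<alpha> i * (x $ i - a $ i) ^ (\<alpha> i - 1)))) (at x)" for i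
    using has_derivative_power[OF has_derivative_diff[OF bounded_linear_imp_has_derivative[OF bounded_linear_vec_nth[of i]]
        has_derivative_const[of "a $ i"]], of "\<alpha> i" x UNIV] by (simp add: mult.left_commute mult.assoc)
  from has_derivative_prod[of UNIV, OF this]
  show ?thesis
    by (simp add: inner_vec_def algebra_simps)
qed

lemma norm_monomial_gradient_le:
  fixes z :: "real^'n" and \<alpha> :: "'n \<Rightarrow> nat"
  assumes z: "\<And>i. \<bar>z $ i\<bar> \<le> \<rho>" and \<rho>: "\<rho> > 0"
  shows "norm (\<chi> i. \<alpha> i * z $ i ^ (\<alpha> i - 1) * (\<Prod>j\<in>UNIV - {i}. z $ j ^ \<alpha> j))
    \<le> CARD('n) / \<rho> * (\<Prod>i\<in>UNIV. (2 * \<rho>) ^ \<alpha> i)"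
proof -
  have "\<bar>\<alpha> i * z $ i ^ (\<alpha> i - 1) * (\<Prod>j\<in>UNIV - {i}. z $ j ^ \<alpha> j)\<bar> \<le> 1 / \<rho> * (\<Prod>i\<in>UNIV. (2 * \<rho>) ^ \<alpha> i)" for i
  proof -
    have 1: "real (\<alpha> i) * \<bar>z $ i\<bar> ^ (\<alpha> i - 1) \<le> 1 / \<rho> * (2 * \<rho>) ^ \<alpha> i"
    proof (cases "\<alpha> i")
      case (Suc m)
      have "real (Suc m) * \<bar>z $ i\<bar> ^ m \<le> 2 ^ Suc m * \<rho> ^ m"
        using of_nat_less_two_power[of "Suc m", where 'a=real] z[of i] \<rho>
        by (intro mult_mono power_mono) auto
      thus ?thesis using Suc \<rho> by (simp add: power_mult_distrib field_simps)
    qed (use \<rho> in auto)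
    have 2: "(\<Prod>j\<in>UNIV - {i}. \<bar>z $ j\<bar> ^ \<alpha> j) \<le> (\<Prod>j\<in>UNIV - {i}. (2 * \<rho>) ^ \<alpha> j)"
    proof (rule prod_mono)
      fix j
      have "\<bar>z $ j\<bar> \<le> 2 * \<rho>" using z[of j] \<rho> by linarith
      thus "0 \<le> \<bar>z $ j\<bar> ^ \<alpha> j \<and> \<bar>z $ j\<bar> ^ \<alpha> j \<le> (2 * \<rho>) ^ \<alpha> j" using power_mono[of "\<bar>z $ j\<bar>" "2 * \<rho>" "\<alpha> j"] by simp
    qed
    have "real (\<alpha> i) * \<bar>z $ i\<bar> ^ (\<alpha> i - 1) * (\<Prod>j\<in>UNIV - {i}. \<bar>z $ j\<bar> ^ \<alpha> j)
      \<le> (1 / \<rho> * (2 * \<rho>) ^ \<alpha> i) * (\<Prod>j\<in>UNIV - {i}. (2 * \<rho>) ^ \<alpha> j)"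
      using \<rho> by (intro mult_mono[OF 1 2]) (auto intro!: prod_nonneg)
    also have "\<dots> = 1 / \<rho> * (\<Prod>i\<in>UNIV. (2 * \<rho>) ^ \<alpha> i)"
      by (subst (2) prod.remove[of _ i]) (auto simp: mult.assoc)
    finally show ?thesis by (simp add: abs_mult abs_prod power_abs)
  qed
  hence "(\<Sum>i\<in>UNIV. norm ((\<chi> i. \<alpha> i * z $ i ^ (\<alpha> i - 1) * (\<Prod>j\<in>UNIV - {i}. z $ j ^ \<alpha> j)) $ i))
      \<le> (\<Sum>i\<in>(UNIV::'n set). 1 / \<rho> * (\<Prod>i\<in>UNIV. (2 * \<rho>) ^ \<alpha> i))"
    by (intro sum_mono) auto
  also have "\<dots> = CARD('n) / \<rho> * (\<Prod>i\<in>UNIV. (2 * \<rho>) ^ \<alpha> i)" by simp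
  finally show ?thesis using order.trans[OF norm_le_l1_cart] unfolding real_norm_def by blast
qed

definition gradient_on :: "(real^'n) set \<Rightarrow> (real^'n \<Rightarrow> real) \<Rightarrow> (real^'n \<Rightarrow> real^'n) \<Rightarrow> bool" where
  "gradient_on S \<phi> G \<longleftrightarrow> continuous_on S G \<and> (\<forall>x\<in>S. (\<phi> has_derivative (\<lambda>e. e \<bullet> G x)) (at x))"

lemma gradient_onD: "gradient_on S \<phi> G \<Longrightarrow> x \<in> S \<Longrightarrow> (\<phi> has_derivative (\<lambda>e. e \<bullet> G x)) (at x)"
  by (simp add: gradient_on_def)

lemma gradient_on_imp_continuous_on: "gradient_on S \<phi> G \<Longrightarrow> continuous_on S \<phi>"
  by (intro continuous_at_imp_continuous_on ballI) (rule has_derivative_continuous[OF gradient_onD])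

lemma grad_eq: "(\<phi> has_derivative (\<lambda>e. e \<bullet> D)) (at x) \<Longrightarrow> grad \<phi> x = D"
  unfolding grad_def gderiv_def
proof (rule the_equality)
  fix D' assume "(\<phi> has_derivative (\<lambda>e. e \<bullet> D)) (at x)" "(\<phi> has_derivative (\<lambda>e. e \<bullet> D')) (at x)"
  from has_derivative_unique[OF this] have "e \<bullet> D = e \<bullet> D'" for e by metis
  thus "D' = D" by (metis vector_eq_rdot inner_commute)
qed

lemma bij_nat_multiindex:
  obtains b :: "nat \<Rightarrow> ('n::finite \<Rightarrow> nat)" where "bij b"
proof -
  have "inj (\<lambda>m::nat. \<lambda>_::'n. m)" by (auto simp: inj_def fun_eq_iff)
  hence "infinite (UNIV :: ('n \<Rightarrow> nat) set)"
    using finite_imageD infinite_UNIV_nat by (metis finite_subset subset_UNIV)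
  thus ?thesis using that bij_betw_from_nat_into[of "UNIV :: ('n \<Rightarrow> nat) set"] by auto
qed

lemma real_analytic_local_gradient:
  fixes \<phi> :: "real^'n \<Rightarrow> real"
  assumes "real_analytic_on \<phi> S" "a \<in> S"
  obtains \<rho> G where "\<rho> > 0" "gradient_on (ball a \<rho>) \<phi> G"
proof -
  from bspec[OF assms(1)[unfolded real_analytic_on_def] assms(2)]
    obtain r c where r: "r > 0" and c: "\<forall>x\<in>ball a r.
      ((\<lambda>\<alpha>. c \<alpha> * (\<Prod>i\<in>UNIV. (x $ i - a $ i) ^ \<alpha> i)) has_sum \<phi> x) UNIV"
    using assms unfolding real_analytic_on_def by metis
  define \<rho> where "\<rho> = r / (4 * CARD('n))"
  have N: "CARD('n) \<ge> 1" by (simp add: Suc_leI)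
  have \<rho>: "\<rho> > 0" using r N by (simp add: \<rho>_def)
  have "4 * \<rho> \<le> r"
  proof -
    have "r / (4 * CARD('n)) \<le> r / 4" using r N by (intro divide_left_mono) auto
    thus ?thesis by (simp add: \<rho>_def)
  qed
  hence sub: "ball a \<rho> \<subseteq> ball a r" using \<rho> by (intro subset_ball) auto
  define p :: "real^'n" where "p = (\<chi> i. a $ i + 2 * \<rho>)"
  have "norm (p - a) \<le> (\<Sum>i\<in>UNIV. \<bar>(p - a) $ i\<bar>)" by (rule norm_le_l1_cart)
  also have "\<dots> = r / 2" using \<rho> by (simp add: p_def, simp add: \<rho>_def)
  finally have "p \<in> ball a r" using r by (simp add: dist_norm norm_minus_commute)
  from bspec[OF c this] have "(\<lambda>\<alpha>. c \<alpha> * (\<Prod>i\<in>UNIV. (2 * \<rho>) ^ \<alpha> i)) summable_on UNIV"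
    by (auto simp: p_def summable_on_def)
  hence "(\<lambda>\<alpha>. \<bar>c \<alpha> * (\<Prod>i\<in>UNIV. (2 * \<rho>) ^ \<alpha> i)\<bar>) summable_on UNIV"
    by (subst (asm) summable_on_iff_abs_summable_on_real) simp
  hence sm: "(\<lambda>\<alpha>. CARD('n) / \<rho> * (\<bar>c \<alpha>\<bar> * (\<Prod>i\<in>UNIV. (2 * \<rho>) ^ \<alpha> i))) summable_on UNIV"
    using \<rho> by (intro summable_on_cmult_right) (simp add: abs_mult abs_prod)
  obtain b :: "nat \<Rightarrow> ('n \<Rightarrow> nat)" where b: "bij b" by (rule bij_nat_multiindex)
  have sM: "summable (\<lambda>n. CARD('n) / \<rho> * (\<bar>c (b n)\<bar> * (\<Prod>i\<in>UNIV. (2 * \<rho>) ^ b n i)))"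
    by (rule summable_on_imp_summable) (rule summable_on_reindex_bij_betw[OF b, THEN iffD2, OF sm])
  define m where "m n x = c (b n) * (\<Prod>i\<in>UNIV. (x $ i - a $ i) ^ b n i)" for n x
  define D :: "nat \<Rightarrow> real^'n \<Rightarrow> real^'n" where "D n x = c (b n) *\<^sub>R
     (\<chi> i. b n i * (x $ i - a $ i) ^ (b n i - 1) * (\<Prod>j\<in>UNIV - {i}. (x $ j - a $ j) ^ b n j))" for n x
  define G where "G x = (\<Sum>n. D n x)" for x
  have m: "(m n has_derivative (\<lambda>e. e \<bullet> D n x)) (at x)" for n x
    using has_derivative_mult_right[OF has_derivative_monomial[of a "b n" x], of "c (b n)"]
    unfolding m_def D_def by (simp add: algebra_simps)
  have ms: "(\<lambda>n. m n x) sums \<phi> x" if "x \<in> ball a \<rho>" for x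
    unfolding m_def using that sub
    by (intro has_sum_imp_sums has_sum_reindex_bij_betw[OF b, THEN iffD2, OF c[rule_format]]) auto
  have nD: "norm (D n x) \<le> CARD('n) / \<rho> * (\<bar>c (b n)\<bar> * (\<Prod>i\<in>UNIV. (2 * \<rho>) ^ b n i))" if "x \<in> ball a \<rho>" for n x
  proof -
    have "\<bar>(x - a) $ i\<bar> \<le> \<rho>" for i
      using component_le_norm_cart[of "x - a" i] that by (simp add: dist_norm norm_minus_commute)
    from mult_left_mono[OF norm_monomial_gradient_le[of "x - a", OF this \<rho>, where \<alpha> = "b n"], of "\<bar>c (b n)\<bar>"]
    show ?thesis by (simp add: D_def mult_ac)
  qed
  have U: "uniform_limit (ball a \<rho>) (\<lambda>n x. \<Sum>i<n. D i x) G sequentially"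
    unfolding G_def by (rule Weierstrass_m_test[OF nD sM])
  have contG: "continuous_on (ball a \<rho>) G"
  proof (rule uniform_limit_theorem[OF _ U])
    show "\<forall>\<^sub>F n in sequentially. continuous_on (ball a \<rho>) (\<lambda>x. \<Sum>i<n. D i x)"
      by (intro always_eventually allI continuous_on_sum) (auto simp: D_def intro!: continuous_intros)
  qed simp
  have "\<exists>g. \<forall>x\<in>ball a \<rho>. (\<lambda>n. m n x) sums g x \<and> (g has_derivative (\<lambda>e. e \<bullet> G x)) (at x within ball a \<rho>)"
  proof (rule has_derivative_series[where f' = "\<lambda>n x e. e \<bullet> D n x"])
    fix e :: real assume "e > 0"
    from uniform_limitD[OF U this]
    show "\<forall>\<^sub>F n in sequentially. \<forall>x\<in>ball a \<rho>. \<forall>h. norm ((\<Sum>i<n. h \<bullet> D i x) - h \<bullet> G x) \<le> e * norm h"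
    proof (rule eventually_mono, intro ballI allI)
      fix n x h assume *: "\<forall>x\<in>ball a \<rho>. dist (\<Sum>i<n. D i x) (G x) < e" and x: "x \<in> ball a \<rho>"
      have "(\<Sum>i<n. h \<bullet> D i x) - h \<bullet> G x = h \<bullet> ((\<Sum>i<n. D i x) - G x)"
        by (simp add: inner_diff_right inner_sum_right)
      also have "norm \<dots> \<le> norm h * norm ((\<Sum>i<n. D i x) - G x)"
        using Cauchy_Schwarz_ineq2 by simp
      also have "\<dots> \<le> norm h * e" using * x by (intro mult_left_mono) (auto simp: dist_norm less_imp_le)
      finally show "norm ((\<Sum>i<n. h \<bullet> D i x) - h \<bullet> G x) \<le> e * norm h" by (simp add: mult.commute)
    qed
  next
    show "(\<lambda>n. m n a) sums \<phi> a" "a \<in> ball a \<rho>" using ms \<rho> by auto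
  qed (auto intro: has_derivative_at_withinI m)
  then obtain g where g: "\<And>x. x \<in> ball a \<rho> \<Longrightarrow> (\<lambda>n. m n x) sums g x"
     "\<And>x. x \<in> ball a \<rho> \<Longrightarrow> (g has_derivative (\<lambda>e. e \<bullet> G x)) (at x within ball a \<rho>)" by blast
  have "(\<phi> has_derivative (\<lambda>e. e \<bullet> G x)) (at x)" if x: "x \<in> ball a \<rho>" for x
  proof -
    have "(g has_derivative (\<lambda>e. e \<bullet> G x)) (at x)" using g(2)[OF x] x by (simp add: at_within_open[OF x])
    moreover have "g y = \<phi> y" if "y \<in> ball a \<rho>" for y using ms[OF that] g(1)[OF that] sums_unique2 by blast
    ultimately show ?thesis using has_derivative_transform_within_open[OF _ open_ball x] by blast
  qed
  with contG \<rho> that show ?thesis unfolding gradient_on_def by blast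
qed

lemma real_analytic_gradient_on:
  fixes \<phi> :: "real^'n \<Rightarrow> real"
  assumes "real_analytic_on \<phi> S"
  shows "gradient_on S \<phi> (grad \<phi>)"
proof -
  have *: "isCont (grad \<phi>) x \<and> (\<phi> has_derivative (\<lambda>e. e \<bullet> grad \<phi> x)) (at x)" if x: "x \<in> S" for x
  proof -
    obtain \<rho> G where \<rho>: "\<rho> > 0" and G: "gradient_on (ball x \<rho>) \<phi> G"
      by (rule real_analytic_local_gradient[OF assms x])
    have eq: "grad \<phi> y = G y" if "y \<in> ball x \<rho>" for y
      using G that grad_eq unfolding gradient_on_def by blast
    have "continuous_on (ball x \<rho>) (grad \<phi>)"
      using G eq unfolding gradient_on_def by (metis continuous_on_cong)
    hence "isCont (grad \<phi>) x" using \<rho> by (simp add: continuous_on_eq_continuous_at)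
    thus ?thesis using G eq \<rho> unfolding gradient_on_def by auto
  qed
  thus ?thesis unfolding gradient_on_def by (simp add: continuous_at_imp_continuous_on)
qed

lemma real_powser_eq_0:
  fixes b :: "nat \<Rightarrow> real"
  assumes sums: "\<And>s. \<bar>s\<bar> < R \<Longrightarrow> (\<lambda>k. b k * s ^ k) sums \<psi> s"
    and s0: "\<bar>s0\<bar> < R" and \<epsilon>: "\<epsilon> > 0"
    and zero: "\<And>s. \<bar>s\<bar> < R \<Longrightarrow> \<bar>s - s0\<bar> < \<epsilon> \<Longrightarrow> \<psi> s = 0"
    and s: "\<bar>s\<bar> < R"
  shows "\<psi> s = 0"
proof -
  define F where "F z = (\<Sum>k. complex_of_real (b k) * z ^ k)" for z
  have Fs: "(\<lambda>k. complex_of_real (b k) * z ^ k) sums F z" if "norm z < R" for z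
  proof -
    obtain t where t: "norm z < t" "t < R" using dense[OF \<open>norm z < R\<close>] by blast
    have "summable (\<lambda>k. b k * t ^ k)" using sums[of t] t norm_ge_zero[of z] by (intro sums_summable[OF sums]) linarith
    hence "summable (\<lambda>k. complex_of_real (b k * t ^ k))" by (simp only: summable_of_real)
    hence "summable (\<lambda>k. complex_of_real (b k) * complex_of_real t ^ k)" by simp
    hence "summable (\<lambda>k. norm (complex_of_real (b k) * z ^ k))"
      by (rule powser_insidea) (use t norm_ge_zero[of z] in auto)
    thus ?thesis unfolding F_def by (rule summable_sums[OF summable_norm_cancel])
  qed
  have Fr: "F (of_real x) = of_real (\<psi> x)" if "\<bar>x\<bar> < R" for x
  proof -
    have "(\<lambda>k. complex_of_real (b k * x ^ k)) sums of_real (\<psi> x)" using sums[OF that] by (simp only: sums_of_real_iff)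
    thus ?thesis using Fs[of "of_real x"] that sums_unique2 by auto
  qed
  define U where "U = complex_of_real ` {x. \<bar>x\<bar> < R \<and> \<bar>x - s0\<bar> < \<epsilon>}"
  have "F (of_real s) = 0"
  proof (rule analytic_continuation[of F "ball 0 R" U "of_real s0"])
    show "F holomorphic_on ball 0 R"
      by (rule power_series_holomorphic[of 0 R "\<lambda>k. complex_of_real (b k)"]) (use Fs in auto)
    have lim: "s0 islimpt {x. \<bar>x\<bar> < R \<and> \<bar>x - s0\<bar> < \<epsilon>}"
    proof -
      have "open ({-R<..<R} \<inter> {s0-\<epsilon><..<s0+\<epsilon>})" by (intro open_Int) auto
      moreover have "{-R<..<R} \<inter> {s0-\<epsilon><..<s0+\<epsilon>} = {x. \<bar>x\<bar> < R \<and> \<bar>x - s0\<bar> < \<epsilon>}" by auto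
      ultimately have "open {x. \<bar>x\<bar> < R \<and> \<bar>x - s0\<bar> < \<epsilon>}" by metis
      thus ?thesis using s0 \<epsilon> by (intro interior_limit_point) (simp add: interior_open)
    qed
    show "complex_of_real s0 islimpt U"
      unfolding islimpt_approachable
    proof (intro allI impI)
      fix e :: real assume "e > 0"
      then obtain x where "x \<in> {x. \<bar>x\<bar> < R \<and> \<bar>x - s0\<bar> < \<epsilon>}" "x \<noteq> s0" "dist x s0 < e"
        using lim unfolding islimpt_approachable by blast
      thus "\<exists>x'\<in>U. x' \<noteq> complex_of_real s0 \<and> dist x' (complex_of_real s0) < e"
        unfolding U_def by (intro bexI[of _ "of_real x"]) (auto simp: dist_of_real)
    qed
    show "F z = 0" if "z \<in> U" for z using that zero Fr unfolding U_def by auto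
  qed (use s s0 in \<open>auto simp: U_def\<close>)
  thus ?thesis using Fr[OF s] by simp
qed

lemma has_sum_fibres:
  fixes g :: "'b \<Rightarrow> real"
  assumes "(g has_sum S) UNIV"
  shows "((\<lambda>k. infsum g {\<alpha>. p \<alpha> = k}) has_sum S) UNIV"
proof -
  let ?A = "SIGMA k:UNIV. {\<alpha>. p \<alpha> = k}"
  have bij: "bij_betw snd ?A UNIV" by (auto simp: bij_betw_def inj_on_def image_iff)
  have *: "((\<lambda>(k, \<alpha>). g \<alpha>) has_sum S) ?A"
    using assms has_sum_reindex_bij_betw[OF bij, of g S] by (simp add: case_prod_unfold)
  hence sm: "(\<lambda>(k, \<alpha>). g \<alpha>) summable_on ?A" unfolding summable_on_def by blast
  have "infsum (\<lambda>k. infsum g {\<alpha>. p \<alpha> = k}) UNIV = S"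
    using infsum_Sigma'_banach[OF sm] * infsumI by metis
  thus ?thesis using has_sum_infsum[OF summable_on_Sigma_banach[OF sm]] by simp
qed

lemma power_series_eq_0_on_cube:
  fixes a q :: "real^'n"
  assumes sum: "\<And>x. (\<And>i. \<bar>x $ i - a $ i\<bar> < \<rho>) \<Longrightarrow>
      ((\<lambda>\<alpha>. c \<alpha> * (\<Prod>i\<in>UNIV. (x $ i - a $ i) ^ \<alpha> i)) has_sum \<phi> x) UNIV"
    and q: "\<And>i. \<bar>q $ i - a $ i\<bar> < \<rho>" and \<delta>: "\<delta> > 0"
    and zero: "\<And>x. (\<And>i. \<bar>x $ i - a $ i\<bar> < \<rho>) \<Longrightarrow> (\<And>i. \<bar>x $ i - q $ i\<bar> < \<delta>) \<Longrightarrow> \<phi> x = 0"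
    and x: "\<And>i. \<bar>x $ i - a $ i\<bar> < \<rho>"
  shows "\<phi> x = 0"
proof -
  have "\<forall>x. (\<forall>i. \<bar>x $ i - a $ i\<bar> < \<rho>) \<and> (\<forall>i. i \<notin> J \<longrightarrow> \<bar>x $ i - q $ i\<bar> < \<delta>) \<longrightarrow> \<phi> x = 0"
    if "finite J" for J :: "'n set"
    using that
  proof (induction J rule: finite_induct)
    case empty
    thus ?case using zero by blast
  next
    case (insert i J)
    show ?case
    proof (intro allI impI, elim conjE)
      fix x :: "real^'n"
      assume x: "\<forall>i. \<bar>x $ i - a $ i\<bar> < \<rho>" and xJ: "\<forall>j. j \<notin> insert i J \<longrightarrow> \<bar>x $ j - q $ j\<bar> < \<delta>"
      define y :: "real \<Rightarrow> real^'n" where "y s = (\<chi> j. if j = i then a $ i + s else x $ j)" for s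
      have y: "\<And>j. \<bar>y s $ j - a $ j\<bar> < \<rho>" if "\<bar>s\<bar> < \<rho>" for s
        using that x by (simp add: y_def)
      have tm: "c \<alpha> * (\<Prod>j\<in>UNIV. (y s $ j - a $ j) ^ \<alpha> j) =
          s ^ \<alpha> i * (c \<alpha> * (\<Prod>j\<in>UNIV-{i}. (x $ j - a $ j) ^ \<alpha> j))" for \<alpha> s
      proof -
        have "(\<Prod>j\<in>UNIV-{i}. (y s $ j - a $ j) ^ \<alpha> j) = (\<Prod>j\<in>UNIV-{i}. (x $ j - a $ j) ^ \<alpha> j)"
          by (intro prod.cong) (auto simp: y_def)
        thus ?thesis by (subst prod.remove[of _ i]) (simp_all add: y_def)
      qed
      define b where "b k = infsum (\<lambda>\<alpha>. c \<alpha> * (\<Prod>j\<in>UNIV-{i}. (x $ j - a $ j) ^ \<alpha> j)) {\<alpha>. \<alpha> i = k}" for k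
      have ps: "(\<lambda>k. b k * s ^ k) sums \<phi> (y s)" if s: "\<bar>s\<bar> < \<rho>" for s
      proof -
        have "((\<lambda>k. infsum (\<lambda>\<alpha>. c \<alpha> * (\<Prod>j\<in>UNIV. (y s $ j - a $ j) ^ \<alpha> j)) {\<alpha>. \<alpha> i = k}) has_sum \<phi> (y s)) UNIV"
          by (rule has_sum_fibres) (rule sum, rule y[OF s])
        also have "(\<lambda>k. infsum (\<lambda>\<alpha>. c \<alpha> * (\<Prod>j\<in>UNIV. (y s $ j - a $ j) ^ \<alpha> j)) {\<alpha>. \<alpha> i = k}) = (\<lambda>k. b k * s ^ k)"
        proof
          fix k
          have "infsum (\<lambda>\<alpha>. c \<alpha> * (\<Prod>j\<in>UNIV. (y s $ j - a $ j) ^ \<alpha> j)) {\<alpha>. \<alpha> i = k}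
            = infsum (\<lambda>\<alpha>. s ^ k * (c \<alpha> * (\<Prod>j\<in>UNIV-{i}. (x $ j - a $ j) ^ \<alpha> j))) {\<alpha>. \<alpha> i = k}"
            by (intro infsum_cong) (simp add: tm)
          also have "\<dots> = b k * s ^ k" unfolding b_def by (subst infsum_cmult_right') simp
          finally show "infsum (\<lambda>\<alpha>. c \<alpha> * (\<Prod>j\<in>UNIV. (y s $ j - a $ j) ^ \<alpha> j)) {\<alpha>. \<alpha> i = k} = b k * s ^ k" .
        qed
        finally show ?thesis by (rule has_sum_imp_sums)
      qed
      have pz: "\<phi> (y s) = 0" if "\<bar>s\<bar> < \<rho>" "\<bar>s - (q $ i - a $ i)\<bar> < \<delta>" for s
      proof -
        have "\<forall>j. j \<notin> J \<longrightarrow> \<bar>y s $ j - q $ j\<bar> < \<delta>"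
          using that xJ by (auto simp: y_def algebra_simps)
        thus ?thesis using insert.IH y[OF that(1)] by blast
      qed
      have "\<phi> (y (x $ i - a $ i)) = 0"
        by (rule real_powser_eq_0[of \<rho> b "\<lambda>s. \<phi> (y s)", OF ps q[of i] \<delta> pz x[rule_format, of i]])
      moreover have "y (x $ i - a $ i) = x" by (simp add: y_def vec_eq_iff)
      ultimately show "\<phi> x = 0" by simp
    qed
  qed
  from this[OF finite, of UNIV] x show ?thesis by blast
qed

lemma real_analytic_identity:
  fixes \<phi> :: "real^'n \<Rightarrow> real"
  assumes an: "real_analytic_on \<phi> S" and S: "open S" "connected S"
    and U: "open U" "U \<noteq> {}" "U \<subseteq> S" "\<And>x. x \<in> U \<Longrightarrow> \<phi> x = 0"
    and x: "x \<in> S"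
  shows "\<phi> x = 0"
proof -
  define Z where "Z = interior {x \<in> S. \<phi> x = 0}"
  have Z0: "\<phi> z = 0" "z \<in> S" if "z \<in> Z" for z
    using that interior_subset unfolding Z_def by blast+
  have cl: "a \<in> Z" if a: "a \<in> S" "a \<in> closure Z" for a
  proof -
    from bspec[OF an[unfolded real_analytic_on_def] a(1)]
    obtain r c where r: "r > 0" and c: "\<forall>x\<in>ball a r.
        ((\<lambda>\<alpha>. c \<alpha> * (\<Prod>i\<in>UNIV. (x $ i - a $ i) ^ \<alpha> i)) has_sum \<phi> x) UNIV"
      by blast
    define \<rho> where "\<rho> = r / CARD('n)"
    have \<rho>: "\<rho> > 0" using r by (simp add: \<rho>_def)
    have cube: "x \<in> ball a r" if "\<And>i. \<bar>x $ i - a $ i\<bar> < \<rho>" for x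
    proof -
      have "norm (x - a) \<le> (\<Sum>i\<in>UNIV. \<bar>(x - a) $ i\<bar>)" by (rule norm_le_l1_cart)
      also have "\<dots> < (\<Sum>i\<in>(UNIV::'n set). \<rho>)" using that by (intro sum_strict_mono) auto
      also have "\<dots> = r" by (simp add: \<rho>_def)
      finally show ?thesis by (simp add: dist_norm norm_minus_commute)
    qed
    obtain q where q: "q \<in> Z" "dist q a < \<rho>" using a(2) \<rho> unfolding closure_approachable by blast
    obtain e where e: "e > 0" "ball q e \<subseteq> Z" using q(1) open_contains_ball[of Z] by (auto simp: Z_def)
    have comp: "\<bar>y $ i - z $ i\<bar> \<le> dist y z" for y z :: "real^'n" and i
      using component_le_norm_cart[of "y - z" i] by (simp add: dist_norm)
    have zero: "\<phi> x = 0" if "\<And>i. \<bar>x $ i - a $ i\<bar> < \<rho>" for x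
    proof (rule power_series_eq_0_on_cube[of a \<rho> c \<phi> q "e / CARD('n)"])
      show "\<bar>q $ i - a $ i\<bar> < \<rho>" for i using comp[of q i a] q(2) by linarith
      show "\<phi> y = 0" if "\<And>i. \<bar>y $ i - q $ i\<bar> < e / CARD('n)" for y
      proof -
        have "norm (y - q) \<le> (\<Sum>i\<in>UNIV. \<bar>(y - q) $ i\<bar>)" by (rule norm_le_l1_cart)
        also have "\<dots> < (\<Sum>i\<in>(UNIV::'n set). e / CARD('n))" using that by (intro sum_strict_mono) auto
        also have "\<dots> = e" by simp
        finally have "y \<in> ball q e" by (simp add: dist_norm norm_minus_commute)
        thus ?thesis using e Z0 by blast
      qed
    qed (use c cube e that in auto)
    obtain d where d: "d > 0" "ball a d \<subseteq> S" using S a open_contains_ball by blast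
    have "ball a (min d \<rho>) \<subseteq> {x \<in> S. \<phi> x = 0}"
    proof
      fix y assume y: "y \<in> ball a (min d \<rho>)"
      have "\<bar>y $ i - a $ i\<bar> < \<rho>" for i using comp[of y i a] y by (simp add: dist_commute)
      thus "y \<in> {x \<in> S. \<phi> x = 0}" using zero d y by auto
    qed
    thus "a \<in> Z" unfolding Z_def using d \<rho> by (intro interiorI[of "ball a (min d \<rho>)"]) auto
  qed
  have "Z \<inter> S = {} \<or> - closure Z \<inter> S = {}"
    by (rule connectedD[OF S(2)]) (use cl closure_subset[of Z] in \<open>auto simp: Z_def\<close>)
  moreover have "U \<subseteq> Z" unfolding Z_def using U by (intro interior_maximal) auto
  ultimately have "x \<in> closure Z" using U x by auto
  thus ?thesis using cl x Z0 by blast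
qed

section \<open>Reproducing kernel Hilbert spaces\<close>

context rkhs
begin

definition add :: "('a \<Rightarrow> real) \<Rightarrow> ('a \<Rightarrow> real) \<Rightarrow> 'a \<Rightarrow> real" where
  "add \<phi> \<psi> = (\<lambda>x\<in>\<Omega>. \<phi> x + \<psi> x)"

definition scale :: "real \<Rightarrow> ('a \<Rightarrow> real) \<Rightarrow> 'a \<Rightarrow> real" where
  "scale c \<phi> = (\<lambda>x\<in>\<Omega>. c * \<phi> x)"

definition sub :: "('a \<Rightarrow> real) \<Rightarrow> ('a \<Rightarrow> real) \<Rightarrow> 'a \<Rightarrow> real" where
  "sub \<phi> \<psi> = (\<lambda>x\<in>\<Omega>. \<phi> x - \<psi> x)"

definition bounded_functional :: "(('a \<Rightarrow> real) \<Rightarrow> real) \<Rightarrow> bool" where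
  "bounded_functional L \<longleftrightarrow>
    (\<forall>\<phi>\<in>H. \<forall>\<psi>\<in>H. L (add \<phi> \<psi>) = L \<phi> + L \<psi>) \<and>
    (\<forall>c. \<forall>\<phi>\<in>H. L (scale c \<phi>) = c * L \<phi>) \<and>
    (\<exists>B\<ge>0. \<forall>\<phi>\<in>H. \<bar>L \<phi>\<bar> \<le> B * hnorm ip \<phi>)"

lemma bounded_functionalD:
  assumes "bounded_functional L"
  shows "\<phi> \<in> H \<Longrightarrow> \<psi> \<in> H \<Longrightarrow> L (add \<phi> \<psi>) = L \<phi> + L \<psi>"
    and "\<phi> \<in> H \<Longrightarrow> L (scale c \<phi>) = c * L \<phi>"
  using assms unfolding bounded_functional_def by blast+

lemma mem_add [simp]: "\<phi> \<in> H \<Longrightarrow> \<psi> \<in> H \<Longrightarrow> add \<phi> \<psi> \<in> H"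
  unfolding add_def by (rule add_mem)

lemma mem_scale [simp]: "\<phi> \<in> H \<Longrightarrow> scale c \<phi> \<in> H"
  unfolding scale_def by (rule scale_mem)

lemma sub_eq: "sub \<phi> \<psi> = add \<phi> (scale (-1) \<psi>)"
  by (rule ext) (simp add: sub_def add_def scale_def restrict_def)

lemma mem_sub [simp]: "\<phi> \<in> H \<Longrightarrow> \<psi> \<in> H \<Longrightarrow> sub \<phi> \<psi> \<in> H"
  by (simp add: sub_eq)

lemma bounded_functional_sub:
  "bounded_functional L \<Longrightarrow> \<phi> \<in> H \<Longrightarrow> \<psi> \<in> H \<Longrightarrow> L (sub \<phi> \<psi>) = L \<phi> - L \<psi>"
  by (simp add: sub_eq bounded_functionalD)

lemma ip_add_left [simp]: "\<phi> \<in> H \<Longrightarrow> \<psi> \<in> H \<Longrightarrow> \<eta> \<in> H \<Longrightarrow> ip (add \<phi> \<psi>) \<eta> = ip \<phi> \<eta> + ip \<psi> \<eta>"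
  unfolding add_def by (rule ip_add)

lemma ip_scale_left [simp]: "\<phi> \<in> H \<Longrightarrow> \<psi> \<in> H \<Longrightarrow> ip (scale c \<phi>) \<psi> = c * ip \<phi> \<psi>"
  unfolding scale_def by (rule ip_scale)

lemma ip_add_right [simp]: "\<phi> \<in> H \<Longrightarrow> \<psi> \<in> H \<Longrightarrow> \<eta> \<in> H \<Longrightarrow> ip \<eta> (add \<phi> \<psi>) = ip \<eta> \<phi> + ip \<eta> \<psi>"
  using ip_add_left[of \<phi> \<psi> \<eta>] ip_commute mem_add by metis

lemma ip_scale_right [simp]: "\<phi> \<in> H \<Longrightarrow> \<psi> \<in> H \<Longrightarrow> ip \<psi> (scale c \<phi>) = c * ip \<psi> \<phi>"
  using ip_scale_left[of \<phi> \<psi> c] ip_commute mem_scale by metis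

lemma ip_add_self:
  "\<phi> \<in> H \<Longrightarrow> \<psi> \<in> H \<Longrightarrow> ip (add \<phi> \<psi>) (add \<phi> \<psi>) = ip \<phi> \<phi> + 2 * ip \<phi> \<psi> + ip \<psi> \<psi>"
  by (simp add: ip_commute[of \<psi> \<phi>])

lemma ip_sub_self:
  "\<phi> \<in> H \<Longrightarrow> \<psi> \<in> H \<Longrightarrow> ip (sub \<phi> \<psi>) (sub \<phi> \<psi>) = ip \<phi> \<phi> - 2 * ip \<phi> \<psi> + ip \<psi> \<psi>"
  by (simp add: sub_eq ip_commute[of \<psi> \<phi>])

lemma hnorm_nonneg: "\<phi> \<in> H \<Longrightarrow> 0 \<le> hnorm ip \<phi>"
  by (simp add: hnorm_def ip_nonneg)

lemma hnorm_squared: "\<phi> \<in> H \<Longrightarrow> (hnorm ip \<phi>)\<^sup>2 = ip \<phi> \<phi>"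
  by (simp add: hnorm_def ip_nonneg)

lemma hnorm_scale: "\<phi> \<in> H \<Longrightarrow> hnorm ip (scale c \<phi>) = \<bar>c\<bar> * hnorm ip \<phi>"
  by (simp add: hnorm_def real_sqrt_mult flip: mult.assoc)

lemma hnorm_sub_eq_0_iff:
  assumes "\<phi> \<in> H" "\<psi> \<in> H"
  shows "hnorm ip (sub \<phi> \<psi>) = 0 \<longleftrightarrow> \<phi> = \<psi>"
proof
  assume "hnorm ip (sub \<phi> \<psi>) = 0"
  hence "sub \<phi> \<psi> = (\<lambda>x\<in>\<Omega>. 0)" using assms by (intro ip_eq_zero) (auto simp: hnorm_def)
  hence "\<phi> x = \<psi> x" if "x \<in> \<Omega>" for x using that by (auto simp: sub_def fun_eq_iff restrict_def split: if_splits)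
  thus "\<phi> = \<psi>" using assms extensional by (intro extensionalityI[of \<phi> \<Omega> \<psi>]) auto
next
  assume "\<phi> = \<psi>"
  thus "hnorm ip (sub \<phi> \<psi>) = 0" using assms by (simp add: hnorm_def ip_sub_self)
qed

lemma Cauchy_Schwarz:
  assumes "\<phi> \<in> H" "\<psi> \<in> H"
  shows "\<bar>ip \<phi> \<psi>\<bar> \<le> hnorm ip \<phi> * hnorm ip \<psi>"
proof (cases "ip \<psi> \<psi> = 0")
  case True
  have "hnorm ip (sub (scale 0 \<psi>) \<psi>) = 0" using assms True by (simp add: hnorm_def ip_sub_self)
  hence "scale 0 \<psi> = \<psi>" using assms hnorm_sub_eq_0_iff by simp
  hence "ip \<phi> \<psi> = 0" using ip_scale_right[OF assms(2,1), of 0] by simp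
  thus ?thesis using hnorm_nonneg assms by simp
next
  case False
  hence pos: "ip \<psi> \<psi> > 0" using ip_nonneg[OF assms(2)] by linarith
  define t where "t = - ip \<phi> \<psi> / ip \<psi> \<psi>"
  have "0 \<le> ip (add \<phi> (scale t \<psi>)) (add \<phi> (scale t \<psi>))"
    by (intro ip_nonneg mem_add mem_scale assms)
  also have "\<dots> = ip \<phi> \<phi> + 2 * (t * ip \<phi> \<psi>) + t\<^sup>2 * ip \<psi> \<psi>"
    using assms by (simp add: ip_commute[of \<psi> \<phi>] power2_eq_square algebra_simps)
  also have "\<dots> = ip \<phi> \<phi> - (ip \<phi> \<psi>)\<^sup>2 / ip \<psi> \<psi>"
    using pos by (simp add: t_def field_simps power2_eq_square)
  finally have "(ip \<phi> \<psi>)\<^sup>2 \<le> ip \<phi> \<phi> * ip \<psi> \<psi>" using pos by (simp add: field_simps)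
  hence "sqrt ((ip \<phi> \<psi>)\<^sup>2) \<le> sqrt (ip \<phi> \<phi> * ip \<psi> \<psi>)" by (rule real_sqrt_le_mono)
  thus ?thesis by (simp add: hnorm_def real_sqrt_mult)
qed

lemma hnorm_add_le:
  assumes "\<phi> \<in> H" "\<psi> \<in> H"
  shows "hnorm ip (add \<phi> \<psi>) \<le> hnorm ip \<phi> + hnorm ip \<psi>"
proof (rule power2_le_imp_le)
  show "(hnorm ip (add \<phi> \<psi>))\<^sup>2 \<le> (hnorm ip \<phi> + hnorm ip \<psi>)\<^sup>2"
    using Cauchy_Schwarz[OF assms]
    unfolding power2_sum hnorm_squared[OF assms(1)] hnorm_squared[OF assms(2)]
      hnorm_squared[OF mem_add[OF assms]] ip_add_self[OF assms] by (simp add: algebra_simps)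
qed (use assms hnorm_nonneg in auto)

text \<open>
  The value off \<open>H\<close> is irrelevant, but \<open>Metric_space\<close> demands nonnegativity and symmetry there too.
\<close>

definition hdist :: "('a \<Rightarrow> real) \<Rightarrow> ('a \<Rightarrow> real) \<Rightarrow> real" where
  "hdist \<phi> \<psi> = (if \<phi> \<in> H \<and> \<psi> \<in> H then hnorm ip (sub \<phi> \<psi>) else 0)"

sublocale metric: Metric_space H hdist
proof
  fix \<phi> \<psi>
  show "0 \<le> hdist \<phi> \<psi>" by (simp add: hdist_def hnorm_nonneg)
  show "hdist \<phi> \<psi> = hdist \<psi> \<phi>" by (simp add: hdist_def hnorm_def ip_sub_self ip_commute)
next
  fix \<phi> \<psi> \<eta> assume *: "\<phi> \<in> H" "\<psi> \<in> H" "\<eta> \<in> H"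
  have "sub \<phi> \<eta> = add (sub \<phi> \<psi>) (sub \<psi> \<eta>)"
    by (rule ext) (simp add: sub_def add_def restrict_def)
  thus "hdist \<phi> \<eta> \<le> hdist \<phi> \<psi> + hdist \<psi> \<eta>"
    using hnorm_add_le[of "sub \<phi> \<psi>" "sub \<psi> \<eta>"] * by (simp add: hdist_def)
qed (simp add: hdist_def hnorm_sub_eq_0_iff)

lemma mcomplete: "metric.mcomplete"
  unfolding metric.mcomplete_def
proof (intro allI impI)
  fix s assume s: "metric.MCauchy s"
  have mem: "s n \<in> H" for n using s unfolding metric.MCauchy_def by auto
  have "\<exists>l\<in>H. (\<lambda>n. hnorm ip (\<lambda>x\<in>\<Omega>. s n x - l x)) \<longlonglongrightarrow> 0"
  proof (rule norm_complete[OF mem], intro allI impI)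
    fix e :: real assume "e > 0"
    then obtain N where "\<And>m n. N \<le> m \<Longrightarrow> N \<le> n \<Longrightarrow> hdist (s m) (s n) < e"
      using s unfolding metric.MCauchy_def by blast
    thus "\<exists>N. \<forall>m\<ge>N. \<forall>n\<ge>N. hnorm ip (\<lambda>x\<in>\<Omega>. s m x - s n x) < e"
      using mem by (auto simp: hdist_def sub_def)
  qed
  then obtain l where l: "l \<in> H" "(\<lambda>n. hnorm ip (sub (s n) l)) \<longlonglongrightarrow> 0" unfolding sub_def by blast
  hence "limitin metric.mtopology s l sequentially"
    unfolding metric.limit_metric_sequentially
  proof (intro conjI allI impI)
    fix e :: real assume "e > 0"
    with l(2) obtain N where "\<forall>n\<ge>N. norm (hnorm ip (sub (s n) l) - 0) < e" using LIMSEQ_D by blast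
    thus "\<exists>N. \<forall>n\<ge>N. s n \<in> H \<and> hdist (s n) l < e"
      using mem l by (intro exI[of _ N]) (auto simp: hdist_def)
  qed
  thus "\<exists>l. limitin metric.mtopology s l sequentially" by blast
qed

lemma uniform_boundedness:
  fixes T :: "nat \<Rightarrow> ('a \<Rightarrow> real) \<Rightarrow> real"
  assumes T: "\<And>j. bounded_functional (T j)"
    and bdd: "\<And>\<phi>. \<phi> \<in> H \<Longrightarrow> \<exists>C. \<forall>j. \<bar>T j \<phi>\<bar> \<le> C"
  shows "\<exists>B\<ge>0. \<forall>j. \<forall>\<phi>\<in>H. \<bar>T j \<phi>\<bar> \<le> B * hnorm ip \<phi>"
proof -
  define E where "E c = {\<phi>\<in>H. \<forall>j. \<bar>T j \<phi>\<bar> \<le> real c}" for c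
  have zero: "(\<lambda>x\<in>\<Omega>. 0) \<in> H" by (rule zero_mem)
  have closed: "closedin metric.mtopology (E c)" for c
    unfolding metric.closedin_metric
  proof (intro conjI allI impI)
    fix \<phi> assume \<phi>: "\<phi> \<in> H - E c"
    then obtain j where j: "\<bar>T j \<phi>\<bar> > c" by (auto simp: E_def not_le)
    obtain B where B: "B \<ge> 0" "\<And>\<phi>. \<phi> \<in> H \<Longrightarrow> \<bar>T j \<phi>\<bar> \<le> B * hnorm ip \<phi>"
      using T[of j] unfolding bounded_functional_def by blast
    define r where "r = (\<bar>T j \<phi>\<bar> - c) / (B + 1)"
    have r: "r > 0" "(B + 1) * r = \<bar>T j \<phi>\<bar> - c" using j B by (auto simp: r_def)
    have "\<psi> \<notin> E c" if \<psi>: "\<psi> \<in> metric.mball \<phi> r" for \<psi>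
    proof -
      have mem: "\<phi> \<in> H" "\<psi> \<in> H" and d: "hnorm ip (sub \<phi> \<psi>) < r" using \<psi> by (auto simp: hdist_def)
      have "\<bar>T j \<phi> - T j \<psi>\<bar> \<le> B * hnorm ip (sub \<phi> \<psi>)"
        using B(2)[of "sub \<phi> \<psi>"] mem bounded_functional_sub[OF T mem] by simp
      also have "\<dots> \<le> B * r" using B d by (intro mult_left_mono) auto
      also have "\<dots> < \<bar>T j \<phi>\<bar> - c" using r by (simp add: algebra_simps)
      finally have "\<bar>T j \<psi>\<bar> > c" by linarith
      thus ?thesis by (auto simp: E_def not_le)
    qed
    thus "\<exists>r>0. disjnt (E c) (metric.mball \<phi> r)" using r unfolding disjnt_def by blast
  qed (auto simp: E_def)
  have union: "\<Union>(range E) = H"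
  proof
    show "H \<subseteq> \<Union>(range E)"
    proof
      fix \<phi> assume \<phi>: "\<phi> \<in> H"
      then obtain C where C: "\<And>j. \<bar>T j \<phi>\<bar> \<le> C" using bdd by blast
      have "\<phi> \<in> E (nat \<lceil>C\<rceil>)"
        unfolding E_def using \<phi> order.trans[OF C real_nat_ceiling_ge] by blast
      thus "\<phi> \<in> \<Union>(range E)" by blast
    qed
  qed (auto simp: E_def)
  have "metric.mtopology interior_of H = H"
    using openin_topspace[of metric.mtopology] by (simp add: interior_of_openin)
  hence "\<exists>c. metric.mtopology interior_of (E c) \<noteq> {}"
    using metric.metric_Baire_category_alt[OF mcomplete, of "range E"] closed zero unfolding union by blast
  then obtain c \<phi>0 r where \<phi>0: "\<phi>0 \<in> H" "r > 0" "metric.mball \<phi>0 r \<subseteq> E c"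
    unfolding metric.metric_interior_of by blast
  have small: "\<bar>T j \<xi>\<bar> \<le> 2 * c" if \<xi>: "\<xi> \<in> H" "hnorm ip \<xi> < r" for \<xi> j
  proof -
    have "sub \<phi>0 (add \<phi>0 \<xi>) = scale (-1) \<xi>" by (rule ext) (simp add: sub_def add_def scale_def restrict_def)
    hence "hdist \<phi>0 (add \<phi>0 \<xi>) < r" using \<xi> \<phi>0 by (simp add: hdist_def hnorm_scale)
    hence "add \<phi>0 \<xi> \<in> E c" "\<phi>0 \<in> E c" using \<phi>0 \<xi> by auto
    hence "\<bar>T j (add \<phi>0 \<xi>)\<bar> \<le> c" "\<bar>T j \<phi>0\<bar> \<le> c" by (auto simp: E_def)
    thus ?thesis using bounded_functionalD(1)[OF T \<phi>0(1) \<xi>(1), of j] by linarith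
  qed
  have "\<bar>T j \<phi>\<bar> \<le> (4 * c / r) * hnorm ip \<phi>" if \<phi>: "\<phi> \<in> H" for j \<phi>
  proof (cases "hnorm ip \<phi> = 0")
    case True
    obtain B where "\<And>\<phi>. \<phi> \<in> H \<Longrightarrow> \<bar>T j \<phi>\<bar> \<le> B * hnorm ip \<phi>"
      using T[of j] unfolding bounded_functional_def by blast
    from this[OF \<phi>] True show ?thesis by simp
  next
    case False
    hence pos: "hnorm ip \<phi> > 0" using hnorm_nonneg[OF \<phi>] by linarith
    define t where "t = r / (2 * hnorm ip \<phi>)"
    have t: "t > 0" using pos \<phi>0 by (simp add: t_def)
    have "hnorm ip (scale t \<phi>) = r / 2" using t pos \<phi> by (simp add: hnorm_scale) (simp add: t_def)
    hence "\<bar>T j (scale t \<phi>)\<bar> \<le> 2 * c" using small[of "scale t \<phi>"] \<phi> \<phi>0 by simp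
    hence "t * \<bar>T j \<phi>\<bar> \<le> 2 * c" using t \<phi> by (simp add: bounded_functionalD(2)[OF T] abs_mult)
    thus ?thesis using pos \<phi>0(2) by (simp add: t_def field_simps)
  qed
  moreover have "4 * c / r \<ge> 0" using \<phi>0 by simp
  ultimately show ?thesis by (intro exI[of _ "4 * c / r"]) auto
qed

lemma bounded_functional_limit:
  assumes T: "\<And>j. bounded_functional (T j)"
    and lim: "\<And>\<phi>. \<phi> \<in> H \<Longrightarrow> (\<lambda>j. T j \<phi>) \<longlonglongrightarrow> L \<phi>"
  shows "bounded_functional L"
proof -
  have bdd: "\<exists>C. \<forall>j. \<bar>T j \<phi>\<bar> \<le> C" if "\<phi> \<in> H" for \<phi>
    using convergent_imp_bounded[OF lim[OF that]] by (auto simp: bounded_iff)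
  from uniform_boundedness[of T, OF T bdd]
  obtain B where B: "B \<ge> 0" "\<forall>j. \<forall>\<phi>\<in>H. \<bar>T j \<phi>\<bar> \<le> B * hnorm ip \<phi>" by auto
  show ?thesis unfolding bounded_functional_def
  proof (intro conjI ballI allI exI[of _ B])
    fix \<phi> \<psi> assume *: "\<phi> \<in> H" "\<psi> \<in> H"
    have "(\<lambda>j. T j (add \<phi> \<psi>)) \<longlonglongrightarrow> L \<phi> + L \<psi>"
      using tendsto_add[OF lim lim] * by (simp add: bounded_functionalD(1)[OF T])
    thus "L (add \<phi> \<psi>) = L \<phi> + L \<psi>" using lim * LIMSEQ_unique by (metis mem_add)
  next
    fix c \<phi> assume *: "\<phi> \<in> H"
    have "(\<lambda>j. T j (scale c \<phi>)) \<longlonglongrightarrow> c * L \<phi>"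
      using tendsto_mult_left[OF lim] * by (simp add: bounded_functionalD(2)[OF T])
    thus "L (scale c \<phi>) = c * L \<phi>" using lim * LIMSEQ_unique by (metis mem_scale)
  next
    fix \<phi> assume *: "\<phi> \<in> H"
    show "\<bar>L \<phi>\<bar> \<le> B * hnorm ip \<phi>"
      using tendsto_rabs[OF lim[OF *]] B(2) * by (intro LIMSEQ_le_const2) auto
  qed (rule B)
qed

lemma bounded_functional_ip: "\<psi> \<in> H \<Longrightarrow> bounded_functional (\<lambda>\<phi>. ip \<phi> \<psi>)"
  unfolding bounded_functional_def
  using Cauchy_Schwarz hnorm_nonneg by (auto simp: mult.commute intro!: exI[of _ "hnorm ip \<psi>"])

lemma bounded_functional_eval:
  assumes "x \<in> \<Omega>"
  shows "bounded_functional (\<lambda>\<phi>. \<phi> x)"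
proof -
  obtain B where "B \<ge> 0" "\<forall>\<phi>\<in>H. \<bar>ip \<phi> (\<lambda>y\<in>\<Omega>. k y x)\<bar> \<le> B * hnorm ip \<phi>"
    using bounded_functional_ip[OF kernel_mem[OF assms]] unfolding bounded_functional_def by blast
  thus ?thesis unfolding bounded_functional_def
    using assms by (auto simp: reproducing add_def scale_def)
qed

inductive_set midpoint_hull :: "('a \<Rightarrow> real) set \<Rightarrow> ('a \<Rightarrow> real) set" for A where
    base: "\<phi> \<in> A \<Longrightarrow> \<phi> \<in> midpoint_hull A"
  | midpoint: "\<phi> \<in> midpoint_hull A \<Longrightarrow> \<psi> \<in> midpoint_hull A \<Longrightarrow>
      scale (1/2) (add \<phi> \<psi>) \<in> midpoint_hull A"

lemma midpoint_hull_mono: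
  assumes "A \<subseteq> B" shows "midpoint_hull A \<subseteq> midpoint_hull B"
proof
  fix \<phi> assume "\<phi> \<in> midpoint_hull A"
  thus "\<phi> \<in> midpoint_hull B"
    by induction (use assms in \<open>auto intro: midpoint_hull.intros\<close>)
qed

lemma midpoint_hull_subset:
  assumes "A \<subseteq> H" "\<phi> \<in> midpoint_hull A" shows "\<phi> \<in> H"
  using assms(2) by induction (use assms(1) in auto)

lemma midpoint_hull_functional_close:
  assumes "A \<subseteq> H" "bounded_functional L" "\<And>\<phi>. \<phi> \<in> A \<Longrightarrow> \<bar>L \<phi> - a\<bar> \<le> \<epsilon>" "\<phi> \<in> midpoint_hull A"
  shows "\<bar>L \<phi> - a\<bar> \<le> \<epsilon>"
  using assms(4)
proof induction
  case (midpoint \<phi> \<psi>)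
  have "\<phi> \<in> H" "\<psi> \<in> H" using midpoint.hyps midpoint_hull_subset assms(1) by blast+
  hence "L (scale (1/2) (add \<phi> \<psi>)) = (L \<phi> + L \<psi>) / 2"
    by (simp add: bounded_functionalD[OF assms(2)])
  thus ?case using midpoint.IH unfolding abs_le_iff by (simp add: field_simps)
qed (use assms in auto)

text \<open>
  A substitute for weak sequential compactness: almost minimal elements of the convex hulls of the
  tails form a Cauchy sequence, and its limit is the weak limit as far as one exists.
\<close>

lemma bounded_sequence_weak_limit:
  fixes s :: "nat \<Rightarrow> 'a \<Rightarrow> real"
  assumes s: "\<And>n. s n \<in> H" and bdd: "\<And>n. hnorm ip (s n) \<le> M"
  shows "\<exists>p\<in>H. \<forall>L a. bounded_functional L \<longrightarrow> (\<lambda>n. L (s n)) \<longlonglongrightarrow> a \<longrightarrow> L p = a"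
proof -
  define K where "K m = midpoint_hull (s ` {m..})" for m
  have KH: "\<phi> \<in> H" if "\<phi> \<in> K m" for \<phi> m
    using that s midpoint_hull_subset[of "s ` {m..}" \<phi>] unfolding K_def by blast
  have K_mono: "K n \<subseteq> K m" if "m \<le> n" for m n
    unfolding K_def using that by (intro midpoint_hull_mono) auto
  have sK: "s m \<in> K m" for m unfolding K_def by (intro midpoint_hull.base) auto
  define d where "d m = Inf ((\<lambda>\<phi>. ip \<phi> \<phi>) ` K m)" for m
  have bb: "bdd_below ((\<lambda>\<phi>. ip \<phi> \<phi>) ` K m)" for m using KH ip_nonneg by (intro bdd_belowI2[of _ 0]) blast
  have d_le: "d m \<le> ip \<phi> \<phi>" if "\<phi> \<in> K m" for \<phi> m
    unfolding d_def using bb that by (intro cInf_lower) auto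
  have "d m \<le> d n" if "m \<le> n" for m n
    unfolding d_def using bb K_mono[OF that] sK by (intro cInf_superset_mono) auto
  moreover have "d m \<le> M\<^sup>2" for m
  proof -
    have "d m \<le> (hnorm ip (s m))\<^sup>2" using d_le[OF sK] by (simp add: hnorm_squared s)
    also have "\<dots> \<le> M\<^sup>2" using bdd hnorm_nonneg s by (intro power_mono) auto
    finally show ?thesis .
  qed
  ultimately obtain D where D: "d \<longlonglongrightarrow> D" "\<And>m. d m \<le> D"
    using incseq_convergent[of d "M\<^sup>2"] unfolding incseq_def by metis
  have "\<exists>\<phi>\<in>K m. ip \<phi> \<phi> < d m + 1 / Suc m" for m
    using cInf_lessD[of "(\<lambda>\<phi>. ip \<phi> \<phi>) ` K m" "d m + 1 / Suc m"] sK unfolding d_def by auto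
  then obtain p where p: "\<And>m. p m \<in> K m" "\<And>m. ip (p m) (p m) < d m + 1 / Suc m" by metis
  have pH: "p m \<in> H" for m using p KH by blast
  have close: "(hnorm ip (sub (p m) (p n)))\<^sup>2 \<le> 2 * (D - d m) + 4 / Suc m" if "m \<le> n" for m n
  proof -
    have "p m \<in> K m" "p n \<in> K m" using p K_mono[OF that] by auto
    hence "scale (1/2) (add (p m) (p n)) \<in> K m" unfolding K_def by (rule midpoint_hull.midpoint)
    from d_le[OF this] have "4 * d m \<le> ip (p m) (p m) + 2 * ip (p m) (p n) + ip (p n) (p n)"
      using pH by (simp add: ip_commute[of "p n" "p m"] field_simps)
    hence "ip (sub (p m) (p n)) (sub (p m) (p n)) \<le> 2 * ip (p m) (p m) + 2 * ip (p n) (p n) - 4 * d m"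
      using pH by (simp add: ip_sub_self)
    also have "\<dots> \<le> 2 * (d m + 1 / Suc m) + 2 * (d n + 1 / Suc n) - 4 * d m"
      by (intro diff_right_mono add_mono mult_left_mono less_imp_le[OF p(2)]) auto
    also have "\<dots> \<le> 2 * (d m + 1 / Suc m) + 2 * (D + 1 / Suc m) - 4 * d m"
    proof -
      have "1 / real (Suc n) \<le> 1 / real (Suc m)" using that by (intro divide_left_mono) auto
      thus ?thesis using D(2)[of n] by (intro diff_right_mono add_mono mult_left_mono) auto
    qed
    also have "\<dots> = 2 * (D - d m) + 4 / Suc m"
    proof -
      have "2 * (a + e) + 2 * (b + e) - 4 * a = 2 * (b - a) + 4 * e" for a b e :: real by simp
      from this[of "d m" "1 / Suc m" D] show ?thesis by (simp only: times_divide_eq_right mult_1_right)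
    qed
    finally show ?thesis using pH by (simp add: hnorm_squared)
  qed
  have lim0: "(\<lambda>m. 2 * (D - d m) + 4 / Suc m) \<longlonglongrightarrow> 0"
  proof -
    have "(\<lambda>m. 2 * (D - d m) + 4 * (1 / real (Suc m))) \<longlonglongrightarrow> 2 * (D - D) + 4 * 0"
      using lim_inverse_n' by (intro tendsto_intros D LIMSEQ_Suc[where f = "\<lambda>n. 1 / real n"])
    thus ?thesis by simp
  qed
  have "\<exists>l\<in>H. (\<lambda>n. hnorm ip (\<lambda>x\<in>\<Omega>. p n x - l x)) \<longlonglongrightarrow> 0"
  proof (rule norm_complete[OF pH], intro allI impI)
    fix e :: real assume e: "e > 0"
    with LIMSEQ_D[OF lim0, of "e\<^sup>2"] obtain N where N: "\<forall>m\<ge>N. norm (2 * (D - d m) + 4 / Suc m - 0) < e\<^sup>2" by auto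
    have *: "hnorm ip (sub (p m) (p n)) < e" if "N \<le> m" "m \<le> n" for m n
    proof -
      have "(hnorm ip (sub (p m) (p n)))\<^sup>2 < e\<^sup>2"
        using close[OF that(2)] N[rule_format, OF that(1)] by (simp only: real_norm_def)
      thus ?thesis using e by (intro power2_less_imp_less[of _ e]) auto
    qed
    have "hnorm ip (sub (p m) (p n)) < e" if "N \<le> m" "N \<le> n" for m n
    proof (cases "m \<le> n")
      case False
      thus ?thesis using *[of n m] that metric.commute[of "p m" "p n"] pH by (simp add: hdist_def)
    qed (use * that in auto)
    thus "\<exists>N. \<forall>m\<ge>N. \<forall>n\<ge>N. hnorm ip (\<lambda>x\<in>\<Omega>. p m x - p n x) < e" unfolding sub_def by blast
  qed
  then obtain q where q: "q \<in> H" "(\<lambda>n. hnorm ip (sub (p n) q)) \<longlonglongrightarrow> 0" unfolding sub_def by blast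
  have "L q = a" if L: "bounded_functional L" and a: "(\<lambda>n. L (s n)) \<longlonglongrightarrow> a" for L a
  proof -
    have "(\<lambda>n. L (p n)) \<longlonglongrightarrow> a"
    proof (rule LIMSEQ_I)
      fix e :: real assume "e > 0"
      with LIMSEQ_D[OF a, of "e/2"] obtain N where N: "\<And>n. n \<ge> N \<Longrightarrow> \<bar>L (s n) - a\<bar> < e/2" by auto
      have "\<bar>L (p n) - a\<bar> \<le> e/2" if "n \<ge> N" for n
      proof (rule midpoint_hull_functional_close[OF _ L])
        show "p n \<in> midpoint_hull (s ` {N..})" using p(1)[of n] K_mono[OF that] unfolding K_def by blast
      qed (use s N in \<open>auto intro: less_imp_le\<close>)
      thus "\<exists>N. \<forall>n\<ge>N. norm (L (p n) - a) < e" using \<open>e > 0\<close> by (intro exI[of _ N]) fastforce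
    qed
    moreover have "(\<lambda>n. L (p n)) \<longlonglongrightarrow> L q"
    proof -
      obtain B where B: "\<And>\<phi>. \<phi> \<in> H \<Longrightarrow> \<bar>L \<phi>\<bar> \<le> B * hnorm ip \<phi>"
        using L unfolding bounded_functional_def by blast
      have "(\<lambda>n. L (p n) - L q) \<longlonglongrightarrow> 0"
      proof (rule Lim_null_comparison)
        show "\<forall>\<^sub>F n in sequentially. norm (L (p n) - L q) \<le> B * hnorm ip (sub (p n) q)"
          using B[of "sub (p _) q"] q pH by (intro always_eventually allI) (simp add: bounded_functional_sub[OF L, symmetric])
        show "(\<lambda>n. B * hnorm ip (sub (p n) q)) \<longlonglongrightarrow> 0" using tendsto_mult_right_zero[OF q(2)] .
      qed
      thus ?thesis by (simp add: LIM_zero_iff)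
    qed
    ultimately show ?thesis using LIMSEQ_unique by blast
  qed
  with q show ?thesis by blast
qed

lemma bounded_sequence_weak_subsequence:
  fixes s :: "nat \<Rightarrow> 'a \<Rightarrow> real"
  assumes s: "\<And>n. s n \<in> H" and bdd: "\<And>n. hnorm ip (s n) \<le> M"
    and F: "countable F" "\<And>L. L \<in> F \<Longrightarrow> bounded_functional L"
  obtains r p where "strict_mono r" "p \<in> H" "\<forall>L\<in>F. (\<lambda>n. L (s (r n))) \<longlonglongrightarrow> L p"
proof -
  define G where "G = insert (\<lambda>_. 0) F"
  have G: "bounded_functional L" if "L \<in> G" for L
  proof (cases "L \<in> F")
    case False
    hence "L = (\<lambda>_. 0)" using that by (simp add: G_def)
    thus ?thesis unfolding bounded_functional_def by (auto intro!: exI[of _ 0])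
  qed (rule F)
  have ran: "range (from_nat_into G) = G" using F by (intro range_from_nat_into) (auto simp: G_def)
  define P where "P j r \<longleftrightarrow> convergent (\<lambda>n. from_nat_into G j (s (r n)))" for j and r :: "nat \<Rightarrow> nat"
  interpret subseqs P
  proof
    fix j and r :: "nat \<Rightarrow> nat"
    have "bounded_functional (from_nat_into G j)" using G ran by blast
    then obtain B where B: "B \<ge> 0" "\<And>\<phi>. \<phi> \<in> H \<Longrightarrow> \<bar>from_nat_into G j \<phi>\<bar> \<le> B * hnorm ip \<phi>"
      unfolding bounded_functional_def by blast
    have "\<bar>from_nat_into G j (s n)\<bar> \<le> B * M" for n
      using B(2)[OF s[of n]] mult_left_mono[OF bdd[of n] B(1)] by linarith
    hence "bounded (range (\<lambda>n. from_nat_into G j (s (r n))))" by (auto simp: bounded_iff)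
    from bounded_imp_convergent_subsequence[OF this] obtain l r' where
      "strict_mono r'" "((\<lambda>n. from_nat_into G j (s (r n))) \<circ> r') \<longlonglongrightarrow> l" by blast
    hence "P j (r \<circ> r')" by (simp add: P_def o_def convergentI)
    with \<open>strict_mono r'\<close> show "\<exists>r'. strict_mono r' \<and> P j (r \<circ> r')" by blast
  qed
  have conv: "convergent (\<lambda>n. L (s (diagseq n)))" if "L \<in> G" for L
  proof -
    have "L \<in> range (from_nat_into G)" unfolding ran by (rule that)
    then obtain j where j: "L = from_nat_into G j" by (rule imageE)
    have "P j (diagseq \<circ> (+) (Suc j))"
    proof (rule diagseq_holds)
      fix r t :: "nat \<Rightarrow> nat" and n assume "strict_mono r" "P n t"
      thus "P n (t \<circ> r)" using convergent_subseq_convergent[of "\<lambda>m. from_nat_into G n (s (t m))" r] by (simp add: P_def o_def)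
    qed
    hence "convergent (\<lambda>n. L (s (diagseq (n + Suc j))))" by (simp add: P_def j o_def add.commute)
    thus ?thesis by (rule convergent_ignore_initial_segment[THEN iffD1])
  qed
  from bounded_sequence_weak_limit[of "\<lambda>n. s (diagseq n)" M, OF s bdd]
  obtain p where p: "p \<in> H" "\<forall>L a. bounded_functional L \<longrightarrow> (\<lambda>n. L (s (diagseq n))) \<longlonglongrightarrow> a \<longrightarrow> L p = a" by (rule bexE)
  have "(\<lambda>n. L (s (diagseq n))) \<longlonglongrightarrow> L p" if "L \<in> F" for L
  proof -
    from conv[of L] that obtain a where a: "(\<lambda>n. L (s (diagseq n))) \<longlonglongrightarrow> a" unfolding convergent_def G_def by auto
    have "L p = a" using p(2)[rule_format, OF F(2)[OF that] a] .
    thus ?thesis using a by simp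
  qed
  with subseq_diagseq p(1) that show ?thesis by blast
qed

end

lemma has_derivative_imp_directional:
  fixes \<phi> :: "'a::real_inner \<Rightarrow> real"
  assumes "(\<phi> has_derivative (\<lambda>e. e \<bullet> D)) (at x)"
  shows "((\<lambda>s. \<phi> (x + s *\<^sub>R e)) has_real_derivative e \<bullet> D) (at 0)"
proof -
  have "((\<lambda>s. x + s *\<^sub>R e) has_derivative (\<lambda>s. s *\<^sub>R e)) (at 0)"
    by (auto intro!: derivative_eq_intros)
  from has_derivative_compose[OF this, of \<phi> "\<lambda>e. e \<bullet> D"] assms
  have "((\<lambda>s. \<phi> (x + s *\<^sub>R e)) has_derivative (\<lambda>s. s *\<^sub>R e \<bullet> D)) (at 0)"
    by simp
  thus ?thesis by (simp add: has_field_derivative_def mult_commute_abs)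
qed

lemma bounded_functional_combination:
  assumes "rkhs \<Omega> k H ip" "rkhs.bounded_functional \<Omega> H ip L1" "rkhs.bounded_functional \<Omega> H ip L2"
  shows "rkhs.bounded_functional \<Omega> H ip (\<lambda>\<phi>. (L1 \<phi> - L2 \<phi>) / t)"
proof -
  interpret rkhs \<Omega> k H ip by fact
  obtain B1 B2 where B: "B1 \<ge> 0" "\<forall>\<phi>\<in>H. \<bar>L1 \<phi>\<bar> \<le> B1 * hnorm ip \<phi>" "B2 \<ge> 0" "\<forall>\<phi>\<in>H. \<bar>L2 \<phi>\<bar> \<le> B2 * hnorm ip \<phi>"
    using assms(2,3) unfolding bounded_functional_def by metis
  have "\<bar>(L1 \<phi> - L2 \<phi>) / t\<bar> \<le> ((B1 + B2) / \<bar>t\<bar>) * hnorm ip \<phi>" if "\<phi> \<in> H" for \<phi>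
  proof -
    have "\<bar>L1 \<phi> - L2 \<phi>\<bar> \<le> (B1 + B2) * hnorm ip \<phi>"
      using B(2)[rule_format, OF that] B(4)[rule_format, OF that] by (simp add: algebra_simps)
    hence "\<bar>L1 \<phi> - L2 \<phi>\<bar> / \<bar>t\<bar> \<le> (B1 + B2) * hnorm ip \<phi> / \<bar>t\<bar>" by (rule divide_right_mono) simp
    thus ?thesis by simp
  qed
  thus ?thesis unfolding bounded_functional_def using B assms(2,3)
    by (auto simp: bounded_functionalD diff_divide_distrib add_divide_distrib algebra_simps
        intro!: exI[of _ "(B1 + B2) / \<bar>t\<bar>"])
qed

lemma bounded_functional_directional_derivative:
  fixes \<Omega> :: "(real^'n) set"
  assumes rk: "rkhs \<Omega> k H ip" and "open \<Omega>" "x \<in> \<Omega>"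
    and D: "\<And>\<phi>. \<phi> \<in> H \<Longrightarrow> (\<phi> has_derivative (\<lambda>e. e \<bullet> grad \<phi> x)) (at x)"
  shows "rkhs.bounded_functional \<Omega> H ip (\<lambda>\<phi>. e \<bullet> grad \<phi> x)"
proof -
  interpret rkhs \<Omega> k H ip by fact
  obtain r where r: "r > 0" "ball x r \<subseteq> \<Omega>" using assms open_contains_ball by blast
  define t where "t j = (r / (norm e + 1)) / real (Suc j)" for j
  have ne: "norm e + 1 > 0" by (simp add: add_nonneg_pos)
  have t: "t j > 0" for j using r ne by (simp add: t_def)
  have mem: "x + t j *\<^sub>R e \<in> \<Omega>" for j
  proof -
    have "t j \<le> r / (norm e + 1)" using r ne by (simp add: t_def divide_le_eq)
    hence "t j * norm e \<le> r / (norm e + 1) * norm e" by (intro mult_right_mono) auto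
    also have "\<dots> < r" using r ne by (simp add: field_simps)
    finally show ?thesis using r t[of j] by (auto simp: dist_norm)
  qed
  have t0: "t \<longlonglongrightarrow> 0"
    unfolding t_def by (rule LIMSEQ_Suc[OF lim_const_over_n])
  show ?thesis
  proof (rule bounded_functional_limit)
    fix j show "bounded_functional (\<lambda>\<phi>. (\<phi> (x + t j *\<^sub>R e) - \<phi> x) / t j)"
      using mem assms by (intro bounded_functional_combination[OF rk] bounded_functional_eval)
  next
    fix \<phi> assume "\<phi> \<in> H"
    have "((\<lambda>s. \<phi> (x + s *\<^sub>R e)) has_real_derivative e \<bullet> grad \<phi> x) (at 0)"
      by (rule has_derivative_imp_directional[OF D]) fact
    hence "(\<lambda>s. (\<phi> (x + s *\<^sub>R e) - \<phi> x) / s) \<midarrow>0\<rightarrow> e \<bullet> grad \<phi> x" by (simp add: DERIV_def)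
    hence "((\<lambda>s. (\<phi> (x + s *\<^sub>R e) - \<phi> x) / s) \<circ> t) \<longlonglongrightarrow> e \<bullet> grad \<phi> x"
      unfolding tendsto_at_iff_sequentially using t t0 by (auto simp: less_le)
    thus "(\<lambda>j. (\<phi> (x + t j *\<^sub>R e) - \<phi> x) / t j) \<longlonglongrightarrow> e \<bullet> grad \<phi> x" by (simp add: o_def)
  qed
qed

section \<open>Uniqueness for the HJB equation near the origin\<close>

definition hjb_op ::
  "(real^'n \<Rightarrow> real^'n) \<Rightarrow> (real^'n \<Rightarrow> real^'m^'n) \<Rightarrow> (real^'n \<Rightarrow> real) \<Rightarrow> real^'m^'m
    \<Rightarrow> real^'n \<Rightarrow> real^'n \<Rightarrow> real" where
  "hjb_op f g h R x D =
    f x \<bullet> D - 1/4 * ((transpose (g x) *v D) \<bullet> (matrix_inv R *v (transpose (g x) *v D))) + h x"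

lemma sym_pos_def_inv_mult:
  assumes "sym_pos_def R"
  shows "R *v (matrix_inv R *v p) = p"
proof -
  have "R *v y \<noteq> 0" if "y \<noteq> 0" for y
    using assms that unfolding sym_pos_def_def by fastforce
  hence "invertible R"
    unfolding invertible_left_inverse matrix_left_invertible_ker by blast
  hence "R ** matrix_inv R = mat 1"
    unfolding invertible_def matrix_inv_def by (rule someI2_ex) blast
  thus ?thesis by (simp add: matrix_vector_mul_assoc)
qed

lemma sym_pos_def_nonneg: "sym_pos_def R \<Longrightarrow> 0 \<le> w \<bullet> (R *v w)"
  unfolding sym_pos_def_def by (cases "w = 0") (auto intro: less_imp_le)

lemma sym_pos_def_swap: "sym_pos_def R \<Longrightarrow> q \<bullet> (R *v w) = w \<bullet> (R *v q)"
  unfolding sym_pos_def_def by (metis dot_lmul_matrix inner_commute transpose_matrix_vector)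

lemma weighted_norm_inv_squared:
  assumes "sym_pos_def R"
  shows "(weighted_norm (matrix_inv R) p)\<^sup>2 = p \<bullet> (matrix_inv R *v p)"
proof -
  have "p \<bullet> (matrix_inv R *v p) = (matrix_inv R *v p) \<bullet> (R *v (matrix_inv R *v p))"
    by (simp add: sym_pos_def_inv_mult[OF assms] inner_commute)
  thus ?thesis using sym_pos_def_nonneg[OF assms] by (simp add: weighted_norm_def)
qed

lemma hjb_residual_eq:
  "sym_pos_def R \<Longrightarrow> hjb_residual f g h R \<phi> x = hjb_op f g h R x (grad \<phi> x)"
  by (simp add: hjb_residual_def hjb_op_def weighted_norm_inv_squared)

lemma inner_transpose_mult: "(transpose A *v D) \<bullet> w = D \<bullet> (A *v w)"
  for A :: "real^'m^'n"
  by (simp add: transpose_matrix_vector dot_lmul_matrix)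

lemma hjb_op_gap:
  fixes g :: "real^'n \<Rightarrow> real^'m^'n" and x D :: "real^'n"
  assumes "sym_pos_def R"
  defines "q \<equiv> matrix_inv R *v (transpose (g x) *v D)"
  shows "D \<bullet> (f x + g x *v w) + h x + w \<bullet> (R *v w)
    = hjb_op f g h R x D + (w + (1/2) *\<^sub>R q) \<bullet> (R *v (w + (1/2) *\<^sub>R q))"
proof -
  have Rq: "R *v q = transpose (g x) *v D" by (simp add: q_def sym_pos_def_inv_mult[OF assms(1)])
  have "(w + (1/2) *\<^sub>R q) \<bullet> (R *v (w + (1/2) *\<^sub>R q))
      = w \<bullet> (R *v w) + w \<bullet> (R *v q) + 1/4 * (q \<bullet> (R *v q))"
    using sym_pos_def_swap[OF assms(1), of q w]
    by (simp add: matrix_vector_right_distrib matrix_vector_mult_scaleR inner_add_left inner_add_right field_simps)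
  also have "w \<bullet> (R *v q) = D \<bullet> (g x *v w)" by (simp add: Rq inner_commute inner_transpose_mult[symmetric])
  finally show ?thesis
    by (simp add: hjb_op_def Rq q_def[symmetric] inner_add_right inner_commute del: transpose_matrix_vector)
qed

lemma hjb_op_le:
  "sym_pos_def R \<Longrightarrow> hjb_op f g h R x D \<le> D \<bullet> (f x + g x *v w) + h x + w \<bullet> (R *v w)"
  by (simp add: hjb_op_gap sym_pos_def_nonneg)

lemma hjb_op_attained:
  assumes "sym_pos_def R"
  obtains w where "D \<bullet> (f x + g x *v w) + h x + w \<bullet> (R *v w) = hjb_op f g h R x D"
proof
  let ?q = "matrix_inv R *v (transpose (g x) *v D)"
  have "- ((1/2) *\<^sub>R ?q) + (1/2) *\<^sub>R ?q = 0" by simp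
  thus "D \<bullet> (f x + g x *v - ((1/2) *\<^sub>R ?q)) + h x + - ((1/2) *\<^sub>R ?q) \<bullet> (R *v - ((1/2) *\<^sub>R ?q)) = hjb_op f g h R x D"
    by (simp only: hjb_op_gap[OF assms] inner_zero_left add_0_right)
qed

lemma continuous_on_matrix_vector_mult:
  fixes A :: "'a::topological_space \<Rightarrow> real^'m^'n"
  assumes "continuous_on S A" "continuous_on S v"
  shows "continuous_on S (\<lambda>x. A x *v v x)"
  unfolding matrix_vector_mult_def using assms by (intro continuous_intros)

lemma continuous_on_transpose:
  fixes A :: "'a::topological_space \<Rightarrow> real^'m^'n"
  assumes "continuous_on S A"
  shows "continuous_on S (\<lambda>x. transpose (A x))"
  unfolding transpose_def using assms by (intro continuous_intros)

lemma continuous_on_hjb_op: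
  assumes "continuous_on S f" "continuous_on S g" "continuous_on S h" "continuous_on S D"
  shows "continuous_on S (\<lambda>x. hjb_op f g h R x (D x))"
  unfolding hjb_op_def using assms
  by (intro continuous_intros continuous_on_matrix_vector_mult continuous_on_transpose)

lemma directional_increase:
  fixes \<phi> :: "real^'n \<Rightarrow> real"
  assumes "(\<phi> has_derivative (\<lambda>e. e \<bullet> D)) (at p)" "F \<bullet> D > 0"
  obtains d where "d > 0" "\<And>s. 0 < s \<Longrightarrow> s < d \<Longrightarrow> \<phi> (p + s *\<^sub>R F) > \<phi> p"
  using DERIV_pos_inc_right[OF has_derivative_imp_directional[OF assms(1)] assms(2)] by auto

lemma hjb_solution_pos:
  assumes "open \<Omega>" "gradient_on \<Omega> v D" "\<And>x. x \<in> \<Omega> \<Longrightarrow> v x \<ge> 0"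
    and "\<And>x. x \<in> \<Omega> \<Longrightarrow> hjb_op f g h R x (D x) = 0"
    and "x \<in> \<Omega>" "h x > 0"
  shows "v x > 0"
proof (rule ccontr)
  assume "\<not> v x > 0"
  hence min: "\<forall>y\<in>\<Omega>. v x \<le> v y" using assms(3) assms(5) by fastforce
  have "(v has_derivative (\<lambda>e. e \<bullet> D x)) (at x)" using assms(2,5) by (simp add: gradient_on_def)
  hence "(\<lambda>e. e \<bullet> D x) = (\<lambda>e. 0)" using differential_zero_maxmin[OF assms(5,1)] min by blast
  hence "D x = 0" by (metis inner_eq_zero_iff)
  thus False using assms(4)[OF assms(5)] assms(6) by (simp add: hjb_op_def)
qed

text \<open>
  Along the closed-loop field of \<open>v1\<close> the function \<open>v1\<close> decreases while \<open>v2 - v1\<close> does not. Hence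
  \<open>v2 - v1 - \<epsilon> v1\<close> attains its maximum over a compact sublevel set of \<open>v1\<close> at the origin only.
\<close>

lemma hjb_comparison:
  fixes f :: "real^'n \<Rightarrow> real^'n" and g :: "real^'n \<Rightarrow> real^'m^'n"
  assumes R: "sym_pos_def R" and \<Omega>: "open \<Omega>" "0 \<in> \<Omega>"
    and h: "\<And>x. x \<noteq> 0 \<Longrightarrow> h x > 0"
    and D1: "gradient_on \<Omega> v1 D1" and D2: "gradient_on \<Omega> v2 D2"
    and nonneg: "\<And>x. x \<in> \<Omega> \<Longrightarrow> v1 x \<ge> 0"
    and zero: "v1 0 = 0" "v2 0 = 0"
    and hjb: "\<And>x. x \<in> \<Omega> \<Longrightarrow> hjb_op f g h R x (D1 x) = 0" "\<And>x. x \<in> \<Omega> \<Longrightarrow> hjb_op f g h R x (D2 x) = 0"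
  shows "\<exists>\<delta>>0. ball 0 \<delta> \<subseteq> \<Omega> \<and> (\<forall>x\<in>ball 0 \<delta>. v2 x \<le> v1 x)"
proof -
  have der: "(v1 has_derivative (\<lambda>e. e \<bullet> D1 x)) (at x)" "(v2 has_derivative (\<lambda>e. e \<bullet> D2 x)) (at x)" if "x \<in> \<Omega>" for x
    using D1 D2 that by (auto simp: gradient_on_def)
  have cont: "continuous_on \<Omega> v1" "continuous_on \<Omega> v2"
    by (fact gradient_on_imp_continuous_on[OF D1] gradient_on_imp_continuous_on[OF D2])+
  have pos: "v1 x > 0" if "x \<in> \<Omega>" "x \<noteq> 0" for x
    using hjb_solution_pos[OF \<Omega>(1) D1 nonneg hjb(1) that(1) h[OF that(2)]] by blast
  obtain r where r: "r > 0" "cball 0 r \<subseteq> \<Omega>" using \<Omega> open_contains_cball by blast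
  have sph: "sphere 0 r \<subseteq> \<Omega>" "sphere (0::real^'n) r \<noteq> {}" using r by auto
  obtain p0 where p0: "p0 \<in> sphere 0 r" "\<And>x. x \<in> sphere 0 r \<Longrightarrow> v1 p0 \<le> v1 x"
    using continuous_attains_inf[of "sphere 0 r" v1] sph continuous_on_subset[OF cont(1) sph(1)] by auto
  define c where "c = v1 p0"
  have c: "c > 0" unfolding c_def using p0(1) sph r by (intro pos) auto
  define S where "S = {x \<in> cball 0 r. v1 x \<le> c / 2}"
  have "closed S" unfolding S_def
    using continuous_on_subset[OF cont(1) r(2)] by (intro continuous_on_closed_Collect_le) auto
  hence compact: "compact S" unfolding S_def by (simp add: compact_eq_bounded_closed bounded_subset[OF bounded_cball[of 0 r]] subset_eq)
  have S\<Omega>: "S \<subseteq> \<Omega>" using r by (auto simp: S_def)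
  have S0: "0 \<in> S" using r c zero by (simp add: S_def)
  have key: "v2 x - v1 x \<le> \<epsilon> * v1 x" if x: "x \<in> S" and \<epsilon>: "\<epsilon> > 0" for x \<epsilon>
  proof -
    let ?w = "\<lambda>x. v2 x - (1 + \<epsilon>) * v1 x"
    have "continuous_on S ?w" using cont S\<Omega> by (auto intro!: continuous_intros intro: continuous_on_subset)
    then obtain p where p: "p \<in> S" "\<And>y. y \<in> S \<Longrightarrow> ?w y \<le> ?w p"
      using continuous_attains_sup[OF compact] S0 by blast
    have "p = 0"
    proof (rule ccontr)
      assume p0': "p \<noteq> 0"
      have p\<Omega>: "p \<in> \<Omega>" using p S\<Omega> by blast
      obtain u where u: "D1 p \<bullet> (f p + g p *v u) + h p + u \<bullet> (R *v u) = hjb_op f g h R p (D1 p)"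
        by (rule hjb_op_attained[OF R])
      define F where "F = f p + g p *v u"
      define l where "l = h p + u \<bullet> (R *v u)"
      have l: "l > 0" using h[OF p0'] sym_pos_def_nonneg[OF R, of u] by (simp add: l_def)
      have F1: "F \<bullet> D1 p = - l" using u hjb(1)[OF p\<Omega>] by (simp add: F_def l_def inner_commute)
      have F2: "F \<bullet> D2 p \<ge> - l" using hjb_op_le[OF R, of f g h p "D2 p" u] hjb(2)[OF p\<Omega>]
        by (simp add: F_def l_def inner_commute)
      have "((\<lambda>x. - v1 x) has_derivative (\<lambda>e. e \<bullet> (- D1 p))) (at p)"
        using has_derivative_minus[OF der(1)[OF p\<Omega>]] by simp
      then obtain d1 where d1: "d1 > 0" "\<And>s. 0 < s \<Longrightarrow> s < d1 \<Longrightarrow> - v1 (p + s *\<^sub>R F) > - v1 p"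
        by (rule directional_increase[of _ "- D1 p" p F]) (use F1 l in auto)
      have "(?w has_derivative (\<lambda>e. e \<bullet> (D2 p - (1 + \<epsilon>) *\<^sub>R D1 p))) (at p)"
        by (auto intro!: derivative_eq_intros der p\<Omega> simp: inner_diff_right)
      moreover have "F \<bullet> (D2 p - (1 + \<epsilon>) *\<^sub>R D1 p) > 0"
      proof -
        have "\<epsilon> * l > 0" using \<epsilon> l by simp
        thus ?thesis using F1 F2 by (simp add: inner_diff_right algebra_simps)
      qed
      ultimately obtain d2 where d2: "d2 > 0" "\<And>s. 0 < s \<Longrightarrow> s < d2 \<Longrightarrow> ?w (p + s *\<^sub>R F) > ?w p"
        by (rule directional_increase) blast
      have "norm p \<noteq> r" using p0(2)[of p] p(1) c by (auto simp: S_def c_def)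
      hence np: "norm p < r" using p(1) by (auto simp: S_def)
      define t where "t = (r - norm p) / (norm F + 1)"
      have nF: "norm F + 1 > 0" by (simp add: add_nonneg_pos)
      hence t: "t > 0" using np by (simp add: t_def)
      define s where "s = min (min d1 d2) t / 2"
      have s: "0 < s" "s < d1" "s < d2" "s \<le> t" using d1(1) d2(1) t by (auto simp: s_def)
      have "s * norm F \<le> s * (norm F + 1)" using s by (intro mult_left_mono) auto
      also have "\<dots> \<le> r - norm p" using s(4) nF by (simp add: t_def pos_le_divide_eq)
      finally have "norm (p + s *\<^sub>R F) \<le> r" using norm_triangle_ineq[of p "s *\<^sub>R F"] s by simp
      hence "p + s *\<^sub>R F \<in> S" using d1(2)[of s] s p(1) by (simp add: S_def)
      thus False using p(2) d2(2)[of s] s by fastforce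
    qed
    hence "?w x \<le> 0" using p(2)[OF x] zero by simp
    thus ?thesis by (simp add: algebra_simps)
  qed
  have le: "v2 x \<le> v1 x" if x: "x \<in> S" for x
  proof (rule ccontr)
    assume "\<not> v2 x \<le> v1 x"
    hence gap: "v2 x - v1 x > 0" by simp
    have v: "v1 x \<ge> 0" using nonneg x S\<Omega> by blast
    hence "(v2 x - v1 x) / (v1 x + 1) > 0" using gap by (intro divide_pos_pos) auto
    from key[OF x this] have "(v2 x - v1 x) * (v1 x + 1) \<le> (v2 x - v1 x) * v1 x"
      using v by (simp add: field_simps)
    thus False using gap v by (simp add: algebra_simps)
  qed
  have "isCont v1 0" using der(1)[OF \<Omega>(2)] has_derivative_continuous by blast
  then obtain d where d: "d > 0" "\<And>x. norm x < d \<Longrightarrow> \<bar>v1 x\<bar> < c / 2"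
    using c zero unfolding continuous_at_eps_delta by (metis dist_0_norm dist_commute dist_real_def diff_0_right half_gt_zero)
  have "ball 0 (min d r) \<subseteq> S"
  proof
    fix x :: "real^'n" assume "x \<in> ball 0 (min d r)"
    thus "x \<in> S" using d(2)[of x] by (auto simp: S_def)
  qed
  thus ?thesis using le S\<Omega> d(1) r(1) by (intro exI[of _ "min d r"]) auto
qed

section \<open>Trajectories of the control system\<close>

lemma norm_matrix_vector_mult_le:
  fixes A :: "real^'m^'n"
  shows "norm (A *v w) \<le> norm A * norm w"
proof -
  have "norm ((A *v w) $ i) \<le> norm (A $ i) * norm w" for i
    using Cauchy_Schwarz_ineq2[of "A $ i" w] by (simp add: matrix_vector_mul_component)
  hence "norm (A *v w) \<le> L2_set (\<lambda>i. norm (A $ i) * norm w) UNIV"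
    unfolding norm_vec_def[of "A *v w"] by (intro L2_set_mono) auto
  also have "\<dots> = norm A * norm w"
    by (simp add: norm_vec_def[of A] L2_set_left_distrib)
  finally show ?thesis .
qed

lemma C1_map_continuous_on: "C1_map F \<Longrightarrow> continuous_on S F"
  unfolding C1_map_def by (metis continuous_at_imp_continuous_on has_derivative_continuous)

lemma C1_map_lipschitz_on_compact:
  fixes F :: "'a::real_normed_vector \<Rightarrow> 'b::real_normed_vector"
  assumes "C1_map F" "compact K" "convex K"
  shows "\<exists>L\<ge>0. \<forall>x\<in>K. \<forall>y\<in>K. norm (F x - F y) \<le> L * norm (x - y)"
proof -
  obtain F' where F': "\<And>x. (F has_derivative blinfun_apply (F' x)) (at x)" "continuous_on UNIV F'"
    using assms(1) unfolding C1_map_def by blast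
  have "compact (F' ` K)"
    using assms(2) by (intro compact_continuous_image continuous_on_subset[OF F'(2)]) auto
  from compact_imp_bounded[OF this, unfolded bounded_pos]
  obtain L where L: "L > 0" "\<forall>z\<in>F' ` K. norm z \<le> L" by blast
  have "norm (F x - F y) \<le> L * norm (x - y)" if "x \<in> K" "y \<in> K" for x y
  proof (rule differentiable_bound[OF assms(3) _ _ that])
    fix z assume "z \<in> K"
    thus "(F has_derivative blinfun_apply (F' z)) (at z within K)" "onorm (blinfun_apply (F' z)) \<le> L"
      using F'(1) L(2) by (auto intro: has_derivative_at_withinI simp: norm_blinfun.rep_eq[symmetric])
  qed
  thus ?thesis using L(1) by (intro exI[of _ L]) auto
qed

lemma integral_cong_except_point:
  fixes F G :: "real \<Rightarrow> 'b::real_normed_vector"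
  assumes "\<And>s. s \<in> S \<Longrightarrow> s \<noteq> a \<Longrightarrow> F s = G s"
  shows "integral S F = integral S G"
  by (rule integral_spike[of "{a}"]) (use assms in auto)

lemma bounded_measurable_absolutely_integrable:
  fixes F :: "real \<Rightarrow> 'b::euclidean_space"
  assumes "F \<in> borel_measurable (lebesgue_on {a..b})" "\<And>s. s \<in> {a..b} \<Longrightarrow> norm (F s) \<le> K"
  shows "F absolutely_integrable_on {a..b}"
  by (rule measurable_bounded_by_integrable_imp_absolutely_integrable[where g = "\<lambda>_. K"]) (use assms in auto)

lemma bounded_measurable_integrable:
  fixes F :: "real \<Rightarrow> 'b::euclidean_space"
  assumes "F \<in> borel_measurable (lebesgue_on {a..b})" "\<And>s. s \<in> {a..b} \<Longrightarrow> norm (F s) \<le> K"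
  shows "F integrable_on {a..b}"
  using bounded_measurable_absolutely_integrable[OF assms] absolutely_integrable_on_def by blast

lemma norm_integral_le:
  fixes F :: "real \<Rightarrow> 'b::euclidean_space"
  assumes "F integrable_on {a..b}" "a \<le> b" "\<And>s. s \<in> {a..b} \<Longrightarrow> norm (F s) \<le> K"
  shows "norm (integral {a..b} F) \<le> K * (b - a)"
  using integral_norm_bound_integral[OF assms(1) integrable_const_ivl assms(3)] assms(2) by (simp add: mult.commute)

lemma gronwall_zero:
  fixes \<delta> :: "real \<Rightarrow> real"
  assumes cont: "continuous_on {0..t} \<delta>" and L: "L \<ge> 0"
    and le: "\<And>s. s \<in> {0..t} \<Longrightarrow> \<delta> s \<le> L * integral {0..s} \<delta>"
    and s: "s \<in> {0..t}"
  shows "\<delta> s \<le> 0"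
proof -
  have st: "{0..s} \<subseteq> {0..t}" "0 \<le> s" using s by auto
  let ?I = "\<lambda>x. integral {0..x} \<delta>"
  have "exp (- L * s) * ?I s \<le> exp (- L * 0) * ?I 0"
  proof (rule DERIV_nonpos_imp_decreasing_open[of 0 s "\<lambda>x. exp (- L * x) * ?I x"])
    fix x assume x: "0 < x" "x < s"
    have "(?I has_real_derivative \<delta> x) (at x within {0..t})"
      by (rule integral_has_real_derivative[OF cont]) (use x s in auto)
    moreover have "at x within {0..t} = at x" by (rule at_within_interior) (use x s in auto)
    ultimately have "(?I has_real_derivative \<delta> x) (at x)" by simp
    hence "((\<lambda>x. exp (- L * x) * ?I x) has_real_derivative exp (- L * x) * (\<delta> x - L * ?I x)) (at x)"
      by (auto intro!: derivative_eq_intros simp: algebra_simps)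
    moreover have "exp (- L * x) * (\<delta> x - L * ?I x) \<le> 0"
      using le[of x] x s by (intro mult_nonneg_nonpos) auto
    ultimately show "\<exists>y. ((\<lambda>x. exp (- L * x) * ?I x) has_real_derivative y) (at x) \<and> y \<le> 0" by blast
  next
    have "\<delta> integrable_on {0..s}" using continuous_on_subset[OF cont st(1)] by (rule integrable_continuous_real)
    thus "continuous_on {0..s} (\<lambda>x. exp (- L * x) * ?I x)"
      by (intro continuous_intros indefinite_integral_continuous_1)
  qed (use st in auto)
  hence "?I s \<le> 0" by (simp add: mult_le_0_iff)
  hence "L * ?I s \<le> 0" by (rule mult_nonneg_nonpos[OF L])
  thus ?thesis using le[OF s] by linarith
qed

definition bounded_control :: "(real \<Rightarrow> real^'m) \<Rightarrow> bool" where
  "bounded_control u \<longleftrightarrow> u \<in> borel_measurable lebesgue \<and> (\<exists>C. \<forall>t. norm (u t) \<le> C)"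

locale control_system =
  fixes f :: "real^'n \<Rightarrow> real^'n" and g :: "real^'n \<Rightarrow> real^'m^'n"
  assumes C1_f: "C1_map f" and C1_g: "C1_map g"
begin

definition field :: "(real \<Rightarrow> real^'m) \<Rightarrow> (real \<Rightarrow> real^'n) \<Rightarrow> real \<Rightarrow> real^'n" where
  "field u y s = f (y s) + g (y s) *v u s"

definition flow_on :: "(real \<Rightarrow> real^'m) \<Rightarrow> real^'n \<Rightarrow> real \<Rightarrow> (real \<Rightarrow> real^'n) \<Rightarrow> bool" where
  "flow_on u x t y \<longleftrightarrow>
    continuous_on {0..t} y \<and> (\<forall>s\<in>{0..t}. y s = x + integral {0..s} (field u y))"

lemma flow_on_subset: "flow_on u x t y \<Longrightarrow> s \<le> t \<Longrightarrow> flow_on u x s y"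
  unfolding flow_on_def by (auto intro: continuous_on_subset)

lemma flow_on_start: "flow_on u x t y \<Longrightarrow> 0 \<le> t \<Longrightarrow> y 0 = x"
  unfolding flow_on_def by auto

lemma flow_on_cong:
  assumes "\<And>s. s \<in> {0..t} \<Longrightarrow> y s = z s" "\<And>s. 0 \<le> s \<Longrightarrow> s < t \<Longrightarrow> u s = w s"
  shows "flow_on u x t y \<longleftrightarrow> flow_on w x t z"
proof -
  have "integral {0..s} (field u y) = integral {0..s} (field w z)" if "s \<in> {0..t}" for s
    by (rule integral_cong_except_point[of _ t]) (use assms that in \<open>auto simp: field_def\<close>)
  moreover have "continuous_on {0..t} y \<longleftrightarrow> continuous_on {0..t} z"
    by (rule continuous_on_cong) (use assms in auto)
  ultimately show ?thesis using assms(1) unfolding flow_on_def by simp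
qed

lemma field_measurable:
  assumes "continuous_on {a..b} y" "bounded_control u"
  shows "field u y \<in> borel_measurable (lebesgue_on {a..b})"
proof -
  have u: "u \<in> borel_measurable (lebesgue_on {a..b})"
    using assms(2) unfolding bounded_control_def by (simp add: measurable_restrict_space1)
  have "continuous_on {a..b} (\<lambda>s. f (y s))" "continuous_on {a..b} (\<lambda>s. g (y s))"
    using C1_map_continuous_on[OF C1_f, of UNIV] C1_map_continuous_on[OF C1_g, of UNIV] assms(1)
    by (auto intro: continuous_on_compose2)
  hence fg: "(\<lambda>s. f (y s)) \<in> borel_measurable (lebesgue_on {a..b})"
      "(\<lambda>s. g (y s)) \<in> borel_measurable (lebesgue_on {a..b})"
    by (auto intro: continuous_imp_measurable_on_sets_lebesgue)
  have "(\<lambda>s. g (y s) *v u s) \<in> borel_measurable (lebesgue_on {a..b})"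
    by (rule borel_measurable_continuous_Pair[OF fg(2) u])
      (intro continuous_on_matrix_vector_mult continuous_intros)
  thus ?thesis unfolding field_def using fg(1) by simp
qed

lemma field_bounded:
  assumes "continuous_on {a..b} y" "bounded_control u"
  obtains K where "K > 0" "\<And>s. s \<in> {a..b} \<Longrightarrow> norm (field u y s) \<le> K"
proof -
  obtain C where C: "\<And>t. norm (u t) \<le> C" using assms(2) unfolding bounded_control_def by blast
  have cpt: "compact ((\<lambda>s. f (y s)) ` {a..b})" "compact ((\<lambda>s. g (y s)) ` {a..b})"
    using C1_map_continuous_on[OF C1_f, of UNIV] C1_map_continuous_on[OF C1_g, of UNIV] assms(1)
    by (auto intro!: compact_continuous_image intro: continuous_on_compose2)
  from compact_imp_bounded[OF cpt(1), unfolded bounded_pos]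
  obtain A where A: "A > 0" "\<And>s. s \<in> {a..b} \<Longrightarrow> norm (f (y s)) \<le> A" by blast
  from compact_imp_bounded[OF cpt(2), unfolded bounded_pos]
  obtain B where B: "B > 0" "\<And>s. s \<in> {a..b} \<Longrightarrow> norm (g (y s)) \<le> B" by blast
  have C0: "C \<ge> 0" using order.trans[OF norm_ge_zero C] .
  have "norm (field u y s) \<le> A + B * C" if "s \<in> {a..b}" for s
  proof -
    have "norm (g (y s) *v u s) \<le> B * C"
      by (rule order.trans[OF norm_matrix_vector_mult_le mult_mono[OF B(2)[OF that] C]]) (use B in auto)
    thus ?thesis using A(2)[OF that] norm_triangle_ineq[of "f (y s)" "g (y s) *v u s"]
      unfolding field_def by linarith
  qed
  moreover have "A + B * C > 0" using A B C0 by (simp add: add_pos_nonneg)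
  ultimately show ?thesis using that by blast
qed

lemma field_absolutely_integrable:
  assumes "continuous_on {a..b} y" "bounded_control u"
  shows "field u y absolutely_integrable_on {a..b}"
proof -
  obtain K where "\<And>s. s \<in> {a..b} \<Longrightarrow> norm (field u y s) \<le> K" using field_bounded[OF assms] by metis
  thus ?thesis by (rule bounded_measurable_absolutely_integrable[OF field_measurable[OF assms]])
qed

lemma field_integrable:
  assumes "continuous_on {a..b} y" "bounded_control u"
  shows "field u y integrable_on {a..b}"
  using field_absolutely_integrable[OF assms] absolutely_integrable_on_def by blast

lemma field_lipschitz:
  assumes "bounded_control u"
  obtains L where "L > 0" "\<And>y z s. norm (y s - c) \<le> \<rho> \<Longrightarrow> norm (z s - c) \<le> \<rho> \<Longrightarrow>
    norm (field u y s - field u z s) \<le> L * norm (y s - z s)"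
proof -
  obtain C where C: "\<And>t. norm (u t) \<le> C" using assms unfolding bounded_control_def by blast
  have C0: "C \<ge> 0" using order.trans[OF norm_ge_zero C] .
  obtain Lf Lg where Lf: "Lf \<ge> 0" "\<forall>x\<in>cball c \<rho>. \<forall>y\<in>cball c \<rho>. norm (f x - f y) \<le> Lf * norm (x - y)"
    and Lg: "Lg \<ge> 0" "\<forall>x\<in>cball c \<rho>. \<forall>y\<in>cball c \<rho>. norm (g x - g y) \<le> Lg * norm (x - y)"
    using C1_map_lipschitz_on_compact[OF C1_f compact_cball convex_cball, of c \<rho>]
      C1_map_lipschitz_on_compact[OF C1_g compact_cball convex_cball, of c \<rho>] by blast
  have "norm (field u y s - field u z s) \<le> (Lf + Lg * C + 1) * norm (y s - z s)"
    if "norm (y s - c) \<le> \<rho>" "norm (z s - c) \<le> \<rho>" for y z s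
  proof -
    have mem: "y s \<in> cball c \<rho>" "z s \<in> cball c \<rho>" using that by (auto simp: dist_norm norm_minus_commute)
    have "field u y s - field u z s = (f (y s) - f (z s)) + (g (y s) - g (z s)) *v u s"
      by (simp add: field_def matrix_vector_mult_diff_rdistrib)
    also have "norm \<dots> \<le> norm (f (y s) - f (z s)) + norm (g (y s) - g (z s)) * norm (u s)"
      using norm_triangle_le[OF add_left_mono[OF norm_matrix_vector_mult_le]] by blast
    also have "\<dots> \<le> Lf * norm (y s - z s) + Lg * norm (y s - z s) * C"
      using Lf(2) Lg mem C by (intro add_mono mult_mono) auto
    also have "\<dots> \<le> (Lf + Lg * C + 1) * norm (y s - z s)" by (simp add: algebra_simps)
    finally show ?thesis .
  qed
  moreover have "Lf + Lg * C + 1 > 0" using Lf Lg C0 by (simp add: add_nonneg_pos)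
  ultimately show ?thesis using that by blast
qed

lemma flow_on_unique:
  assumes u: "bounded_control u" and y: "flow_on u x t y" and z: "flow_on u x t z" and s: "s \<in> {0..t}"
  shows "y s = z s"
proof -
  have cont: "continuous_on {0..t} y" "continuous_on {0..t} z" using y z by (auto simp: flow_on_def)
  hence "compact (y ` {0..t} \<union> z ` {0..t})" by (intro compact_Un compact_continuous_image) auto
  from compact_imp_bounded[OF this, unfolded bounded_iff]
  obtain \<rho> where \<rho>: "\<forall>p\<in>y ` {0..t} \<union> z ` {0..t}. norm p \<le> \<rho>" by blast
  obtain L where L: "L > 0" "\<And>y z s. norm (y s - 0) \<le> \<rho> \<Longrightarrow> norm (z s - 0) \<le> \<rho> \<Longrightarrow>
      norm (field u y s - field u z s) \<le> L * norm (y s - z s)"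
    by (rule field_lipschitz[OF u, of 0 \<rho>]) (rule that)
  define \<delta> where "\<delta> r = norm (y r - z r)" for r
  have c\<delta>: "continuous_on {0..t} \<delta>" unfolding \<delta>_def using cont by (intro continuous_intros)
  have "\<delta> s \<le> 0"
  proof (rule gronwall_zero[OF c\<delta> less_imp_le[OF L(1)] _ s])
    fix r assume r: "r \<in> {0..t}"
    hence sub: "{0..r} \<subseteq> {0..t}" by auto
    have int: "field u y integrable_on {0..r}" "field u z integrable_on {0..r}"
      using cont sub by (auto intro!: field_integrable u intro: continuous_on_subset)
    have "y r - z r = integral {0..r} (field u y) - integral {0..r} (field u z)"
      using y z r unfolding flow_on_def by simp
    also have "\<dots> = integral {0..r} (\<lambda>q. field u y q - field u z q)"
      using int by (simp add: integral_diff)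
    also have "norm \<dots> \<le> integral {0..r} (\<lambda>q. L * \<delta> q)"
    proof (rule integral_norm_bound_integral)
      show "(\<lambda>q. L * \<delta> q) integrable_on {0..r}"
        by (intro integrable_continuous_real continuous_intros continuous_on_subset[OF c\<delta> sub])
      fix q assume "q \<in> {0..r}"
      hence "q \<in> {0..t}" using sub by auto
      thus "norm (field u y q - field u z q) \<le> L * \<delta> q"
        unfolding \<delta>_def using \<rho> by (intro L(2)) auto
    qed (use int in \<open>auto intro: integrable_diff\<close>)
    also have "\<dots> = L * integral {0..r} \<delta>" by simp
    finally show "\<delta> r \<le> L * integral {0..r} \<delta>" by (simp add: \<delta>_def)
  qed
  thus ?thesis by (simp add: \<delta>_def)
qed

lemma flow_on_exists:
  assumes u: "bounded_control u"
  shows "\<exists>\<delta>>0. \<exists>y. flow_on u x \<delta> y"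
proof -
  obtain C where C: "\<And>t. norm (u t) \<le> C" using u unfolding bounded_control_def by blast
  have C0: "C \<ge> 0" using order.trans[OF norm_ge_zero C] .
  obtain L where L: "L > 0" "\<And>y z s. norm (y s - x) \<le> 1 \<Longrightarrow> norm (z s - x) \<le> 1 \<Longrightarrow>
      norm (field u y s - field u z s) \<le> L * norm (y s - z s)"
    by (rule field_lipschitz[OF u, of x 1]) (rule that)
  define K where "K = norm (f x) + norm (g x) * C + L"
  have K: "norm (field u y s) \<le> K" if "norm (y s - x) \<le> 1" for y s
  proof -
    have "norm (field u y s - field u (\<lambda>_. x) s) \<le> L * norm (y s - x)" using that by (intro L(2)) auto
    also have "\<dots> \<le> L * 1" using that L by (intro mult_left_mono) auto
    finally have 1: "norm (field u y s - field u (\<lambda>_. x) s) \<le> L" by simp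
    have "norm (g x *v u s) \<le> norm (g x) * C"
      by (rule order.trans[OF norm_matrix_vector_mult_le mult_left_mono[OF C]]) simp
    hence "norm (field u (\<lambda>_. x) s) \<le> norm (f x) + norm (g x) * C"
      unfolding field_def by (intro norm_triangle_le) auto
    thus ?thesis using 1 norm_triangle_sub[of "field u y s" "field u (\<lambda>_. x) s"] unfolding K_def by linarith
  qed
  have Kpos: "K > 0" using L(1) C0 unfolding K_def by (intro add_nonneg_pos) auto
  define \<delta> where "\<delta> = min (1 / K) (1 / (2 * L))"
  have \<delta>: "\<delta> > 0" "K * \<delta> \<le> 1" "L * \<delta> \<le> 1/2"
  proof -
    show "\<delta> > 0" using Kpos L(1) by (simp add: \<delta>_def)
    have "K * \<delta> \<le> K * (1 / K)" using Kpos by (intro mult_left_mono) (auto simp: \<delta>_def)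
    thus "K * \<delta> \<le> 1" using Kpos by simp
    have "L * \<delta> \<le> L * (1 / (2 * L))" using L(1) by (intro mult_left_mono) (auto simp: \<delta>_def)
    thus "L * \<delta> \<le> 1/2" using L(1) by simp
  qed
  define clamp where "clamp t = max 0 (min \<delta> t)" for t
  have clamp: "clamp t \<in> {0..\<delta>}" for t using \<delta>(1) by (auto simp: clamp_def)
  define S :: "(real \<Rightarrow>\<^sub>C (real^'n)) set" where "S = PiC UNIV (\<lambda>_. cball x 1)"
  define P where "P Y = (\<lambda>t. x + integral {0..clamp t} (field u (apply_bcontfun Y)))" for Y :: "real \<Rightarrow>\<^sub>C (real^'n)"
  define \<Phi> where "\<Phi> Y = Bcontfun (P Y)" for Y
  have SD: "norm (apply_bcontfun Y t - x) \<le> 1" if "Y \<in> S" for Y t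
    using that by (auto simp: S_def mem_PiC_iff Pi_iff dist_norm norm_minus_commute)
  have int: "field u (apply_bcontfun Y) integrable_on {0..t}" for Y t
    by (rule field_integrable[OF _ u]) simp
  have P_close: "norm (P Y t - x) \<le> 1" if "Y \<in> S" for Y t
  proof -
    have "norm (P Y t - x) \<le> K * (clamp t - 0)"
      unfolding P_def using clamp[of t] by (simp, intro order.trans[OF norm_integral_le[OF int _ K[OF SD[OF that]]]]) auto
    also have "\<dots> \<le> K * \<delta>" using clamp[of t] Kpos by (intro mult_left_mono) auto
    finally show ?thesis using \<delta>(2) by linarith
  qed
  have P_cont: "continuous_on UNIV (P Y)" for Y
  proof -
    have "continuous_on UNIV clamp" unfolding clamp_def by (intro continuous_intros)
    hence "continuous_on UNIV (\<lambda>t. integral {0..clamp t} (field u (apply_bcontfun Y)))"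
      by (rule continuous_on_compose2[OF indefinite_integral_continuous_1[OF int[of Y \<delta>]]]) (use clamp in auto)
    thus ?thesis unfolding P_def by (intro continuous_intros)
  qed
  have \<Phi>: "apply_bcontfun (\<Phi> Y) = P Y" if "Y \<in> S" for Y
  proof -
    have "P Y \<in> bcontfun"
    proof (rule bcontfun_normI[OF P_cont])
      fix t show "norm (P Y t) \<le> norm x + 1"
        using norm_triangle_sub[of "P Y t" x] P_close[OF that, of t] by linarith
    qed
    thus ?thesis unfolding \<Phi>_def by (rule Bcontfun_inverse)
  qed
  have "\<exists>!Y. Y \<in> S \<and> \<Phi> Y = Y"
  proof (rule Banach_fix[where c = "1/2"])
    show "complete S" unfolding S_def complete_eq_closed by (rule closed_PiC) simp
    have "const_bcontfun x \<in> S" by (simp add: S_def mem_PiC_iff const_bcontfun.rep_eq)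
    thus "S \<noteq> {}" by blast
    show "\<Phi> ` S \<subseteq> S"
      using \<Phi> P_close by (auto simp: S_def mem_PiC_iff Pi_iff dist_norm norm_minus_commute)
    show "dist (\<Phi> Y) (\<Phi> Z) \<le> 1/2 * dist Y Z" if YZ: "Y \<in> S" "Z \<in> S" for Y Z
    proof (rule dist_bound)
      fix t
      have "P Y t - P Z t = integral {0..clamp t} (\<lambda>s. field u (apply_bcontfun Y) s - field u (apply_bcontfun Z) s)"
        unfolding P_def by (simp add: integral_diff[OF int int])
      also have "norm \<dots> \<le> (L * dist Y Z) * (clamp t - 0)"
      proof (rule norm_integral_le[OF integrable_diff[OF int int]])
        fix s
        have "norm (field u (apply_bcontfun Y) s - field u (apply_bcontfun Z) s)
            \<le> L * norm (apply_bcontfun Y s - apply_bcontfun Z s)"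
          by (intro L(2) SD YZ)
        also have "\<dots> \<le> L * dist Y Z"
          using dist_bounded[of Y s Z] L(1) by (intro mult_left_mono) (auto simp: dist_norm)
        finally show "norm (field u (apply_bcontfun Y) s - field u (apply_bcontfun Z) s) \<le> L * dist Y Z" .
      qed (use clamp[of t] in auto)
      also have "\<dots> \<le> (L * dist Y Z) * \<delta>" using clamp[of t] L(1) by (intro mult_left_mono) auto
      also have "\<dots> \<le> 1/2 * dist Y Z" using mult_right_mono[OF \<delta>(3), of "dist Y Z"] by (simp add: mult_ac)
      finally show "dist (apply_bcontfun (\<Phi> Y) t) (apply_bcontfun (\<Phi> Z) t) \<le> 1/2 * dist Y Z"
        by (simp add: \<Phi> YZ dist_norm)
    qed
  qed auto
  then obtain Y where Y: "Y \<in> S" "\<Phi> Y = Y" by blast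
  have "flow_on u x \<delta> (apply_bcontfun Y)"
    unfolding flow_on_def
  proof (intro conjI ballI)
    fix s assume s: "s \<in> {0..\<delta>}"
    have "apply_bcontfun Y s = P Y s" using \<Phi>[OF Y(1)] Y(2) by simp
    moreover have "clamp s = s" using s by (auto simp: clamp_def)
    ultimately show "apply_bcontfun Y s = x + integral {0..s} (field u (apply_bcontfun Y))" by (simp add: P_def)
  qed simp
  thus ?thesis using \<delta>(1) by blast
qed

lemma bounded_control_shift:
  assumes "bounded_control u" shows "bounded_control (\<lambda>s. u (a + s))"
proof -
  have "(\<lambda>s::real. a + s) \<in> lebesgue \<rightarrow>\<^sub>M lebesgue"
    using lebesgue_affine_measurable[of "\<lambda>_. 1" a] by simp
  thus ?thesis using assms measurable_compose[of "\<lambda>s. a + s" lebesgue lebesgue u borel]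
    unfolding bounded_control_def by auto
qed

definition switch :: "real \<Rightarrow> (real \<Rightarrow> real^'m) \<Rightarrow> (real \<Rightarrow> real^'m) \<Rightarrow> real \<Rightarrow> real^'m" where
  "switch a u w s = (if s < a then u s else w (s - a))"

lemma bounded_control_switch:
  assumes "bounded_control u" "bounded_control w"
  shows "bounded_control (switch a u w)"
proof -
  obtain C D where CD: "\<And>t. norm (u t) \<le> C" "\<And>t. norm (w t) \<le> D"
    using assms unfolding bounded_control_def by blast
  have [measurable]: "(\<lambda>s. w (s - a)) \<in> borel_measurable lebesgue" "u \<in> borel_measurable lebesgue"
    using bounded_control_shift[OF assms(2), of "-a"] assms(1) unfolding bounded_control_def by simp_all
  have [measurable]: "{s::real. s < a} \<in> sets lebesgue" using lmeasurable_iff_integrable by auto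
  have "(\<lambda>s. if s \<in> {s. s < a} then u s else w (s - a)) \<in> borel_measurable lebesgue"
    by (rule measurable_If_set) auto
  moreover have "norm (switch a u w t) \<le> max C D" for t
    using CD[of t] CD(2)[of "t - a"] by (auto simp: switch_def le_max_iff_disj)
  moreover have "switch a u w = (\<lambda>s. if s \<in> {s. s < a} then u s else w (s - a))"
    by (auto simp: switch_def)
  ultimately show ?thesis unfolding bounded_control_def by metis
qed

lemma flow_on_split:
  assumes u: "bounded_control u" and ab: "0 \<le> a" "0 \<le> b"
  shows "flow_on u x (a + b) y \<longleftrightarrow>
    flow_on u x a y \<and> flow_on (\<lambda>s. u (a + s)) (y a) b (\<lambda>s. y (a + s))"
proof -
  let ?u = "\<lambda>s. u (a + s)" and ?y = "\<lambda>s. y (a + s)"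
  have key: "integral {0..a + s} (field u y) = integral {0..a} (field u y) + integral {0..s} (field ?u ?y)"
    if "continuous_on {0..a + b} y" "s \<in> {0..b}" for s
  proof -
    have i: "field u y integrable_on {0..a + s}"
      by (rule field_integrable[OF continuous_on_subset[OF that(1)] u]) (use that in auto)
    have "integral {0..a + s} (field u y) = integral {0..a} (field u y) + integral {a..a + s} (field u y)"
      by (rule Henstock_Kurzweil_Integration.integral_combine[OF ab(1) _ i, symmetric]) (use that in auto)
    also have "integral {a..a + s} (field u y) = integral {0..s} (field u y \<circ> (+) a)"
      using integral_shift_Icc_real[of 0 s "field u y" a] by (simp add: add.commute)
    also have "field u y \<circ> (+) a = field ?u ?y" by (auto simp: field_def)
    finally show ?thesis .
  qed
  have split: "{0..a + b} = {0..a} \<union> {a..a + b}" using ab by auto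
  have shift: "continuous_on {a..a + b} y \<longleftrightarrow> continuous_on {0..b} ?y"
  proof
    assume "continuous_on {a..a + b} y"
    thus "continuous_on {0..b} ?y" by (rule continuous_on_compose2) (auto intro!: continuous_intros)
  next
    assume "continuous_on {0..b} ?y"
    hence "continuous_on {a..a + b} (\<lambda>s. ?y (s - a))" by (rule continuous_on_compose2) (auto intro!: continuous_intros)
    thus "continuous_on {a..a + b} y" by simp
  qed
  show ?thesis
  proof
    assume L: "flow_on u x (a + b) y"
    hence c: "continuous_on {0..a + b} y" by (simp add: flow_on_def)
    have "y (a + s) = y a + integral {0..s} (field ?u ?y)" if s: "s \<in> {0..b}" for s
    proof -
      have "y (a + s) = x + integral {0..a + s} (field u y)" "y a = x + integral {0..a} (field u y)"
        using L s ab unfolding flow_on_def by auto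
      thus ?thesis using key[OF c s] by simp
    qed
    moreover have "continuous_on {0..b} ?y"
      unfolding shift[symmetric] by (rule continuous_on_subset[OF c]) (use ab in auto)
    moreover have "flow_on u x a y" by (rule flow_on_subset[OF L]) (use ab in auto)
    ultimately show "flow_on u x a y \<and> flow_on ?u (y a) b ?y" unfolding flow_on_def by blast
  next
    assume R: "flow_on u x a y \<and> flow_on ?u (y a) b ?y"
    have c: "continuous_on {0..a + b} y"
      unfolding split using R shift by (intro continuous_on_closed_Un) (auto simp: flow_on_def)
    have "y s = x + integral {0..s} (field u y)" if s: "s \<in> {0..a + b}" for s
    proof (cases "s \<le> a")
      case True
      thus ?thesis using R s unfolding flow_on_def by auto
    next
      case False
      hence s': "s - a \<in> {0..b}" using s by auto
      hence "y (a + (s - a)) = y a + integral {0..s - a} (field ?u ?y)"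
        using R unfolding flow_on_def by blast
      moreover have "y a = x + integral {0..a} (field u y)" using R ab unfolding flow_on_def by auto
      ultimately show ?thesis using key[OF c s'] by simp
    qed
    thus "flow_on u x (a + b) y" using c unfolding flow_on_def by blast
  qed
qed

lemma flow_on_concat:
  assumes u: "bounded_control u" "bounded_control w" and ab: "0 \<le> a" "0 \<le> b"
    and y: "flow_on u x a y" and z: "flow_on w (y a) b z"
  shows "flow_on (switch a u w) x (a + b) (\<lambda>s. if s \<le> a then y s else z (s - a))"
    (is "flow_on ?c x _ ?p")
proof -
  have z0: "z 0 = y a" by (rule flow_on_start[OF z ab(2)])
  have "flow_on ?c x a ?p"
    by (rule flow_on_cong[THEN iffD1, OF _ _ y]) (auto simp: switch_def)
  moreover have "flow_on (\<lambda>s. ?c (a + s)) (?p a) b (\<lambda>s. ?p (a + s))"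
    by (rule flow_on_cong[THEN iffD1, of b z _ w]) (use z z0 in \<open>auto simp: switch_def\<close>)
  ultimately show ?thesis
    using flow_on_split[OF bounded_control_switch[OF u] ab] by blast
qed

lemma caratheodory_solution_iff:
  assumes u: "bounded_control u"
  shows "caratheodory_solution f g u x T y \<longleftrightarrow>
    0 < T \<and> (\<forall>t. 0 \<le> t \<and> ereal t < T \<longrightarrow> flow_on u x t y)"
proof
  assume L: "caratheodory_solution f g u x T y"
  have "flow_on u x t y" if t: "0 \<le> t" "ereal t < T" for t
    unfolding flow_on_def
  proof (intro conjI ballI)
    show "continuous_on {0..t} y"
      using L t unfolding caratheodory_solution_def
      by (auto elim!: continuous_on_subset) (metis ereal_less_eq(3) order.strict_trans1)
    fix s assume s: "s \<in> {0..t}"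
    hence "ereal s < T" using t by (metis atLeastAtMost_iff ereal_less_eq(3) order.strict_trans1)
    hence "set_integrable lebesgue {0..s} (field u y)" "y s = x + (LINT q:{0..s}|lebesgue. field u y q)"
      using L s unfolding caratheodory_solution_def field_def by auto
    thus "y s = x + integral {0..s} (field u y)" using set_lebesgue_integral_eq_integral(2) by metis
  qed
  thus "0 < T \<and> (\<forall>t. 0 \<le> t \<and> ereal t < T \<longrightarrow> flow_on u x t y)"
    using L unfolding caratheodory_solution_def by blast
next
  assume R: "0 < T \<and> (\<forall>t. 0 \<le> t \<and> ereal t < T \<longrightarrow> flow_on u x t y)"
  let ?S = "{t. 0 \<le> t \<and> ereal t < T}"
  have "continuous_on ?S y"
    unfolding continuous_on_eq_continuous_within
  proof
    fix s assume s: "s \<in> ?S"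
    then obtain t where t: "s < t" "ereal t < T" using ereal_dense2[of "ereal s" T] by auto
    have "at s within ?S = at s within {0..t}"
    proof (rule at_within_nhd[of s "{..<t}"])
      show "?S \<inter> {..<t} - {s} = {0..t} \<inter> {..<t} - {s}"
        using t(2) by (auto) (metis ereal_less_eq(3) less_imp_le order.strict_trans1)
    qed (use t in auto)
    moreover have "continuous_on {0..t} y" using R s t unfolding flow_on_def by auto
    ultimately show "continuous (at s within ?S) y"
      using s t by (simp add: continuous_on_eq_continuous_within)
  qed
  moreover have "set_integrable lebesgue {0..t} (\<lambda>s. f (y s) + g (y s) *v u s) \<and>
      y t = x + (LINT s:{0..t}|lebesgue. f (y s) + g (y s) *v u s)" if t: "0 \<le> t \<and> ereal t < T" for t
  proof -
    have fl: "flow_on u x t y" using R t by blast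
    hence "field u y absolutely_integrable_on {0..t}"
      using field_absolutely_integrable u unfolding flow_on_def by blast
    moreover have "y t = x + integral {0..t} (field u y)" using fl t unfolding flow_on_def by auto
    ultimately show ?thesis
      using set_lebesgue_integral_eq_integral(2)[of "{0..t}" "field u y"] unfolding field_def[abs_def] by simp
  qed
  ultimately show "caratheodory_solution f g u x T y"
    using R unfolding caratheodory_solution_def by blast
qed

definition global_flow :: "(real \<Rightarrow> real^'m) \<Rightarrow> real^'n \<Rightarrow> (real \<Rightarrow> real^'n) \<Rightarrow> bool" where
  "global_flow u x y \<longleftrightarrow> (\<forall>t\<ge>0. flow_on u x t y)"

lemma caratheodory_solution_infinity:
  "bounded_control u \<Longrightarrow> caratheodory_solution f g u x \<infinity> y \<longleftrightarrow> global_flow u x y"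
  by (auto simp: caratheodory_solution_iff global_flow_def)

lemma maximal_solution_exists:
  assumes u: "bounded_control u"
  shows "\<exists>T y. maximal_solution f g u x T y"
proof -
  define E where "E = {ereal t |t. 0 < t \<and> (\<exists>y. flow_on u x t y)}"
  define T where "T = Sup E"
  obtain \<delta> where \<delta>: "\<delta> > 0" "\<exists>y. flow_on u x \<delta> y" using flow_on_exists[OF u] by blast
  hence "ereal \<delta> \<le> T" unfolding T_def E_def by (intro Sup_upper) blast
  hence T0: "0 < T" using \<delta>(1) by (metis ereal_less(2) less_le_trans)
  have ex: "\<exists>y. flow_on u x t y" if "ereal t < T" for t
  proof -
    from that obtain a where "a \<in> E" "ereal t < a" unfolding T_def less_Sup_iff by blast
    then obtain t' y where "t < t'" "flow_on u x t' y" unfolding E_def by auto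
    thus ?thesis using flow_on_subset less_imp_le by blast
  qed
  define Y where "Y t = (SOME y. flow_on u x t y)" for t
  have Y: "flow_on u x t (Y t)" if "ereal t < T" for t
    unfolding Y_def using ex[OF that] by (rule someI_ex)
  define y where "y t = Y t t" for t
  have "flow_on u x t y" if t: "0 \<le> t" "ereal t < T" for t
  proof -
    have "y s = Y t s" if s: "s \<in> {0..t}" for s
    proof -
      have "ereal s < T" using s t by (metis atLeastAtMost_iff ereal_less_eq(3) order.strict_trans1)
      hence "flow_on u x s (Y s)" "flow_on u x s (Y t)"
        using Y flow_on_subset[OF Y[OF t(2)]] s by auto
      thus ?thesis unfolding y_def using flow_on_unique[OF u, of x s "Y s" "Y t" s] s by auto
    qed
    thus ?thesis using flow_on_cong[of t y "Y t" u u] Y[OF t(2)] by simp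
  qed
  hence sol: "caratheodory_solution f g u x T y" using T0 caratheodory_solution_iff[OF u] by blast
  have "\<not> (\<exists>T' z. T < T' \<and> caratheodory_solution f g u x T' z \<and> P z T')" for P
  proof clarify
    fix T' z assume T': "T < T'" "caratheodory_solution f g u x T' z"
    then obtain t where t: "T < ereal t" "ereal t < T'" using ereal_dense2 by blast
    hence t0: "0 < t" using T0 by (metis ereal_less(2) order.strict_trans)
    hence "flow_on u x t z" using T'(2) t unfolding caratheodory_solution_iff[OF u] by auto
    hence "ereal t \<le> T" unfolding T_def E_def using t0 by (intro Sup_upper) blast
    thus False using t by simp
  qed
  with sol have "maximal_solution f g u x T y" unfolding maximal_solution_def by blast
  thus ?thesis by blast
qed

lemma maximal_trajectory_maximal:
  assumes u: "bounded_control u" and "maximal_trajectory f g u x = (T, y)"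
  shows "maximal_solution f g u x T y"
proof -
  have "\<exists>p. case p of (T, y) \<Rightarrow> maximal_solution f g u x T y"
    using maximal_solution_exists[OF u] by auto
  from someI_ex[OF this] assms(2) show ?thesis unfolding maximal_trajectory_def by simp
qed

lemma maximal_trajectory_global:
  assumes u: "bounded_control u" and y: "global_flow u x y" and max: "maximal_trajectory f g u x = (T, z)"
  shows "T = \<infinity>" and "\<And>t. t \<ge> 0 \<Longrightarrow> z t = y t"
proof -
  note m = maximal_trajectory_maximal[OF u max]
  hence c: "caratheodory_solution f g u x T z" by (simp add: maximal_solution_def)
  have eq: "y t = z t" if "0 \<le> t" "ereal t < T" for t
    using flow_on_unique[OF u, of x t y z t] y c that
    unfolding global_flow_def caratheodory_solution_iff[OF u] by auto
  show T: "T = \<infinity>"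
  proof (rule ccontr)
    assume "T \<noteq> \<infinity>"
    hence "T < \<infinity>" by simp
    moreover have "caratheodory_solution f g u x \<infinity> y" using y caratheodory_solution_infinity[OF u] by blast
    ultimately show False using m eq unfolding maximal_solution_def by blast
  qed
  show "z t = y t" if "t \<ge> 0" for t using eq[OF that] T by simp
qed

end

lemma admissible_control_bounded_version:
  assumes "u \<in> admissible_controls"
  shows "\<exists>w N. bounded_control w \<and> negligible N \<and> (\<forall>t\<ge>0. t \<notin> N \<longrightarrow> w t = u t)"
proof -
  obtain C where u: "u \<in> borel_measurable (lebesgue_on {0..})" and C: "AE t in lebesgue_on {0..}. norm (u t) \<le> C"
    using assms unfolding admissible_controls_def by blast
  have "AE t in lebesgue. t \<in> {0..} \<longrightarrow> norm (u t) \<le> C"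
    using C by (subst (asm) AE_restrict_space_iff) auto
  then obtain N where N: "N \<in> null_sets lebesgue" "{t. \<not> (t \<in> {0..} \<longrightarrow> norm (u t) \<le> C)} \<subseteq> N"
    unfolding eventually_ae_filter by auto
  define w1 where "w1 t = (if t \<in> {0..} then u t else 0)" for t
  define w where "w t = (if norm (w1 t) \<le> C then w1 t else 0)" for t
  have [measurable]: "w1 \<in> borel_measurable lebesgue"
    unfolding w1_def using u by (subst borel_measurable_if) auto
  have "w \<in> borel_measurable lebesgue" unfolding w_def by measurable
  moreover have "norm (w t) \<le> max C 0" for t by (simp add: w_def le_max_iff_disj)
  ultimately have "bounded_control w" unfolding bounded_control_def by blast
  moreover have "negligible N" using N by (simp add: negligible_iff_null_sets)
  moreover have "w t = u t" if "t \<ge> 0" "t \<notin> N" for t using that N by (auto simp: w_def w1_def)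
  ultimately show ?thesis by blast
qed

lemma bounded_control_admissible: "bounded_control u \<Longrightarrow> u \<in> admissible_controls"
  unfolding bounded_control_def admissible_controls_def by (auto simp: measurable_restrict_space1)

lemma caratheodory_solution_control_cong:
  assumes N: "negligible N" "\<And>t. t \<ge> 0 \<Longrightarrow> t \<notin> N \<Longrightarrow> w t = u t"
  shows "caratheodory_solution f g w x T y = caratheodory_solution f g u x T y"
proof -
  let ?F = "\<lambda>u s. f (y s) + g (y s) *v u s"
  have si: "set_integrable lebesgue {0..t} (?F w) \<longleftrightarrow> set_integrable lebesgue {0..t} (?F u)" for t
    by (rule absolutely_integrable_spike_eq[OF N(1)]) (use N in auto)
  have li: "(LINT s:{0..t}|lebesgue. ?F w s) = (LINT s:{0..t}|lebesgue. ?F u s)"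
    if *: "set_integrable lebesgue {0..t} (?F u)" for t
  proof -
    have "integral {0..t} (?F w) = integral {0..t} (?F u)"
      by (rule integral_spike[OF N(1)]) (use N in auto)
    thus ?thesis
      by (simp only: set_lebesgue_integral_eq_integral(2)[OF *]
          set_lebesgue_integral_eq_integral(2)[OF si[THEN iffD2, OF *]])
  qed
  have "(set_integrable lebesgue {0..t} (?F w) \<and> y t = x + (LINT s:{0..t}|lebesgue. ?F w s)) \<longleftrightarrow>
      (set_integrable lebesgue {0..t} (?F u) \<and> y t = x + (LINT s:{0..t}|lebesgue. ?F u s))" for t
    by (simp only: si) (rule conj_cong[OF refl], simp only: li)
  thus ?thesis unfolding caratheodory_solution_def by (simp only:)
qed

lemma cost_control_cong:
  assumes N: "negligible N" "\<And>t. t \<ge> 0 \<Longrightarrow> t \<notin> N \<Longrightarrow> w t = u t"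
  shows "cost f g h R x w = cost f g h R x u"
proof -
  have "maximal_trajectory f g w x = maximal_trajectory f g u x"
    unfolding maximal_trajectory_def maximal_solution_def
    by (simp add: caratheodory_solution_control_cong[OF N])
  moreover have "(\<integral>\<^sup>+ t\<in>{0..}. ennreal (h (y t) + w t \<bullet> (R *v w t)) \<partial>lebesgue) =
      (\<integral>\<^sup>+ t\<in>{0..}. ennreal (h (y t) + u t \<bullet> (R *v u t)) \<partial>lebesgue)" for y
  proof (rule nn_integral_cong_AE)
    have "AE t in lebesgue. t \<notin> N" using N(1) by (simp add: AE_not_in negligible_iff_null_sets)
    thus "AE t in lebesgue. ennreal (h (y t) + w t \<bullet> (R *v w t)) * indicator {0..} t =
        ennreal (h (y t) + u t \<bullet> (R *v u t)) * indicator {0..} t"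
      by (rule AE_mp) (use N(2) in \<open>auto simp: indicator_def\<close>)
  qed
  ultimately show ?thesis unfolding cost_def by (simp split: prod.split)
qed

section \<open>Dynamic programming\<close>

locale control_problem = control_system f g
  for f :: "real^'n \<Rightarrow> real^'n" and g :: "real^'n \<Rightarrow> real^'m^'n" +
  fixes h :: "real^'n \<Rightarrow> real" and R :: "real^'m^'m"
  assumes C1_h: "C1_map h" and R: "sym_pos_def R"
    and f0: "f 0 = 0" and h0: "h 0 = 0" and h_pos: "\<And>x. x \<noteq> 0 \<Longrightarrow> h x > 0"
begin

definition running :: "(real \<Rightarrow> real^'m) \<Rightarrow> (real \<Rightarrow> real^'n) \<Rightarrow> real \<Rightarrow> real" where
  "running u y s = h (y s) + u s \<bullet> (R *v u s)"

definition total_cost :: "(real \<Rightarrow> real^'m) \<Rightarrow> (real \<Rightarrow> real^'n) \<Rightarrow> ennreal" where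
  "total_cost u y = (\<integral>\<^sup>+ t\<in>{0..}. ennreal (running u y t) \<partial>lebesgue)"

lemma h_nonneg: "h x \<ge> 0"
  using h_pos[of x] h0 by (cases "x = 0") auto

lemma running_nonneg: "running u y s \<ge> 0"
  using h_nonneg sym_pos_def_nonneg[OF R] by (simp add: running_def)

lemma running_measurable:
  assumes "continuous_on S y" "bounded_control u" "S \<in> sets lebesgue"
  shows "running u y \<in> borel_measurable (lebesgue_on S)"
proof -
  have u: "u \<in> borel_measurable (lebesgue_on S)"
    using assms(2) unfolding bounded_control_def by (simp add: measurable_restrict_space1)
  have "continuous_on S (\<lambda>s. h (y s))"
    by (rule continuous_on_compose2[OF C1_map_continuous_on[OF C1_h, of UNIV] assms(1)]) auto
  hence "(\<lambda>s. h (y s)) \<in> borel_measurable (lebesgue_on S)"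
    by (rule continuous_imp_measurable_on_sets_lebesgue[OF _ assms(3)])
  moreover have "(\<lambda>s. R *v u s) \<in> borel_measurable (lebesgue_on S)"
    by (rule borel_measurable_continuous_on[OF matrix_vector_mult_linear_continuous_on u])
  ultimately show ?thesis unfolding running_def using u by measurable
qed

lemma running_bounded:
  assumes "continuous_on {a..b} y" "bounded_control u"
  shows "\<exists>K. \<forall>s\<in>{a..b}. norm (running u y s) \<le> K"
proof -
  obtain C where C: "\<And>t. norm (u t) \<le> C" using assms(2) unfolding bounded_control_def by blast
  have C0: "C \<ge> 0" using order.trans[OF norm_ge_zero C] .
  have "continuous_on {a..b} (\<lambda>s. h (y s))"
    by (rule continuous_on_compose2[OF C1_map_continuous_on[OF C1_h, of UNIV] assms(1)]) auto
  hence "compact ((\<lambda>s. h (y s)) ` {a..b})" by (intro compact_continuous_image) auto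
  from compact_imp_bounded[OF this, unfolded bounded_iff]
  obtain A where A: "\<And>s. s \<in> {a..b} \<Longrightarrow> norm (h (y s)) \<le> A" by blast
  have "norm (running u y s) \<le> A + C * (norm R * C)" if "s \<in> {a..b}" for s
  proof -
    have "norm (R *v u s) \<le> norm R * C"
      by (rule order.trans[OF norm_matrix_vector_mult_le mult_left_mono[OF C]]) simp
    hence "norm (u s) * norm (R *v u s) \<le> C * (norm R * C)" using C C0 by (intro mult_mono) auto
    hence "norm (u s \<bullet> (R *v u s)) \<le> C * (norm R * C)"
      using Cauchy_Schwarz_ineq2[of "u s" "R *v u s"] by simp
    thus ?thesis unfolding running_def using A[OF that] by (intro norm_triangle_mono)
  qed
  thus ?thesis by blast
qed

lemma running_absolutely_integrable:
  assumes "continuous_on {a..b} y" "bounded_control u"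
  shows "running u y absolutely_integrable_on {a..b}"
proof -
  obtain K where "\<forall>s\<in>{a..b}. norm (running u y s) \<le> K" using running_bounded[OF assms] by blast
  thus ?thesis
    by (intro bounded_measurable_absolutely_integrable[of _ _ _ K] running_measurable[OF assms]) auto
qed

lemma running_integrable:
  assumes "continuous_on {a..b} y" "bounded_control u"
  shows "running u y integrable_on {a..b}"
  using running_absolutely_integrable[OF assms] absolutely_integrable_on_def by blast

lemma running_nn_integral:
  assumes "continuous_on {a..b} y" "bounded_control u"
  shows "(\<integral>\<^sup>+ t\<in>{a..b}. ennreal (running u y t) \<partial>lebesgue) = ennreal (integral {a..b} (running u y))"
proof -
  note ai = running_absolutely_integrable[OF assms]
  have "(\<integral>\<^sup>+ t\<in>{a..b}. ennreal (running u y t) \<partial>lebesgue)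
      = (\<integral>\<^sup>+ t. ennreal (indicator {a..b} t *\<^sub>R running u y t) \<partial>lebesgue)"
    by (intro nn_integral_cong) (auto simp: indicator_def)
  also have "\<dots> = ennreal (LINT t:{a..b}|lebesgue. running u y t)"
    unfolding set_lebesgue_integral_def
    by (rule nn_integral_eq_integral) (use ai running_nonneg in \<open>auto simp: set_integrable_def indicator_def\<close>)
  also have "\<dots> = ennreal (integral {a..b} (running u y))"
    using set_lebesgue_integral_eq_integral(2)[OF ai] by simp
  finally show ?thesis .
qed

lemma total_cost_split:
  assumes y: "continuous_on {0..} y" and u: "bounded_control u" and a: "a \<ge> 0"
  shows "total_cost u y = ennreal (integral {0..a} (running u y)) + total_cost (\<lambda>s. u (a + s)) (\<lambda>s. y (a + s))"
proof -
  let ?r = "\<lambda>t. ennreal (running u y t)"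
  have meas: "(\<lambda>t. ?r t * indicator S t) \<in> borel_measurable lebesgue" if "S \<subseteq> {0..}" "S \<in> sets lebesgue" for S
  proof -
    have "(\<lambda>t. if t \<in> S then running u y t else 0) \<in> borel_measurable lebesgue"
      by (rule borel_measurable_if_I[OF running_measurable[OF continuous_on_subset[OF y that(1)] u that(2)] that(2)])
    hence "(\<lambda>t. ennreal (if t \<in> S then running u y t else 0)) \<in> borel_measurable lebesgue" by measurable
    moreover have "(\<lambda>t. ennreal (if t \<in> S then running u y t else 0)) = (\<lambda>t. ?r t * indicator S t)"
      by (auto simp: indicator_def)
    ultimately show ?thesis by simp
  qed
  have "total_cost u y = (\<integral>\<^sup>+ t. ?r t * indicator {0..a} t + ?r t * indicator {a<..} t \<partial>lebesgue)"
    unfolding total_cost_def using a by (intro nn_integral_cong) (auto simp: indicator_def)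
  also have "\<dots> = (\<integral>\<^sup>+ t. ?r t * indicator {0..a} t \<partial>lebesgue) + (\<integral>\<^sup>+ t. ?r t * indicator {a<..} t \<partial>lebesgue)"
    using a by (intro nn_integral_add meas) auto
  also have "(\<integral>\<^sup>+ t. ?r t * indicator {0..a} t \<partial>lebesgue) = ennreal (integral {0..a} (running u y))"
    by (rule running_nn_integral[OF continuous_on_subset[OF y] u]) auto
  also have "(\<integral>\<^sup>+ t. ?r t * indicator {a<..} t \<partial>lebesgue)
      = (\<integral>\<^sup>+ t. ?r (a + 1 * t) * indicator {a<..} (a + 1 * t) \<partial>lebesgue)"
    using a by (subst nn_integral_real_affine_lebesgue[where c = 1 and t = a, OF meas]) auto
  also have "\<dots> = total_cost (\<lambda>s. u (a + s)) (\<lambda>s. y (a + s))"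
    unfolding total_cost_def
  proof (rule nn_integral_cong_AE)
    have "AE t in lebesgue. t \<notin> {0::real}" by (intro AE_not_in) auto
    thus "AE t in lebesgue. ?r (a + 1 * t) * indicator {a<..} (a + 1 * t)
        = ennreal (running (\<lambda>s. u (a + s)) (\<lambda>s. y (a + s)) t) * indicator {0..} t"
      by (rule AE_mp) (auto simp: indicator_def running_def)
  qed
  finally show ?thesis .
qed

lemma global_flow_continuous:
  assumes "global_flow u x y" shows "continuous_on {0..} y"
  unfolding continuous_on_eq_continuous_within
proof
  fix s :: real assume s: "s \<in> {0..}"
  have "at s within {0..} = at s within {0..s + 1}"
    by (rule at_within_nhd[of s "{..<s + 1}"]) auto
  moreover have "continuous_on {0..s + 1} y" using assms s unfolding global_flow_def flow_on_def by auto
  ultimately show "continuous (at s within {0..}) y"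
    using s by (simp add: continuous_on_eq_continuous_within)
qed

lemma global_flow_shift:
  assumes "bounded_control u" "global_flow u x y" "a \<ge> 0"
  shows "global_flow (\<lambda>s. u (a + s)) (y a) (\<lambda>s. y (a + s))"
  using assms flow_on_split unfolding global_flow_def by (metis add_nonneg_nonneg)

lemma cost_eq_total_cost:
  assumes u: "bounded_control u" and y: "global_flow u x y"
  shows "cost f g h R x u = total_cost u y"
proof -
  obtain T z where Tz: "maximal_trajectory f g u x = (T, z)" by (cases "maximal_trajectory f g u x")
  note m = maximal_trajectory_global[OF u y Tz]
  have "cost f g h R x u = total_cost u z"
    unfolding cost_def Tz total_cost_def running_def using m(1) by simp
  also have "\<dots> = total_cost u y"
    unfolding total_cost_def running_def
    by (intro nn_integral_cong) (use m(2) in \<open>auto simp: indicator_def\<close>)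
  finally show ?thesis .
qed

lemma cost_finite_global_flow:
  assumes u: "bounded_control u" and "cost f g h R x u < \<infinity>"
  shows "\<exists>y. global_flow u x y"
proof -
  obtain T z where Tz: "maximal_trajectory f g u x = (T, z)" by (cases "maximal_trajectory f g u x")
  have "T = \<infinity>" using assms(2) unfolding cost_def Tz by (auto split: if_splits)
  hence "caratheodory_solution f g u x \<infinity> z"
    using maximal_trajectory_maximal[OF u Tz] unfolding maximal_solution_def by simp
  thus ?thesis using caratheodory_solution_infinity[OF u] by blast
qed

abbreviation V :: "real^'n \<Rightarrow> ennreal" where
  "V \<equiv> optimal_value f g h R"

lemma optimal_value_bounded_controls:
  "V x = (INF u\<in>{u. bounded_control u}. cost f g h R x u)"
proof (rule antisym)
  show "V x \<le> (INF u\<in>{u. bounded_control u}. cost f g h R x u)"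
    unfolding optimal_value_def by (rule INF_superset_mono) (auto intro: bounded_control_admissible)
  show "(INF u\<in>{u. bounded_control u}. cost f g h R x u) \<le> V x"
    unfolding optimal_value_def
  proof (rule INF_mono)
    fix u :: "real \<Rightarrow> real^'m" assume "u \<in> admissible_controls"
    from admissible_control_bounded_version[OF this]
    obtain w N where w: "bounded_control w" "negligible N" "\<forall>t\<ge>0. t \<notin> N \<longrightarrow> w t = u t" by blast
    have "cost f g h R x w = cost f g h R x u" by (rule cost_control_cong[OF w(2)]) (use w in auto)
    thus "\<exists>w\<in>{u. bounded_control u}. cost f g h R x w \<le> cost f g h R x u" using w(1) by auto
  qed
qed

lemma optimal_value_le_cost: "bounded_control u \<Longrightarrow> V x \<le> cost f g h R x u"
  unfolding optimal_value_bounded_controls by (rule INF_lower) simp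

lemma dynamic_programming_lower:
  assumes u: "bounded_control u" and y: "global_flow u x y" and a: "a \<ge> 0"
  shows "ennreal (integral {0..a} (running u y)) + V (y a) \<le> cost f g h R x u"
proof -
  have "V (y a) \<le> cost f g h R (y a) (\<lambda>s. u (a + s))"
    by (rule optimal_value_le_cost[OF bounded_control_shift[OF u]])
  also have "\<dots> = total_cost (\<lambda>s. u (a + s)) (\<lambda>s. y (a + s))"
    by (rule cost_eq_total_cost[OF bounded_control_shift[OF u] global_flow_shift[OF u y a]])
  finally show ?thesis
    unfolding cost_eq_total_cost[OF u y] total_cost_split[OF global_flow_continuous[OF y] u a]
    by (rule add_left_mono)
qed

lemma dynamic_programming_upper:
  assumes u: "bounded_control u" and y: "flow_on u x a y" and a: "a \<ge> 0"
  shows "V x \<le> ennreal (integral {0..a} (running u y)) + V (y a)"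
proof -
  have "V x \<le> ennreal (integral {0..a} (running u y)) + cost f g h R (y a) w" if w: "bounded_control w" for w
  proof (cases "cost f g h R (y a) w < \<infinity>")
    case True
    then obtain z where z: "global_flow w (y a) z" using cost_finite_global_flow[OF w] by blast
    let ?c = "switch a u w" and ?p = "\<lambda>s. if s \<le> a then y s else z (s - a)"
    have c: "bounded_control ?c" by (rule bounded_control_switch[OF u w])
    have "flow_on ?c x (a + t) ?p" if "t \<ge> 0" for t
      using flow_on_concat[OF u w a that y] z that unfolding global_flow_def by blast
    hence "flow_on ?c x t ?p" if "t \<ge> 0" for t
      by (rule flow_on_subset[of _ _ "a + t"]) (use that a in auto)
    hence p: "global_flow ?c x ?p" unfolding global_flow_def by blast
    have z0: "z 0 = y a" using z flow_on_start unfolding global_flow_def by blast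
    have 1: "integral {0..a} (running ?c ?p) = integral {0..a} (running u y)"
      by (rule integral_cong_except_point[of _ a]) (auto simp: running_def switch_def)
    have 2: "total_cost (\<lambda>s. ?c (a + s)) (\<lambda>s. ?p (a + s)) = total_cost w z"
      unfolding total_cost_def running_def
      by (intro nn_integral_cong) (auto simp: indicator_def switch_def z0)
    have "V x \<le> cost f g h R x ?c" by (rule optimal_value_le_cost[OF c])
    also have "\<dots> = ennreal (integral {0..a} (running u y)) + total_cost w z"
      unfolding cost_eq_total_cost[OF c p] total_cost_split[OF global_flow_continuous[OF p] c a] 1 2 ..
    also have "total_cost w z = cost f g h R (y a) w" by (rule cost_eq_total_cost[OF w z, symmetric])
    finally show ?thesis .
  next
    case False
    thus ?thesis by (simp add: not_less top_unique)
  qed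
  hence "V x - ennreal (integral {0..a} (running u y)) \<le> V (y a)"
    unfolding optimal_value_bounded_controls[of "y a"]
    by (intro INF_greatest) (simp add: ennreal_minus_le_iff)
  thus ?thesis by (simp add: ennreal_minus_le_iff)
qed

lemma bounded_control_const: "bounded_control (\<lambda>_. w)"
  unfolding bounded_control_def by auto

lemma optimal_value_0: "V 0 = 0"
proof -
  have "global_flow (\<lambda>_. 0) 0 (\<lambda>_. 0)"
    unfolding global_flow_def flow_on_def field_def by (simp add: f0)
  hence "cost f g h R 0 (\<lambda>_. 0) = total_cost (\<lambda>_. 0) (\<lambda>_. 0)"
    by (rule cost_eq_total_cost[OF bounded_control_const])
  also have "\<dots> = 0" by (simp add: total_cost_def running_def h0)
  finally show ?thesis using optimal_value_le_cost[OF bounded_control_const, of 0 0] by simp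
qed

end

section \<open>The HJB equation for the value function\<close>

text \<open>
  Differentiation at every point, not only almost everywhere: although \<open>F\<close> is merely measurable,
  the difference of both sides, as a function of the upper limit, has derivative \<open>0\<close> throughout.
\<close>

lemma chain_rule_indefinite_integral:
  fixes \<phi> :: "real^'n \<Rightarrow> real" and F y :: "real \<Rightarrow> real^'n"
  assumes grad: "gradient_on S \<phi> G" and yS: "\<And>s. s \<in> {0..a} \<Longrightarrow> y s \<in> S"
    and F: "F \<in> borel_measurable (lebesgue_on {0..a})" "\<And>s. s \<in> {0..a} \<Longrightarrow> norm (F s) \<le> K"
    and y: "\<And>s. s \<in> {0..a} \<Longrightarrow> y s = x + integral {0..s} F" and a: "0 \<le> a"
  shows "(\<lambda>s. F s \<bullet> G (y s)) integrable_on {0..a}"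
    and "\<phi> (y a) - \<phi> x = integral {0..a} (\<lambda>s. F s \<bullet> G (y s))"
proof -
  have K: "K \<ge> 0" using F(2)[of 0] a norm_ge_zero[of "F 0"] by (simp del: norm_ge_zero)
  have Fint: "F integrable_on {0..a}" by (rule bounded_measurable_integrable[OF F])
  have ycont: "continuous_on {0..a} y"
    using indefinite_integral_continuous_1[OF Fint] y
    by (subst continuous_on_cong[OF refl y]) (auto intro!: continuous_intros)
  have Gcont: "continuous_on {0..a} (\<lambda>s. G (y s))"
    by (rule continuous_on_compose2[of S]) (use grad yS ycont in \<open>auto simp: gradient_on_def\<close>)
  have Gm: "(\<lambda>s. G (y s)) \<in> borel_measurable (lebesgue_on {0..a})"
    by (rule continuous_imp_measurable_on_sets_lebesgue[OF Gcont]) auto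
  have "compact ((\<lambda>s. G (y s)) ` {0..a})" by (rule compact_continuous_image[OF Gcont]) auto
  from compact_imp_bounded[OF this, unfolded bounded_iff]
  obtain B where B: "\<And>s. s \<in> {0..a} \<Longrightarrow> norm (G (y s)) \<le> B" by blast
  define P where "P s = F s \<bullet> G (y s)" for s
  have Pint: "P integrable_on {0..a}"
  proof (rule bounded_measurable_integrable[where K = "K * B"])
    show "P \<in> borel_measurable (lebesgue_on {0..a})" unfolding P_def using F(1) Gm by measurable
    show "norm (P s) \<le> K * B" if "s \<in> {0..a}" for s
      using Cauchy_Schwarz_ineq2[of "F s" "G (y s)"] mult_mono[OF F(2)[OF that] B[OF that]] K
      unfolding P_def by simp
  qed
  thus "(\<lambda>s. F s \<bullet> G (y s)) integrable_on {0..a}" unfolding P_def .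
  define I where "I s = integral {0..s} P" for s
  have diff: "y q - y p = integral {p..q} F" "I q - I p = integral {p..q} P"
     "F integrable_on {p..q}" "P integrable_on {p..q}" if "0 \<le> p" "p \<le> q" "q \<le> a" for p q
  proof -
    have "integral {0..p} F + integral {p..q} F = integral {0..q} F"
      by (rule Henstock_Kurzweil_Integration.integral_combine) (use that integrable_subinterval_real[OF Fint] in auto)
    moreover have "integral {0..p} P + integral {p..q} P = integral {0..q} P"
      by (rule Henstock_Kurzweil_Integration.integral_combine) (use that integrable_subinterval_real[OF Pint] in auto)
    ultimately show "y q - y p = integral {p..q} F" "I q - I p = integral {p..q} P"
      using y[of p] y[of q] that by (auto simp: I_def algebra_simps)
    show "F integrable_on {p..q}" "P integrable_on {p..q}"
      using that integrable_subinterval_real[OF Fint] integrable_subinterval_real[OF Pint] by auto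
  qed
  have lip: "norm (y q - y p) \<le> K * \<bar>q - p\<bar>" if "p \<in> {0..a}" "q \<in> {0..a}" for p q
  proof -
    have *: "norm (y q - y p) \<le> K * (q - p)" if "0 \<le> p" "p \<le> q" "q \<le> a" for p q
      unfolding diff(1)[OF that] by (rule norm_integral_le[OF diff(3)[OF that]]) (use that F(2) in auto)
    show ?thesis using *[of p q] *[of q p] that by (cases "p \<le> q") (auto simp: norm_minus_commute)
  qed
  have core: "\<bar>(y q - y p) \<bullet> c - (I q - I p)\<bar> \<le> K * e * (q - p)"
    if pq: "0 \<le> p" "p \<le> q" "q \<le> a" and c: "\<And>r. r \<in> {p..q} \<Longrightarrow> norm (G (y r) - c) \<le> e" for p q c e
  proof -
    have "((\<lambda>r. F r \<bullet> c) has_integral (y q - y p) \<bullet> c) {p..q}"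
      unfolding diff(1)[OF pq]
      using has_integral_linear[OF integrable_integral[OF diff(3)[OF pq]] bounded_linear_inner_left[of c]]
      by (simp add: o_def)
    hence *: "((\<lambda>r. F r \<bullet> c - P r) has_integral (y q - y p) \<bullet> c - (I q - I p)) {p..q}"
      using has_integral_diff integrable_integral[OF diff(4)[OF pq]] diff(2)[OF pq] by metis
    have "norm (integral {p..q} (\<lambda>r. F r \<bullet> c - P r)) \<le> K * e * (q - p)"
    proof (rule norm_integral_le[OF has_integral_integrable[OF *] pq(2)])
      fix r assume r: "r \<in> {p..q}"
      have "F r \<bullet> c - P r = F r \<bullet> (c - G (y r))" by (simp add: P_def inner_diff_right)
      also have "norm \<dots> \<le> norm (F r) * norm (c - G (y r))" using Cauchy_Schwarz_ineq2 by simp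
      also have "\<dots> \<le> K * e" using F(2)[of r] c[OF r] r pq K by (intro mult_mono) (auto simp: norm_minus_commute)
      finally show "norm (F r \<bullet> c - P r) \<le> K * e" .
    qed
    thus ?thesis using integral_unique[OF *] by simp
  qed
  define W where "W s = \<phi> (y s) - I s" for s
  have "(W has_derivative (\<lambda>_. 0)) (at s within {0..a})" if s: "s \<in> {0..a}" for s
    unfolding has_derivative_within_alt
  proof (intro conjI allI impI)
    fix e :: real assume e: "e > 0"
    define e1 where "e1 = e / (2 * (K + 1))"
    have e1: "e1 > 0" "2 * (e1 * K) \<le> e" using e K by (auto simp: e1_def field_simps)
    have "(\<phi> has_derivative (\<lambda>e. e \<bullet> G (y s))) (at (y s))" by (rule gradient_onD[OF grad yS[OF s]])
    then obtain d1 where d1: "d1 > 0" "\<And>z. norm (z - y s) < d1 \<Longrightarrow>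
        norm (\<phi> z - \<phi> (y s) - (z - y s) \<bullet> G (y s)) \<le> e1 * norm (z - y s)"
      using e1(1) unfolding has_derivative_at_alt by blast
    from Gcont s e1(1) obtain d2 where d2: "d2 > 0"
      "\<And>r. r \<in> {0..a} \<Longrightarrow> dist r s < d2 \<Longrightarrow> dist (G (y r)) (G (y s)) < e1"
      unfolding continuous_on_iff by blast
    define d where "d = min d2 (d1 / (K + 1))"
    have d: "d > 0" using d1 d2 K by (simp add: d_def)
    have "norm (W q - W s - 0) \<le> e * norm (q - s)" if q: "q \<in> {0..a}" "norm (q - s) < d" for q
    proof -
      have "K * \<bar>q - s\<bar> \<le> (K + 1) * \<bar>q - s\<bar>" by (intro mult_right_mono) auto
      also have "\<dots> < (K + 1) * (d1 / (K + 1))" using q K by (intro mult_strict_left_mono) (auto simp: d_def)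
      also have "\<dots> = d1" using K by simp
      finally have "norm (y q - y s) < d1" using lip[OF s q(1)] by linarith
      hence "\<bar>\<phi> (y q) - \<phi> (y s) - (y q - y s) \<bullet> G (y s)\<bar> \<le> e1 * norm (y q - y s)" using d1(2) by simp
      also have "\<dots> \<le> e1 * (K * \<bar>q - s\<bar>)" using lip[OF s q(1)] e1 by (intro mult_left_mono) auto
      finally have 1: "\<bar>\<phi> (y q) - \<phi> (y s) - (y q - y s) \<bullet> G (y s)\<bar> \<le> e1 * K * \<bar>q - s\<bar>" by simp
      have near: "norm (G (y r) - G (y s)) \<le> e1" if "r \<in> {min s q..max s q}" for r
        using d2(2)[of r] that s q by (fastforce simp: d_def dist_norm min_def max_def split: if_splits)
      have 2: "\<bar>(y q - y s) \<bullet> G (y s) - (I q - I s)\<bar> \<le> K * e1 * \<bar>q - s\<bar>"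
      proof (cases "s \<le> q")
        case True
        thus ?thesis using core[of s q "G (y s)" e1] near s q by auto
      next
        case False
        hence "\<bar>(y s - y q) \<bullet> G (y s) - (I s - I q)\<bar> \<le> K * e1 * (s - q)"
          using near s q by (intro core) auto
        moreover have "(y s - y q) \<bullet> G (y s) - (I s - I q) = - ((y q - y s) \<bullet> G (y s) - (I q - I s))"
          by (simp add: inner_diff_left)
        ultimately show ?thesis using False by simp
      qed
      have "\<bar>W q - W s\<bar> \<le> 2 * (e1 * K) * \<bar>q - s\<bar>" using 1 2 unfolding W_def by (simp add: mult.commute[of K])
      also have "\<dots> \<le> e * \<bar>q - s\<bar>" using e1(2) by (intro mult_right_mono) auto
      finally show ?thesis by simp
    qed
    thus "\<exists>d>0. \<forall>q\<in>{0..a}. norm (q - s) < d \<longrightarrow> norm (W q - W s - 0) \<le> e * norm (q - s)" using d by blast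
  qed simp
  then obtain c where c: "\<And>s. s \<in> {0..a} \<Longrightarrow> W s = c"
    using has_derivative_zero_constant[of "{0..a}" W] by auto
  have "y 0 = x" using y[of 0] a by simp
  thus "\<phi> (y a) - \<phi> x = integral {0..a} (\<lambda>s. F s \<bullet> G (y s))"
    using c[of 0] c[of a] a unfolding W_def I_def P_def by simp
qed

lemma exit_time:
  fixes y :: "real \<Rightarrow> 'a::metric_space"
  assumes y: "continuous_on {0..1} y" "y 0 = x" and r: "r > 0"
  obtains \<tau> where "0 < \<tau>" "\<tau> \<le> 1" "\<And>s. s \<in> {0..\<tau>} \<Longrightarrow> dist x (y s) \<le> r" "\<tau> = 1 \<or> dist x (y \<tau>) = r"
proof (cases "\<forall>s\<in>{0..1}. dist x (y s) \<le> r")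
  case True
  thus ?thesis using that[of 1] by auto
next
  case False
  let ?A = "{s \<in> {0..1}. r \<le> dist x (y s)}"
  have cont: "continuous_on {0..1} (\<lambda>s. dist x (y s))" using y by (intro continuous_intros)
  have "closed ?A" using cont by (intro continuous_on_closed_Collect_le) auto
  hence "compact ?A" by (simp add: compact_eq_bounded_closed bounded_subset[OF bounded_closed_interval[of 0 1]] subset_eq)
  moreover have "?A \<noteq> {}" using False by force
  ultimately obtain \<tau> where \<tau>: "\<tau> \<in> ?A" "\<forall>s\<in>?A. \<tau> \<le> s" using compact_attains_inf by blast
  have "0 \<notin> ?A" using y r by simp
  hence pos: "0 < \<tau>" using \<tau>(1) by (cases "\<tau> = 0") auto
  have "\<exists>s\<ge>0. s \<le> \<tau> \<and> dist x (y s) = r"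
  proof (rule IVT')
    show "continuous_on {0..\<tau>} (\<lambda>s. dist x (y s))"
      by (rule continuous_on_subset[OF cont]) (use \<tau>(1) in auto)
  qed (use \<tau> y r pos in auto)
  then obtain s where s: "0 \<le> s" "s \<le> \<tau>" "dist x (y s) = r" by blast
  have "s \<in> ?A" using s \<tau>(1) by auto
  hence "s = \<tau>" using \<tau>(2) s(2) by fastforce
  moreover have "dist x (y q) \<le> r" if "q \<in> {0..\<tau>}" for q
    using \<tau> that s(3) \<open>s = \<tau>\<close> by (cases "q = \<tau>") fastforce+
  ultimately show ?thesis using that[of \<tau>] pos \<tau>(1) s(3) by auto
qed

context control_problem
begin

lemma flow_on_value_change:
  assumes u: "bounded_control u" and y: "flow_on u x a y" and a: "0 \<le> a"
    and grad: "gradient_on S \<phi> G" and yS: "\<And>s. s \<in> {0..a} \<Longrightarrow> y s \<in> S"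
  shows "((\<lambda>s. field u y s \<bullet> G (y s) + running u y s) has_integral
    \<phi> (y a) - \<phi> x + integral {0..a} (running u y)) {0..a}"
proof -
  have c: "continuous_on {0..a} y" using y by (simp add: flow_on_def)
  obtain K where K: "\<And>s. s \<in> {0..a} \<Longrightarrow> norm (field u y s) \<le> K" using field_bounded[OF c u] by metis
  have y': "y s = x + integral {0..s} (field u y)" if "s \<in> {0..a}" for s
    using y that by (simp add: flow_on_def)
  have ch: "(\<lambda>s. field u y s \<bullet> G (y s)) integrable_on {0..a}"
      "\<phi> (y a) - \<phi> x = integral {0..a} (\<lambda>s. field u y s \<bullet> G (y s))"
    by (rule chain_rule_indefinite_integral[OF grad yS field_measurable[OF c u] K y' a]; assumption)+
  have "((\<lambda>s. field u y s \<bullet> G (y s)) has_integral \<phi> (y a) - \<phi> x) {0..a}"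
    using integrable_integral[OF ch(1)] unfolding ch(2)[symmetric] .
  thus ?thesis by (rule has_integral_add[OF _ integrable_integral[OF running_integrable[OF c u]]])
qed

text \<open>
  The quadratic term in \<open>\<phi>\<close> penalizes leaving the ball around \<open>x\<close>, so that no lower bound on the
  exit time of nearly optimal trajectories is needed.
\<close>

lemma optimal_value_hjb_le:
  assumes \<Omega>: "open \<Omega>" "x \<in> \<Omega>" and fin: "\<And>x. x \<in> \<Omega> \<Longrightarrow> V x < \<infinity>"
    and v: "\<And>x. x \<in> \<Omega> \<Longrightarrow> v x = enn2real (V x)" and grad: "gradient_on \<Omega> v D"
  shows "hjb_op f g h R x (D x) \<le> 0"
proof (rule ccontr)
  assume "\<not> hjb_op f g h R x (D x) \<le> 0"
  have Vv: "V z = ennreal (v z)" if "z \<in> \<Omega>" for z using fin[OF that] v[OF that] by simp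
  have v0: "v z \<ge> 0" if "z \<in> \<Omega>" for z using v[OF that] by simp
  define \<theta> where "\<theta> = hjb_op f g h R x (D x)"
  have \<theta>: "\<theta> > 0" using \<open>\<not> _\<close> by (simp add: \<theta>_def)
  define \<phi> where "\<phi> z = v z - (z - x) \<bullet> (z - x)" for z
  define G where "G z = D z - 2 *\<^sub>R (z - x)" for z
  have G: "gradient_on \<Omega> \<phi> G" unfolding gradient_on_def
  proof (intro conjI ballI)
    show "continuous_on \<Omega> G" unfolding G_def using grad by (auto simp: gradient_on_def intro!: continuous_intros)
    fix z assume "z \<in> \<Omega>"
    from gradient_onD[OF grad this]
    show "(\<phi> has_derivative (\<lambda>e. e \<bullet> G z)) (at z)" unfolding \<phi>_def G_def
      by (auto intro!: derivative_eq_intros simp: inner_diff_left inner_diff_right inner_commute algebra_simps fun_eq_iff)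
  qed
  have cont: "continuous_on \<Omega> (\<lambda>z. hjb_op f g h R z (G z))"
    using G by (intro continuous_on_hjb_op C1_map_continuous_on[OF C1_f]
        C1_map_continuous_on[OF C1_g] C1_map_continuous_on[OF C1_h]) (simp add: gradient_on_def)
  obtain r1 where r1: "r1 > 0" "cball x r1 \<subseteq> \<Omega>" using \<Omega> open_contains_cball by blast
  have "G x = D x" by (simp add: G_def)
  hence "hjb_op f g h R x (G x) = \<theta>" by (simp add: \<theta>_def)
  moreover from cont \<Omega>(2) \<theta> obtain r2 where r2: "r2 > 0"
    "\<And>z. z \<in> \<Omega> \<Longrightarrow> dist z x < r2 \<Longrightarrow> dist (hjb_op f g h R z (G z)) (hjb_op f g h R x (G x)) < \<theta> / 2"
    unfolding continuous_on_iff by (meson half_gt_zero)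
  ultimately have near: "hjb_op f g h R z (G z) \<ge> \<theta> / 2" if "z \<in> \<Omega>" "dist z x < r2" for z
    using r2(2)[OF that] unfolding dist_real_def by linarith
  define r where "r = min r1 (r2 / 2)"
  have r: "r > 0" "cball x r \<subseteq> \<Omega>" using r1 r2(1) by (auto simp: r_def)
  have low: "hjb_op f g h R z (G z) \<ge> \<theta> / 2" if "z \<in> cball x r" for z
    using near[of z] r(2) that r2(1) by (auto simp: r_def dist_commute)
  define \<epsilon> where "\<epsilon> = min (r\<^sup>2) (\<theta> / 2)"
  have \<epsilon>: "\<epsilon> > 0" using r \<theta> by (simp add: \<epsilon>_def)
  have "V x < ennreal (v x + \<epsilon>)" using Vv[OF \<Omega>(2)] v0[OF \<Omega>(2)] \<epsilon> by (simp add: ennreal_less_iff)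
  then obtain u where u: "bounded_control u" "cost f g h R x u < ennreal (v x + \<epsilon>)"
    unfolding optimal_value_bounded_controls INF_less_iff by auto
  have "cost f g h R x u < \<infinity>" using u(2) by (rule order.strict_trans) simp
  then obtain y where y: "global_flow u x y" using cost_finite_global_flow[OF u(1)] by blast
  have fl: "flow_on u x t y" if "t \<ge> 0" for t using y that by (simp add: global_flow_def)
  have y0: "y 0 = x" using flow_on_start[OF fl] by blast
  have y1: "continuous_on {0..1} y" using fl[of 1] by (simp add: flow_on_def)
  obtain \<tau> where \<tau>: "0 < \<tau>" "\<tau> \<le> 1" "\<And>s. s \<in> {0..\<tau>} \<Longrightarrow> dist x (y s) \<le> r" "\<tau> = 1 \<or> dist x (y \<tau>) = r"
    using exit_time[OF y1 y0 r(1)] by metis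
  have yS: "y s \<in> \<Omega>" if "s \<in> {0..\<tau>}" for s using \<tau>(3)[OF that] r(2) by auto
  define J where "J = integral {0..\<tau>} (running u y)"
  have J0: "J \<ge> 0"
    unfolding J_def using running_nonneg fl[of \<tau>] \<tau> u(1)
    by (intro integral_nonneg running_integrable) (auto simp: flow_on_def)
  have I: "((\<lambda>s. field u y s \<bullet> G (y s) + running u y s) has_integral \<phi> (y \<tau>) - \<phi> x + J) {0..\<tau>}"
    unfolding J_def by (rule flow_on_value_change[OF u(1) fl _ G yS]) (use \<tau> in auto)
  have I\<theta>: "((\<lambda>s. \<theta> / 2) has_integral (\<theta> / 2 * \<tau>)) {0..\<tau>}"
    using has_integral_const_real[of "\<theta> / 2" 0 \<tau>] \<tau> by (simp add: mult.commute)
  have "\<theta> / 2 \<le> field u y s \<bullet> G (y s) + running u y s" if "s \<in> {0..\<tau>}" for s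
  proof -
    have "\<theta> / 2 \<le> hjb_op f g h R (y s) (G (y s))" using low \<tau>(3)[OF that] by simp
    also have "\<dots> \<le> G (y s) \<bullet> (f (y s) + g (y s) *v u s) + h (y s) + u s \<bullet> (R *v u s)"
      by (rule hjb_op_le[OF R])
    finally show ?thesis by (simp add: field_def running_def inner_commute)
  qed
  hence gain: "\<theta> / 2 * \<tau> \<le> \<phi> (y \<tau>) - \<phi> x + J" by (rule has_integral_le[OF I\<theta> I])
  have y\<tau>: "y \<tau> \<in> \<Omega>" using yS \<tau> by simp
  have "ennreal J + V (y \<tau>) < ennreal (v x + \<epsilon>)"
    using dynamic_programming_lower[OF u(1) y, of \<tau>] \<tau> u(2) unfolding J_def by (simp add: le_less_trans)
  hence "J + v (y \<tau>) < v x + \<epsilon>"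
    using J0 v0[OF y\<tau>] v0[OF \<Omega>(2)] \<epsilon> by (simp add: Vv[OF y\<tau>] ennreal_less_iff flip: ennreal_plus)
  hence less: "(y \<tau> - x) \<bullet> (y \<tau> - x) + \<theta> / 2 * \<tau> < \<epsilon>"
    using gain by (simp add: \<phi>_def)
  show False
  proof (cases "\<tau> = 1")
    case True
    moreover have "(y \<tau> - x) \<bullet> (y \<tau> - x) \<ge> 0" by simp
    ultimately show False using less unfolding \<epsilon>_def by (auto simp del: inner_ge_zero)
  next
    case False
    hence "dist x (y \<tau>) = r" using \<tau>(4) by blast
    hence "(y \<tau> - x) \<bullet> (y \<tau> - x) = r\<^sup>2" by (simp add: dist_norm norm_minus_commute power2_norm_eq_inner[symmetric])
    moreover have "\<theta> / 2 * \<tau> \<ge> 0" using \<theta> \<tau> by simp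
    ultimately show False using less by (simp add: \<epsilon>_def)
  qed
qed

lemma optimal_value_hjb_ge:
  assumes \<Omega>: "open \<Omega>" "x \<in> \<Omega>" and fin: "\<And>x. x \<in> \<Omega> \<Longrightarrow> V x < \<infinity>"
    and v: "\<And>x. x \<in> \<Omega> \<Longrightarrow> v x = enn2real (V x)" and grad: "gradient_on \<Omega> v D"
  shows "hjb_op f g h R x (D x) \<ge> 0"
proof (rule ccontr)
  assume neg: "\<not> hjb_op f g h R x (D x) \<ge> 0"
  have Vv: "V z = ennreal (v z)" if "z \<in> \<Omega>" for z using fin[OF that] v[OF that] by simp
  have v0: "v z \<ge> 0" if "z \<in> \<Omega>" for z using v[OF that] by simp
  obtain w where w: "D x \<bullet> (f x + g x *v w) + h x + w \<bullet> (R *v w) = hjb_op f g h R x (D x)"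
    by (rule hjb_op_attained[OF R])
  define q where "q z = D z \<bullet> (f z + g z *v w) + h z + w \<bullet> (R *v w)" for z
  define \<theta> where "\<theta> = - q x"
  have \<theta>: "\<theta> > 0" using w neg by (simp add: \<theta>_def q_def)
  have "continuous_on \<Omega> q"
    unfolding q_def using grad
    by (intro continuous_intros continuous_on_matrix_vector_mult C1_map_continuous_on[OF C1_f]
        C1_map_continuous_on[OF C1_g] C1_map_continuous_on[OF C1_h]) (simp add: gradient_on_def)
  with \<Omega>(2) \<theta> obtain r2 where r2: "r2 > 0"
    "\<And>z. z \<in> \<Omega> \<Longrightarrow> dist z x < r2 \<Longrightarrow> dist (q z) (q x) < \<theta>"
    unfolding continuous_on_iff by meson
  obtain r1 where r1: "r1 > 0" "ball x r1 \<subseteq> \<Omega>" using \<Omega> open_contains_ball by blast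
  have u: "bounded_control (\<lambda>_. w)" by (rule bounded_control_const)
  obtain \<delta> y where y: "\<delta> > 0" "flow_on (\<lambda>_. w) x \<delta> y" using flow_on_exists[OF u] by blast
  have y0: "y 0 = x" using flow_on_start y by fastforce
  have "continuous_on {0..\<delta>} y" using y by (simp add: flow_on_def)
  moreover have "min r1 r2 > 0" using r1 r2 by simp
  ultimately obtain d where d: "d > 0" "\<And>s. s \<in> {0..\<delta>} \<Longrightarrow> dist s 0 < d \<Longrightarrow> dist (y s) (y 0) < min r1 r2"
    using y(1) unfolding continuous_on_iff by (metis atLeastAtMost_iff less_eq_real_def order.refl)
  define a where "a = min \<delta> (d / 2)"
  have a: "a > 0" "a \<le> \<delta>" using y(1) d(1) by (auto simp: a_def)
  have close: "dist (y s) x < min r1 r2" if "s \<in> {0..a}" for s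
    using d(2)[of s] that a d(1) y0 by (auto simp: a_def)
  have yS: "y s \<in> \<Omega>" if "s \<in> {0..a}" for s
    using close[OF that] r1(2) by (auto simp: dist_commute subset_eq)
  have fl: "flow_on (\<lambda>_. w) x a y" by (rule flow_on_subset[OF y(2) a(2)])
  define J where "J = integral {0..a} (running (\<lambda>_. w) y)"
  have J0: "J \<ge> 0"
    unfolding J_def using running_nonneg fl u
    by (intro integral_nonneg running_integrable) (auto simp: flow_on_def)
  have I: "((\<lambda>s. field (\<lambda>_. w) y s \<bullet> D (y s) + running (\<lambda>_. w) y s) has_integral v (y a) - v x + J) {0..a}"
    unfolding J_def by (rule flow_on_value_change[OF u fl _ grad yS]) (use a in auto)
  have integrand: "field (\<lambda>_. w) y s \<bullet> D (y s) + running (\<lambda>_. w) y s = q (y s)" for s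
    by (simp add: field_def running_def q_def inner_commute)
  have ya: "y a \<in> \<Omega>" using yS a by simp
  have "V x \<le> ennreal J + V (y a)" unfolding J_def by (rule dynamic_programming_upper[OF u fl]) (use a in simp)
  hence "v x \<le> J + v (y a)"
    using J0 v0[OF ya] by (simp add: Vv[OF ya] Vv[OF \<Omega>(2)] ennreal_le_iff flip: ennreal_plus)
  hence nonneg: "v (y a) - v x + J \<ge> 0" by simp
  have cq: "continuous_on {0..a} (\<lambda>s. q (y s))"
    by (rule continuous_on_compose2[OF \<open>continuous_on \<Omega> q\<close>]) (use fl yS in \<open>auto simp: flow_on_def\<close>)
  have "q (y s) < 0" if "s \<in> {0..a}" for s
    using r2(2)[OF yS[OF that]] close[OF that] by (simp add: \<theta>_def dist_real_def)
  moreover obtain m where m: "m \<in> {0..a}" "\<And>s. s \<in> {0..a} \<Longrightarrow> q (y s) \<le> q (y m)"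
    using continuous_attains_sup[OF _ _ cq] a by auto
  ultimately have qm: "q (y m) < 0" by blast
  have "((\<lambda>s. q (y m)) has_integral (q (y m) * a)) {0..a}"
    using has_integral_const_real[of "q (y m)" 0 a] a by (simp add: mult.commute)
  with I have "v (y a) - v x + J \<le> q (y m) * a"
    by (rule has_integral_le) (use m in \<open>simp add: integrand\<close>)
  moreover have "q (y m) * a < 0" using qm a by (simp add: mult_neg_pos)
  ultimately show False using nonneg by linarith
qed

end

section \<open>Convergence of the minimizers\<close>

lemma subseq_convergence_real:
  fixes a :: "nat \<Rightarrow> real"
  assumes "\<And>r. strict_mono r \<Longrightarrow> \<exists>t. strict_mono (t :: nat \<Rightarrow> nat) \<and> (\<lambda>n. a (r (t n))) \<longlonglongrightarrow> l"
  shows "a \<longlonglongrightarrow> l"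
proof (rule ccontr)
  assume "\<not> a \<longlonglongrightarrow> l"
  then obtain e where e: "e > 0" "\<forall>N. \<exists>n\<ge>N. \<not> \<bar>a n - l\<bar> < e"
    unfolding LIMSEQ_iff real_norm_def by blast
  hence "infinite {n. \<not> \<bar>a n - l\<bar> < e}" by (simp add: infinite_nat_iff_unbounded_le)
  then obtain r :: "nat \<Rightarrow> nat" where r: "strict_mono r" "\<And>n. r n \<in> {n. \<not> \<bar>a n - l\<bar> < e}"
    using infinite_enumerate by blast
  obtain t where "strict_mono (t :: nat \<Rightarrow> nat)" "(\<lambda>n. a (r (t n))) \<longlonglongrightarrow> l"
    using assms[OF r(1)] by blast
  hence "\<exists>n. \<bar>a (r (t n)) - l\<bar> < e" using e(1) unfolding LIMSEQ_iff real_norm_def by blast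
  thus False using r(2) by blast
qed

lemma minimal_norm_interpolants_converge:
  fixes f :: "real^'n \<Rightarrow> real^'n" and g :: "real^'n \<Rightarrow> real^'m^'n" and X :: "nat \<Rightarrow> (real^'n) set"
  assumes fgh: "continuous_on UNIV f" "continuous_on UNIV g" "continuous_on UNIV h"
    and R: "sym_pos_def R" and h: "\<And>x. x \<noteq> 0 \<Longrightarrow> h x > 0"
    and \<Omega>: "open \<Omega>" "connected \<Omega>" "0 \<in> \<Omega>"
    and X: "incseq X" "\<And>n. finite (X n)" "\<And>n. X n \<subseteq> \<Omega>" "\<Omega> \<subseteq> closure (\<Union>n. X n)"
    and rk: "rkhs \<Omega> k H ip" and an: "\<And>\<phi>. \<phi> \<in> H \<Longrightarrow> real_analytic_on \<phi> \<Omega>"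
    and w: "w \<in> H" "w 0 = 0" "\<And>x. x \<in> \<Omega> \<Longrightarrow> w x \<ge> 0" "\<And>x. x \<in> \<Omega> \<Longrightarrow> hjb_residual f g h R w x = 0"
    and v: "\<And>n. v n \<in> minimizers f g h R H ip (X n)"
  shows "(\<lambda>n. hnorm ip (\<lambda>x\<in>\<Omega>. v n x - w x)) \<longlonglongrightarrow> 0"
proof (rule subseq_convergence_real)
  interpret rkhs \<Omega> k H ip by fact
  fix r :: "nat \<Rightarrow> nat" assume r: "strict_mono r"
  have grad: "gradient_on \<Omega> \<phi> (grad \<phi>)" if "\<phi> \<in> H" for \<phi>
    by (rule real_analytic_gradient_on[OF an[OF that]])
  have vf: "v n \<in> H" "\<And>x. x \<in> X n \<Longrightarrow> hjb_op f g h R x (grad (v n) x) = 0"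
    "\<And>x. x \<in> X n \<Longrightarrow> v n x \<ge> 0" "v n 0 = 0" for n
    using v[of n] hjb_residual_eq[OF R, of f g h] unfolding minimizers_def feasible_def by auto
  have "w \<in> feasible f g h R H (X n)" for n
    unfolding feasible_def using w X(3)[of n] by blast
  hence vw: "hnorm ip (v n) \<le> hnorm ip w" for n
    using v[of n] unfolding minimizers_def by blast
  define D where "D = (\<Union>n. X n)"
  have D: "countable D" "D \<subseteq> \<Omega>" "\<Omega> \<subseteq> closure D"
    unfolding D_def using X by (auto intro: countable_finite)
  define F :: "((real^'n \<Rightarrow> real) \<Rightarrow> real) set" where
    "F = insert (\<lambda>\<phi>. ip \<phi> w) ((\<lambda>x \<phi>. \<phi> x) ` insert 0 D \<union> (\<lambda>(x, e) \<phi>. e \<bullet> grad \<phi> x) ` (D \<times> Basis))"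
  have F: "countable F"
    unfolding F_def using D(1) countable_finite[OF finite_Basis]
    by (intro countable_insert countable_Un countable_image countable_SIGMA)
  have FL: "bounded_functional L" if L: "L \<in> F" for L
  proof -
    consider "L = (\<lambda>\<phi>. ip \<phi> w)" | x where "x \<in> \<Omega>" "L = (\<lambda>\<phi>. \<phi> x)"
      | x e where "x \<in> \<Omega>" "L = (\<lambda>\<phi>. e \<bullet> grad \<phi> x)"
      using L \<Omega>(3) D(2) unfolding F_def by auto
    thus ?thesis
    proof cases
      case 3
      show ?thesis unfolding 3(2)
        by (rule bounded_functional_directional_derivative[OF rk \<Omega>(1) 3(1) gradient_onD[OF grad 3(1)]])
    qed (use bounded_functional_ip[OF w(1)] bounded_functional_eval in auto)
  qed
  obtain t p where t: "strict_mono t" and p: "p \<in> H" and lim: "\<forall>L\<in>F. (\<lambda>n. L (v (r (t n)))) \<longlonglongrightarrow> L p"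
    by (rule bounded_sequence_weak_subsequence[of "\<lambda>n. v (r n)" "hnorm ip w", OF vf(1) vw F FL])
  have mono: "strict_mono (\<lambda>n. r (t n))" using strict_mono_o[OF r t] by (simp add: o_def)
  have lim_eval: "(\<lambda>n. v (r (t n)) x) \<longlonglongrightarrow> p x" if "x \<in> insert 0 D" for x
  proof -
    have "(\<lambda>\<phi>. \<phi> x) \<in> F" using that unfolding F_def by blast
    from bspec[OF lim this] show ?thesis .
  qed
  have lim_grad: "(\<lambda>n. grad (v (r (t n))) x) \<longlonglongrightarrow> grad p x" if "x \<in> D" for x
    unfolding tendsto_componentwise_iff[of "\<lambda>n. grad (v (r (t n))) x"]
  proof
    fix e :: "real^'n" assume "e \<in> Basis"
    hence "(\<lambda>\<phi>. e \<bullet> grad \<phi> x) \<in> F" using that unfolding F_def by (auto intro!: image_eqI[of _ _ "(x, e)"])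
    from bspec[OF lim this] show "(\<lambda>n. grad (v (r (t n))) x \<bullet> e) \<longlonglongrightarrow> grad p x \<bullet> e"
      by (simp add: inner_commute)
  qed
  have ev: "\<forall>\<^sub>F n in sequentially. x \<in> X (r (t n))" if "x \<in> D" for x
  proof -
    from that obtain m where m: "x \<in> X m" unfolding D_def by blast
    have "x \<in> X (r (t n))" if "n \<ge> m" for n
      using seq_suble[OF mono, of n] that m X(1) unfolding incseq_def by (meson order_trans subsetD)
    thus ?thesis unfolding eventually_sequentially by blast
  qed
  have hjbD: "hjb_op f g h R x (grad p x) = 0" if x: "x \<in> D" for x
  proof -
    have "continuous_on UNIV (\<lambda>d. hjb_op f g h R x d)"
      unfolding hjb_op_def
      by (intro continuous_intros continuous_on_matrix_vector_mult)
    hence "(\<lambda>n. hjb_op f g h R x (grad (v (r (t n))) x)) \<longlonglongrightarrow> hjb_op f g h R x (grad p x)"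
      by (rule continuous_on_tendsto_compose[OF _ lim_grad[OF x]]) auto
    moreover have "\<forall>\<^sub>F n in sequentially. hjb_op f g h R x (grad (v (r (t n))) x) = 0"
      using ev[OF x] by eventually_elim (rule vf(2))
    ultimately show ?thesis using tendsto_cong[of _ "\<lambda>_. 0"] LIMSEQ_unique tendsto_const by metis
  qed
  have pD: "p x \<ge> 0" if x: "x \<in> D" for x
    by (rule tendsto_lowerbound[OF lim_eval]) (use x in \<open>auto intro: eventually_mono[OF ev[OF x]] vf(3)\<close>)
  have seqD: "\<exists>q. (\<forall>n. q n \<in> D) \<and> q \<longlonglongrightarrow> x" if "x \<in> \<Omega>" for x
    using subsetD[OF D(3) that] by (simp only: closure_sequential)
  have p0: "p 0 = 0" using lim_eval[of 0] by (simp add: vf(4) LIMSEQ_const_iff)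
  have hjb: "hjb_op f g h R x (grad p x) = 0" if x: "x \<in> \<Omega>" for x
  proof -
    obtain q where q: "\<And>n. q n \<in> D" "q \<longlonglongrightarrow> x" using seqD[OF x] by blast
    have "continuous_on \<Omega> (\<lambda>x. hjb_op f g h R x (grad p x))"
      using grad[OF p] fgh by (intro continuous_on_hjb_op) (auto simp: gradient_on_def elim: continuous_on_subset)
    hence "(\<lambda>n. hjb_op f g h R (q n) (grad p (q n))) \<longlonglongrightarrow> hjb_op f g h R x (grad p x)"
      by (rule continuous_on_tendsto_compose[OF _ q(2) x]) (intro always_eventually allI subsetD[OF D(2)] q(1))
    thus ?thesis using hjbD q(1) LIMSEQ_unique[OF _ tendsto_const] by auto
  qed
  have pos: "p x \<ge> 0" if x: "x \<in> \<Omega>" for x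
  proof -
    obtain q where q: "\<And>n. q n \<in> D" "q \<longlonglongrightarrow> x" using seqD[OF x] by blast
    have "(\<lambda>n. p (q n)) \<longlonglongrightarrow> p x"
      by (rule continuous_on_tendsto_compose[OF gradient_on_imp_continuous_on[OF grad[OF p]] q(2) x])
        (intro always_eventually allI subsetD[OF D(2)] q(1))
    thus ?thesis by (rule LIMSEQ_le_const) (use pD q in auto)
  qed
  have hjbw: "hjb_op f g h R x (grad w x) = 0" if "x \<in> \<Omega>" for x
    using w(4)[OF that] hjb_residual_eq[OF R, of f g h] by simp
  obtain \<delta>1 where \<delta>1: "\<delta>1 > 0" "ball 0 \<delta>1 \<subseteq> \<Omega>" "\<forall>x\<in>ball 0 \<delta>1. p x \<le> w x"
    using hjb_comparison[OF R \<Omega>(1,3) h grad[OF w(1)] grad[OF p] w(3) w(2) p0 hjbw hjb] by blast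
  obtain \<delta>2 where \<delta>2: "\<delta>2 > 0" "ball 0 \<delta>2 \<subseteq> \<Omega>" "\<forall>x\<in>ball 0 \<delta>2. w x \<le> p x"
    using hjb_comparison[OF R \<Omega>(1,3) h grad[OF p] grad[OF w(1)] pos p0 w(2) hjb hjbw] by blast
  have "sub p w x = 0" if "x \<in> \<Omega>" for x
  proof (rule real_analytic_identity[OF an \<Omega>(1,2), of "sub p w" "ball 0 (min \<delta>1 \<delta>2)"])
    fix y :: "real^'n" assume "y \<in> ball 0 (min \<delta>1 \<delta>2)"
    hence "y \<in> \<Omega>" "p y \<le> w y" "w y \<le> p y" using \<delta>1 \<delta>2 by auto
    thus "sub p w y = 0" by (simp add: sub_def)
  qed (use that p w \<delta>1 \<delta>2 in auto)
  hence "p x = w x" if "x \<in> \<Omega>" for x using that by (simp add: sub_def)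
  hence pw: "p = w" using p w(1) extensional by (intro extensionalityI[of p \<Omega> w]) auto
  have "(\<lambda>\<phi>. ip \<phi> w) \<in> F" unfolding F_def by blast
  from bspec[OF lim this] have ipw: "(\<lambda>n. ip (v (r (t n))) w) \<longlonglongrightarrow> ip w w" by (simp add: pw)
  have "(\<lambda>n. (hnorm ip (sub (v (r (t n))) w))\<^sup>2) \<longlonglongrightarrow> 0"
  proof (rule tendsto_sandwich[where f = "\<lambda>_. 0"])
    show "(\<lambda>n. 2 * ip w w - 2 * ip (v (r (t n))) w) \<longlonglongrightarrow> 0"
      using tendsto_diff[OF tendsto_const[of "2 * ip w w"] tendsto_mult_left[OF ipw, of 2]] by simp
    have "(hnorm ip (sub (v n) w))\<^sup>2 \<le> 2 * ip w w - 2 * ip (v n) w" for n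
    proof -
      have "ip (v n) (v n) \<le> ip w w"
        using power_mono[OF vw[of n] hnorm_nonneg[OF vf(1)], of 2] vf(1) w(1) by (simp add: hnorm_squared)
      thus ?thesis using vf(1) w(1) by (simp add: hnorm_squared ip_sub_self)
    qed
    thus "\<forall>\<^sub>F n in sequentially. (hnorm ip (sub (v (r (t n))) w))\<^sup>2 \<le> 2 * ip w w - 2 * ip (v (r (t n))) w" by simp
  qed auto
  hence "(\<lambda>n. sqrt ((hnorm ip (sub (v (r (t n))) w))\<^sup>2)) \<longlonglongrightarrow> sqrt 0" by (rule tendsto_real_sqrt)
  hence "(\<lambda>n. hnorm ip (sub (v (r (t n))) w)) \<longlonglongrightarrow> 0"
    using hnorm_nonneg vf(1) w(1) by simp
  thus "\<exists>t. strict_mono (t :: nat \<Rightarrow> nat) \<and> (\<lambda>n. hnorm ip (\<lambda>x\<in>\<Omega>. v (r (t n)) x - w x)) \<longlonglongrightarrow> 0"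
    using t unfolding sub_def by blast
qed

theorem theorem4p1:
  fixes f :: "real^'n \<Rightarrow> real^'n"
    and g :: "real^'n \<Rightarrow> real^'m^'n"
    and h :: "real^'n \<Rightarrow> real"
    and R :: "real^'m^'m"
    and \<Omega> :: "(real^'n) set"
    and X :: "nat \<Rightarrow> (real^'n) set"
    and k :: "real^'n \<Rightarrow> real^'n \<Rightarrow> real"
    and H :: "(real^'n \<Rightarrow> real) set"
    and ip :: "(real^'n \<Rightarrow> real) \<Rightarrow> (real^'n \<Rightarrow> real) \<Rightarrow> real"
    and vstar :: "real^'n \<Rightarrow> real"
    and v :: "nat \<Rightarrow> real^'n \<Rightarrow> real"
  assumes "C1_map f" and "C1_map g" and "C1_map h"
    and "sym_pos_def R"
    and "f 0 = 0" and "h 0 = 0" and "\<And>x. x \<noteq> 0 \<Longrightarrow> h x > 0"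
    and "open \<Omega>" and "connected \<Omega>" and "0 \<in> \<Omega>"
    and "incseq X" and "\<And>n. finite (X n)" and "\<And>n. X n \<subseteq> \<Omega> - {0}"
    and "\<Omega> \<subseteq> closure (\<Union>n. X n)"
    and "pos_def_kernel \<Omega> k"
    and "rkhs \<Omega> k H ip"
    and "\<And>\<phi>. \<phi> \<in> H \<Longrightarrow> real_analytic_on \<phi> \<Omega>"
    and "\<And>x. x \<in> \<Omega> \<Longrightarrow> optimal_value f g h R x < \<infinity>"
    and "vstar = (\<lambda>x\<in>\<Omega>. enn2real (optimal_value f g h R x))"
    and "vstar \<in> H"
    and "\<And>n. v n \<in> minimizers f g h R H ip (X n)"
  shows "(\<lambda>n. hnorm ip (\<lambda>x\<in>\<Omega>. v n x - vstar x)) \<longlonglongrightarrow> 0"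
proof -
  interpret control_problem f g h R
    by unfold_locales (fact assms(1-7))+
  have vstar: "vstar x = enn2real (V x)" if "x \<in> \<Omega>" for x using that assms(19) by simp
  have "gradient_on \<Omega> vstar (grad vstar)"
    by (rule real_analytic_gradient_on[OF assms(17)[OF assms(20)]])
  hence "hjb_op f g h R x (grad vstar x) = 0" if "x \<in> \<Omega>" for x
    using optimal_value_hjb_le[OF assms(8) that assms(18) vstar]
      optimal_value_hjb_ge[OF assms(8) that assms(18) vstar] by (intro antisym)
  moreover have "vstar 0 = 0" using vstar[OF assms(10)] optimal_value_0 by simp
  moreover have "X n \<subseteq> \<Omega>" for n using assms(13)[of n] by blast
  ultimately show ?thesis
    using assms vstar hjb_residual_eq[OF assms(4), of f g h]
    by (intro minimal_norm_interpolants_converge[of f g h R \<Omega> X k H ip vstar v]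
        C1_map_continuous_on[OF assms(1)] C1_map_continuous_on[OF assms(2)] C1_map_continuous_on[OF assms(3)]) auto
qed

end
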